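(* Let $\Phi$ be an irreducible finite root system and let $R$ be a ranked poset with edges colored by the index set $I$ for a choice of simple roots. Minuscule case: $R$ is (isomorphic to) a minuscule splitting poset if and only if it is connected, fibrous, and $\Phi$-structured; has at least one edge; and has the following properties: (1) $l_i(\mathbf x)\le 1$ for all $i\in I$ and $\mathbf x\in R$, and (2) whenever $\langle\alpha_i,\alpha_j^\vee\rangle=0=\langle\alpha_j,\alpha_i^\vee\rangle$, then any $\{i,j\}$-component of $R$ has a unique maximal element. In this case, $R$ has a unique maximal element $\mathbf m$, $\lambda:=wt(\mathbf m)$ is dominant and minuscule, and $R\cong R(\lambda)$. Quasi-minuscule case: $R$ is (isomorphic to) a quasi-minuscule splitting poset if and only if it is connected, fibrous, and $\Phi$-structured; has an $i$-component of length at least two for some $i\in I$; and has the following properties: (1) if $l_i(\mathbf x)\ge2$ for some $i\in I$ and $\mathbf x\in R$, then $\mathrm{comp}_i(\mathbf x)$ is a chain $\mathbf x_0\xrightarrow{i}\mathbf x_1\xrightarrow{i}\mathbf x_2$ such that $\delta_j(\mathbf x_0)=0=\rho_j(\mathbf x_2)$ and $\mathrm{comp}_j(\mathbf x_1)=\{\mathbf x_1\}$ for all $j\ne i$; (2) whenever $\langle\alpha_i,\alpha_j^\vee\rangle=0=\langle\alpha_j,\alpha_i^\vee\rangle$, then any $\{i,j\}$-component of $R$ has a unique maximal element; and (3) whenever $\langle\alpha_i,\alpha_j^\vee\rangle=-1=\langle\alpha_j,\alpha_i^\vee\rangle$, then any $\{i,j\}$-component of $R$ has a unique maximal element. In this case,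 $R$ has a unique maximal element $\mathbf m$, $\lambda:=wt(\mathbf m)$ is dominant and quasi-minuscule, and $R\cong R(\lambda)$.
   Context: $\Phi$ is a finite (reduced, crystallographic) root system in a Euclidean space with simple roots $\{\alpha_i\}_{i\in I}$, $\alpha^\vee=2\alpha/\langle\alpha,\alpha\rangle$, fundamental weights $\omega_i$ dual to simple coroots, $\Lambda=\bigoplus\mathbb Z\omega_i$, $\Lambda^+=\bigoplus\mathbb Z_{\ge0}\omega_i$, Weyl group $W$; $\mu\le\nu$ in $\Lambda$ iff $\nu-\mu$ is a nonnegative integer combination of simple roots. In the simply laced irreducible case all roots are regarded as short. All posets are finite, identified with Hasse diagrams (edge $\mathbf s\to\mathbf t$ iff $\mathbf t$ covers $\mathbf s$). Ranked means there is a surjection $\rho:R\to\{0,\dots,l\}$ with $\rho(\mathbf s)+1=\rho(\mathbf t)$ whenever $\mathbf s\to\mathbf t$; $l$ is the length. If Hasse edges are colored by $I$ and $J\subseteq I$, a $J$-component is a connected component of the graph retaining only edges with colors in $J$, and $\mathrm{comp}_i(\mathbf x)$ is the $\{i\}$-component containing $\mathbf x$ ("$i$-component"); $\rho_i(\mathbf x)$ is the rank of $\mathbf x$ in $\mathrm{comp}_i(\mathbf x)$, $l_i(\mathbf x)$ its length, $\delta_i=l_i-\rho_i$, $m_i=\rho_i-\delta_i$, $wt(\mathbf x)=\sum_i m_i(\mathbf x)\omega_i$. $R$ is $\Phi$-structured if $wt(\mathbf s)+\alpha_i=wt(\mathbf t)$ whenever $\mathbf s\xrightarrow{i}\mathbf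 t$; fibrous if every $i$-component is a chain for every $i\in I$. Isomorphism ($\cong$) means isomorphism of edge-colored directed graphs. A nonzero weight $\mu\in\Lambda$ is minuscule if $\langle\mu,\alpha^\vee\rangle\in\{0,\pm1\}$ for all $\alpha\in\Phi$; it is quasi-minuscule if $\langle\mu,\alpha^\vee\rangle\in\{0,\pm1,\pm2\}$ for all $\alpha\in\Phi$ and there is a unique $\beta\in\Phi$ with $\langle\mu,\beta^\vee\rangle=2$. (The dominant quasi-minuscule weight is the highest short root.) For $\lambda$ dominant and minuscule, the minuscule splitting poset $R(\lambda)$ is the $W$-orbit $W\lambda$ with edges $\mu\xrightarrow{i}\nu$ iff $\mu+\alpha_i=\nu$. For $\lambda$ dominant and quasi-minuscule, the quasi-minuscule splitting poset $R(\lambda)$ has vertex set $W\lambda\sqcup\{\overline{\alpha_i}:\alpha_i\text{ a short simple root}\}$ (the $\overline{\alpha_i}$ being distinct new symbols), with edges: $\alpha\xrightarrow{i}\beta$ for $\alpha,\beta\in W\lambda$ with $\alpha+\alpha_i=\beta$; and $-\alpha_i\xrightarrow{i}\overline{\alpha_i}\xrightarrow{i}\alpha_i$ for each short simple $\alpha_i$. *)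

theory Defs
  imports "HOL-Analysis.Analysis"
begin

section \<open>Root systems\<close>

definition coroot :: "'a::euclidean_space \<Rightarrow> 'a" where
  "coroot \<alpha> = (2 / (\<alpha> \<bullet> \<alpha>)) *\<^sub>R \<alpha>"

definition reflect :: "'a::euclidean_space \<Rightarrow> 'a \<Rightarrow> 'a" where
  "reflect \<alpha> v = v - (v \<bullet> coroot \<alpha>) *\<^sub>R \<alpha>"

text \<open>Finite, reduced, crystallographic.  The ambient Euclidean space is the type, which the roots
  span.\<close>

definition root_system :: "'a::euclidean_space set \<Rightarrow> bool" where
  "root_system \<Phi> \<longleftrightarrow>
     finite \<Phi> \<and> 0 \<notin> \<Phi> \<and> span \<Phi> = UNIV \<and>
     (\<forall>\<alpha>\<in>\<Phi>. reflect \<alpha> ` \<Phi> = \<Phi>) \<and>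
     (\<forall>\<alpha>\<in>\<Phi>. \<forall>\<beta>\<in>\<Phi>. \<alpha> \<bullet> coroot \<beta> \<in> \<int>) \<and>
     (\<forall>\<alpha>\<in>\<Phi>. \<forall>c. c *\<^sub>R \<alpha> \<in> \<Phi> \<longrightarrow> c = 1 \<or> c = - 1)"

definition irreducible_root_system :: "'a::euclidean_space set \<Rightarrow> bool" where
  "irreducible_root_system \<Phi> \<longleftrightarrow>
     root_system \<Phi> \<and> \<Phi> \<noteq> {} \<and>
     \<not> (\<exists>\<Phi>\<^sub>1 \<Phi>\<^sub>2. \<Phi>\<^sub>1 \<noteq> {} \<and> \<Phi>\<^sub>2 \<noteq> {} \<and> \<Phi> = \<Phi>\<^sub>1 \<union> \<Phi>\<^sub>2 \<and>
          (\<forall>\<alpha>\<in>\<Phi>\<^sub>1. \<forall>\<beta>\<in>\<Phi>\<^sub>2. \<alpha> \<bullet> \<beta> = 0))"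

definition simple_roots :: "'a::euclidean_space set \<Rightarrow> 'i set \<Rightarrow> ('i \<Rightarrow> 'a) \<Rightarrow> bool" where
  "simple_roots \<Phi> I \<alpha> \<longleftrightarrow>
     inj_on \<alpha> I \<and> \<alpha> ` I \<subseteq> \<Phi> \<and> independent (\<alpha> ` I) \<and> span (\<alpha> ` I) = UNIV \<and>
     (\<forall>\<beta>\<in>\<Phi>. \<exists>c :: 'i \<Rightarrow> int. \<beta> = (\<Sum>i\<in>I. of_int (c i) *\<^sub>R \<alpha> i) \<and>
        ((\<forall>i\<in>I. c i \<ge> 0) \<or> (\<forall>i\<in>I. c i \<le> 0)))"

text \<open>Roots of minimal length, so that every root is short in the simply laced irreducible case.\<close>

definition short_root :: "'a::euclidean_space set \<Rightarrow> 'a \<Rightarrow> bool" where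
  "short_root \<Phi> \<alpha> \<longleftrightarrow> \<alpha> \<in> \<Phi> \<and> (\<forall>\<beta>\<in>\<Phi>. norm \<alpha> \<le> norm \<beta>)"

text \<open>The group generated by the reflections; since these are involutions, closing under composition
  is enough.\<close>

inductive_set weyl_group :: "'a::euclidean_space set \<Rightarrow> ('a \<Rightarrow> 'a) set" for \<Phi> where
  one: "id \<in> weyl_group \<Phi>"
| refl: "w \<in> weyl_group \<Phi> \<Longrightarrow> \<alpha> \<in> \<Phi> \<Longrightarrow> reflect \<alpha> \<circ> w \<in> weyl_group \<Phi>"

definition weyl_orbit :: "'a::euclidean_space set \<Rightarrow> 'a \<Rightarrow> 'a set" where
  "weyl_orbit \<Phi> \<mu> = (\<lambda>w. w \<mu>) ` weyl_group \<Phi>"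

definition fund_weight :: "'i set \<Rightarrow> ('i \<Rightarrow> 'a::euclidean_space) \<Rightarrow> 'i \<Rightarrow> 'a" where
  "fund_weight I \<alpha> i =
     (THE \<omega>. \<forall>j\<in>I. \<omega> \<bullet> coroot (\<alpha> j) = (if j = i then 1 else 0))"

definition weights :: "'i set \<Rightarrow> ('i \<Rightarrow> 'a::euclidean_space) \<Rightarrow> 'a set" where
  "weights I \<alpha> = {\<Sum>i\<in>I. of_int (c i) *\<^sub>R fund_weight I \<alpha> i | c :: 'i \<Rightarrow> int. True}"

definition dominant_weights :: "'i set \<Rightarrow> ('i \<Rightarrow> 'a::euclidean_space) \<Rightarrow> 'a set" where
  "dominant_weights I \<alpha> = {\<Sum>i\<in>I. of_nat (c i) *\<^sub>R fund_weight I \<alpha> i | c :: 'i \<Rightarrow> nat. True}"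

definition minuscule ::
  "'a::euclidean_space set \<Rightarrow> 'i set \<Rightarrow> ('i \<Rightarrow> 'a) \<Rightarrow> 'a \<Rightarrow> bool" where
  "minuscule \<Phi> I \<alpha> \<mu> \<longleftrightarrow>
     \<mu> \<in> weights I \<alpha> \<and> \<mu> \<noteq> 0 \<and> (\<forall>\<beta>\<in>\<Phi>. \<mu> \<bullet> coroot \<beta> \<in> {0, 1, - 1})"

definition quasi_minuscule ::
  "'a::euclidean_space set \<Rightarrow> 'i set \<Rightarrow> ('i \<Rightarrow> 'a) \<Rightarrow> 'a \<Rightarrow> bool" where
  "quasi_minuscule \<Phi> I \<alpha> \<mu> \<longleftrightarrow>
     \<mu> \<in> weights I \<alpha> \<and> \<mu> \<noteq> 0 \<and>
     (\<forall>\<beta>\<in>\<Phi>. \<mu> \<bullet> coroot \<beta> \<in> {0, 1, - 1, 2, - 2}) \<and>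
     (\<exists>!\<beta>. \<beta> \<in> \<Phi> \<and> \<mu> \<bullet> coroot \<beta> = 2)"


section \<open>Edge-colored posets\<close>

text \<open>A triple \<open>(s, i, t)\<close> is an edge from \<open>s\<close> to \<open>t\<close> of color \<open>i\<close>.  Posets are identified with
  their Hasse diagrams, so the order is the reflexive-transitive closure of the edges.\<close>

record ('v, 'i) colored_digraph =
  verts :: "'v set"
  edges :: "('v \<times> 'i \<times> 'v) set"

definition arcs :: "('v, 'i) colored_digraph \<Rightarrow> 'v rel" where
  "arcs G = {(s, t). \<exists>i. (s, i, t) \<in> edges G}"

definition covered_by :: "'v rel \<Rightarrow> 'v \<Rightarrow> 'v \<Rightarrow> bool" where
  "covered_by r s t \<longleftrightarrow>
     (s, t) \<in> r \<and> s \<noteq> t \<and> (\<forall>u. (s, u) \<in> r \<and> (u, t) \<in> r \<longrightarrow> u = s \<or> u = t)"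

text \<open>A finite poset each of whose Hasse edges carries exactly one color from \<open>I\<close>.\<close>

definition edge_colored_poset :: "'i set \<Rightarrow> ('v, 'i) colored_digraph \<Rightarrow> bool" where
  "edge_colored_poset I G \<longleftrightarrow>
     finite (verts G) \<and>
     edges G \<subseteq> verts G \<times> I \<times> verts G \<and>
     (\<forall>s t i j. (s, i, t) \<in> edges G \<and> (s, j, t) \<in> edges G \<longrightarrow> i = j) \<and>
     (\<exists>r. partial_order_on (verts G) r \<and>
        (\<forall>s t. (s, t) \<in> arcs G \<longleftrightarrow> covered_by r s t))"

definition maximal_elem :: "('v, 'i) colored_digraph \<Rightarrow> 'v \<Rightarrow> bool" where
  "maximal_elem G m \<longleftrightarrow>
     m \<in> verts G \<and> (\<forall>t\<in>verts G. (m, t) \<in> (arcs G)\<^sup>* \<longrightarrow> t = m)"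

definition is_chain :: "('v, 'i) colored_digraph \<Rightarrow> bool" where
  "is_chain G \<longleftrightarrow>
     (\<forall>s\<in>verts G. \<forall>t\<in>verts G. (s, t) \<in> (arcs G)\<^sup>* \<or> (t, s) \<in> (arcs G)\<^sup>*)"

definition rank_function :: "('v, 'i) colored_digraph \<Rightarrow> ('v \<Rightarrow> nat) \<Rightarrow> nat \<Rightarrow> bool" where
  "rank_function G \<rho> l \<longleftrightarrow>
     \<rho> ` verts G = {0..l} \<and> (\<forall>(s, t)\<in>arcs G. \<rho> s + 1 = \<rho> t)"

definition ranked :: "('v, 'i) colored_digraph \<Rightarrow> bool" where
  "ranked G \<longleftrightarrow> (\<exists>\<rho> l. rank_function G \<rho> l)"

text \<open>The next two are meant for connected ranked posets, whose rank function is unique.\<close>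

definition rank_of :: "('v, 'i) colored_digraph \<Rightarrow> 'v \<Rightarrow> nat" where
  "rank_of G x = (THE k. \<exists>\<rho> l. rank_function G \<rho> l \<and> \<rho> x = k)"

definition length_of :: "('v, 'i) colored_digraph \<Rightarrow> nat" where
  "length_of G = (THE l. \<exists>\<rho>. rank_function G \<rho> l)"

definition connected_digraph :: "('v, 'i) colored_digraph \<Rightarrow> bool" where
  "connected_digraph G \<longleftrightarrow>
     (\<forall>s\<in>verts G. \<forall>t\<in>verts G. (s, t) \<in> (arcs G \<union> (arcs G)\<inverse>)\<^sup>*)"

definition retain_colors ::
  "('v, 'i) colored_digraph \<Rightarrow> 'i set \<Rightarrow> ('v, 'i) colored_digraph" where
  "retain_colors G J = \<lparr>verts = verts G, edges = {(s, j, t). (s, j, t) \<in> edges G \<and> j \<in> J}\<rparr>"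

definition component ::
  "('v, 'i) colored_digraph \<Rightarrow> 'i set \<Rightarrow> 'v \<Rightarrow> ('v, 'i) colored_digraph" where
  "component G J x =
     (let A = arcs (retain_colors G J);
          C = {y \<in> verts G. (x, y) \<in> (A \<union> A\<inverse>)\<^sup>*}
      in \<lparr>verts = C, edges = edges (retain_colors G J) \<inter> C \<times> J \<times> C\<rparr>)"

abbreviation color_comp :: "('v, 'i) colored_digraph \<Rightarrow> 'i \<Rightarrow> 'v \<Rightarrow> ('v, 'i) colored_digraph" where
  "color_comp G i x \<equiv> component G {i} x"

definition rho :: "('v, 'i) colored_digraph \<Rightarrow> 'i \<Rightarrow> 'v \<Rightarrow> nat" where
  "rho G i x = rank_of (color_comp G i x) x"

definition len :: "('v, 'i) colored_digraph \<Rightarrow> 'i \<Rightarrow> 'v \<Rightarrow> nat" where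
  "len G i x = length_of (color_comp G i x)"

definition delta :: "('v, 'i) colored_digraph \<Rightarrow> 'i \<Rightarrow> 'v \<Rightarrow> nat" where
  "delta G i x = len G i x - rho G i x"

definition wt ::
  "'i set \<Rightarrow> ('i \<Rightarrow> 'a::euclidean_space) \<Rightarrow> ('v, 'i) colored_digraph \<Rightarrow> 'v \<Rightarrow> 'a" where
  "wt I \<alpha> G x =
     (\<Sum>i\<in>I. of_int (int (rho G i x) - int (delta G i x)) *\<^sub>R fund_weight I \<alpha> i)"

text \<open>Being \<open>\<Phi>\<close>-structured depends on \<open>\<Phi>\<close> only through its simple roots.\<close>

definition structured ::
  "'i set \<Rightarrow> ('i \<Rightarrow> 'a::euclidean_space) \<Rightarrow> ('v, 'i) colored_digraph \<Rightarrow> bool" where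
  "structured I \<alpha> G \<longleftrightarrow> (\<forall>(s, i, t)\<in>edges G. wt I \<alpha> G s + \<alpha> i = wt I \<alpha> G t)"

definition fibrous :: "'i set \<Rightarrow> ('v, 'i) colored_digraph \<Rightarrow> bool" where
  "fibrous I G \<longleftrightarrow> (\<forall>i\<in>I. \<forall>x\<in>verts G. is_chain (color_comp G i x))"

definition colored_iso ::
  "('v, 'i) colored_digraph \<Rightarrow> ('w, 'i) colored_digraph \<Rightarrow> bool" (infix \<open>\<cong>\<^sub>c\<close> 50) where
  "G \<cong>\<^sub>c H \<longleftrightarrow>
     (\<exists>f. bij_betw f (verts G) (verts H) \<and>
        (\<forall>s\<in>verts G. \<forall>t\<in>verts G. \<forall>i. (s, i, t) \<in> edges G \<longleftrightarrow> (f s, i, f t) \<in> edges H))"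


section \<open>Splitting posets\<close>

definition minuscule_splitting_poset ::
  "'a::euclidean_space set \<Rightarrow> 'i set \<Rightarrow> ('i \<Rightarrow> 'a) \<Rightarrow> 'a \<Rightarrow> ('a, 'i) colored_digraph" where
  "minuscule_splitting_poset \<Phi> I \<alpha> lam =
     \<lparr>verts = weyl_orbit \<Phi> lam,
      edges = {(\<mu>, i, \<nu>). \<mu> \<in> weyl_orbit \<Phi> lam \<and> \<nu> \<in> weyl_orbit \<Phi> lam \<and> i \<in> I \<and> \<mu> + \<alpha> i = \<nu>}\<rparr>"

text \<open>\<open>Inr i\<close> is the additional vertex \<open>\<alpha>\<^sub>i\<close>-bar attached to a short simple root.\<close>

definition quasi_minuscule_splitting_poset ::
  "'a::euclidean_space set \<Rightarrow> 'i set \<Rightarrow> ('i \<Rightarrow> 'a) \<Rightarrow> 'a \<Rightarrow> ('a + 'i, 'i) colored_digraph" where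
  "quasi_minuscule_splitting_poset \<Phi> I \<alpha> lam =
     \<lparr>verts = Inl ` weyl_orbit \<Phi> lam \<union> Inr ` {i \<in> I. short_root \<Phi> (\<alpha> i)},
      edges =
        {(Inl \<mu>, i, Inl \<nu>) | \<mu> i \<nu>.
           \<mu> \<in> weyl_orbit \<Phi> lam \<and> \<nu> \<in> weyl_orbit \<Phi> lam \<and> i \<in> I \<and> \<mu> + \<alpha> i = \<nu>} \<union>
        {(Inl (- \<alpha> i), i, Inr i) | i. i \<in> I \<and> short_root \<Phi> (\<alpha> i)} \<union>
        {(Inr i, i, Inl (\<alpha> i)) | i. i \<in> I \<and> short_root \<Phi> (\<alpha> i)}\<rparr>"

definition is_minuscule_splitting_poset ::
  "'a::euclidean_space set \<Rightarrow> 'i set \<Rightarrow> ('i \<Rightarrow> 'a) \<Rightarrow> ('v, 'i) colored_digraph \<Rightarrow> bool" where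
  "is_minuscule_splitting_poset \<Phi> I \<alpha> G \<longleftrightarrow>
     (\<exists>lam. lam \<in> dominant_weights I \<alpha> \<and> minuscule \<Phi> I \<alpha> lam \<and>
        G \<cong>\<^sub>c minuscule_splitting_poset \<Phi> I \<alpha> lam)"

definition is_quasi_minuscule_splitting_poset ::
  "'a::euclidean_space set \<Rightarrow> 'i set \<Rightarrow> ('i \<Rightarrow> 'a) \<Rightarrow> ('v, 'i) colored_digraph \<Rightarrow> bool" where
  "is_quasi_minuscule_splitting_poset \<Phi> I \<alpha> G \<longleftrightarrow>
     (\<exists>lam. lam \<in> dominant_weights I \<alpha> \<and> quasi_minuscule \<Phi> I \<alpha> lam \<and>
        G \<cong>\<^sub>c quasi_minuscule_splitting_poset \<Phi> I \<alpha> lam)"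

end

theory Submission
  imports Defs
begin

text \<open>Let \<open>m i x\<close> be the coefficient of \<open>\<omega>\<^sub>i\<close> in \<open>wt x\<close>.  Along an edge of color \<open>i\<close> it changes by Cartan
  integers, so the bounds on chain lengths force \<open>\<langle>\<alpha>\<^sub>i, \<alpha>\<^sub>j\<^sup>\<or>\<rangle> = \<langle>\<alpha>\<^sub>j, \<alpha>\<^sub>i\<^sup>\<or>\<rangle> \<in> {0, -1}\<close> whenever edges of distinct
  colors \<open>i\<close>, \<open>j\<close> leave the same vertex.  The unique maxima of \<open>{i, j}\<close>-components thus make the poset
  locally confluent, and Newman's lemma yields a unique maximal element \<open>m\<close>.  The nonzero weights are
  stable under simple reflections, hence form the Weyl orbit of \<open>wt m\<close>, and climbing to \<open>m\<close> shows that
  a vertex is determined by its weight when this is nonzero.  In the quasi-minuscule case the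
  vertices of weight zero are the middles of the chains of length two.

  Conversely, in a splitting poset the edges of color \<open>i\<close> are read off \<open>\<langle>\<mu>, \<alpha>\<^sub>i\<^sup>\<or>\<rangle>\<close>, because
  \<open>\<mu> + \<alpha>\<^sub>i\<close> has the length of \<open>\<mu>\<close> iff \<open>\<langle>\<mu>, \<alpha>\<^sub>i\<^sup>\<or>\<rangle> = -1\<close>; unique maxima of components come from local
  confluence again.  Irreducibility enters only through the quasi-minuscule weights: these are
  exactly the short roots, which form a single orbit.\<close>

section \<open>Reflections and root systems\<close>

text \<open>Weights separate vertices only away from zero. Every induction in the quasi-minuscule
  case therefore runs over vertices of nonzero weight and jumps over a zero by climbing two ranks;
  the vertices of weight zero are told apart by the one color in which they have edges. What makes
  the nonzero part behave as in the minuscule case is that an interior vertex of a chain has weight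
  zero: elsewhere \<open>rho\<close> or \<open>delta\<close> vanishes, and the integer
  \<open>m\<close> alone tells which edges exist.

  The axioms speak about simple roots, whereas minuscule and quasi-minuscule speak about all roots.
  The passage rests on conjugation: every root is reached from a simple one by simple reflections,
  and a reflection may be moved from the coroot to the weight, where closure of the set of weights
  absorbs it.

  The numbers \<open>rho\<close> and \<open>delta\<close> are defined through the rank function of a
  component. On a connected component two functions that rise by one along edges differ by a
  constant, so everything is computed from a single rank function \<open>r\<close> of the whole
  poset.\<close>

lemma inner_coroot: "x \<bullet> coroot y = 2 * (x \<bullet> y) / (y \<bullet> y)"
  by (simp add: coroot_def)

lemma inner_coroot_self: "x \<noteq> 0 \<Longrightarrow> x \<bullet> coroot x = 2"
  by (simp add: inner_coroot)

lemma inner_coroot_eq_0_iff: "y \<noteq> 0 \<Longrightarrow> x \<bullet> coroot y = 0 \<longleftrightarrow> x \<bullet> y = 0"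
  by (simp add: inner_coroot)

lemma inner_coroot_pos_iff: "y \<noteq> 0 \<Longrightarrow> x \<bullet> coroot y > 0 \<longleftrightarrow> x \<bullet> y > 0"
proof -
  assume "y \<noteq> 0"
  then have "0 < y \<bullet> y" by simp
  then show ?thesis unfolding inner_coroot by (subst pos_less_divide_eq) auto
qed

lemma coroot_minus: "coroot (- x) = - coroot x"
  by (simp add: coroot_def)

lemma reflect_self: "x \<noteq> 0 \<Longrightarrow> reflect x x = - x"
  by (simp add: reflect_def inner_coroot_self algebra_simps scaleR_2)

lemma reflect_minus: "reflect y (- x) = - reflect y x"
  by (simp add: reflect_def)

lemma reflect_scaleR: "reflect y (c *\<^sub>R x) = c *\<^sub>R reflect y x"
  by (simp add: reflect_def algebra_simps)

lemma reflect_diff: "reflect y (u - v) = reflect y u - reflect y v"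
  by (simp add: reflect_def algebra_simps inner_diff_left)

lemma inner_reflect_reflect: "reflect y u \<bullet> reflect y v = u \<bullet> v"
proof -
  have h: "x \<bullet> y = (x \<bullet> coroot y) * (y \<bullet> y) / 2" for x
    by (cases "y = 0") (simp_all add: inner_coroot)
  have "reflect y u \<bullet> reflect y v =
      u \<bullet> v - (v \<bullet> coroot y) * (u \<bullet> y) - (u \<bullet> coroot y) * (v \<bullet> y)
        + (u \<bullet> coroot y) * (v \<bullet> coroot y) * (y \<bullet> y)"
    unfolding reflect_def
    by (simp add: inner_diff_left inner_diff_right inner_commute[of y v] algebra_simps)
  then show ?thesis unfolding h[of u] h[of v] by simp
qed

lemma reflect_reflect [simp]: "reflect y (reflect y x) = x"
proof (cases "y = 0")
  case False
  then show ?thesis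
    by (simp add: reflect_def inner_diff_left inner_coroot_self algebra_simps scaleR_2)
qed (simp add: reflect_def)

lemma inner_reflect_left: "reflect y u \<bullet> v = u \<bullet> reflect y v"
  using inner_reflect_reflect[of y u "reflect y v"] by simp

lemma norm_reflect: "norm (reflect y x) = norm x"
  by (simp add: norm_eq_sqrt_inner inner_reflect_reflect)

lemma coroot_reflect: "coroot (reflect y x) = reflect y (coroot x)"
  by (simp add: coroot_def inner_reflect_reflect reflect_scaleR)

lemma inner_coroot_reflect: "x \<bullet> coroot (reflect y z) = reflect y x \<bullet> coroot z"
  by (simp add: coroot_reflect inner_reflect_left)

text \<open>Reflecting in a reflected root is conjugation. This turns invariance of a set under the
  simple reflections into invariance under all reflections.\<close>

lemma reflect_reflect_root: "reflect (reflect y z) x = reflect y (reflect z (reflect y x))"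
proof -
  have "reflect y (reflect z (reflect y x)) = x - (reflect y x \<bullet> coroot z) *\<^sub>R reflect y z"
    unfolding reflect_def[of z] by (simp only: reflect_diff reflect_scaleR reflect_reflect)
  then show ?thesis
    by (simp only: reflect_def[of "reflect y z"] inner_coroot_reflect)
qed

lemma reflect_eq_self_iff: "y \<noteq> 0 \<Longrightarrow> reflect y x = x \<longleftrightarrow> x \<bullet> y = 0"
  by (auto simp: reflect_def inner_coroot)

text \<open>Expanding the square leaves \<open>2 * (x \<bullet> y) = - (y \<bullet> y)\<close>.
  Since orbit points have equal length, an edge between them can be read off a single
  pairing.\<close>

lemma norm_add_eq_iff: 
  assumes "y \<noteq> 0" shows "norm (x + y) = norm x \<longleftrightarrow> x \<bullet> coroot y = - 1"
proof -
  have "norm (x + y) = norm x \<longleftrightarrow> (x + y) \<bullet> (x + y) = x \<bullet> x"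
    by (simp add: norm_eq_sqrt_inner)
  also have "\<dots> \<longleftrightarrow> 2 * (x \<bullet> y) = - (y \<bullet> y)"
    by (auto simp: inner_add_left inner_add_right inner_commute[of y x])
  also have "\<dots> \<longleftrightarrow> x \<bullet> coroot y = - 1"
    using assms by (simp add: inner_coroot divide_eq_eq)
  finally show ?thesis .
qed

lemma weyl_orbit_self: "\<mu> \<in> weyl_orbit \<Phi> \<mu>"
  unfolding weyl_orbit_def using weyl_group.one by (metis id_apply image_eqI)

lemma weyl_orbit_reflect:
  "x \<in> weyl_orbit \<Phi> \<mu> \<Longrightarrow> \<beta> \<in> \<Phi> \<Longrightarrow> reflect \<beta> x \<in> weyl_orbit \<Phi> \<mu>"
proof -
  assume "x \<in> weyl_orbit \<Phi> \<mu>" and \<beta>: "\<beta> \<in> \<Phi>"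
  then obtain w where w: "w \<in> weyl_group \<Phi>" "x = w \<mu>" by (auto simp: weyl_orbit_def)
  then have "reflect \<beta> x = (reflect \<beta> \<circ> w) \<mu>" by simp
  with weyl_group.refl[OF w(1) \<beta>] show ?thesis
    unfolding weyl_orbit_def by (intro image_eqI[where x = "reflect \<beta> \<circ> w"]) simp_all
qed

lemma weyl_orbit_induct [consumes 1, case_names base refl]:
  assumes "x \<in> weyl_orbit \<Phi> \<mu>" and "P \<mu>"
    and step: "\<And>y \<beta>. y \<in> weyl_orbit \<Phi> \<mu> \<Longrightarrow> P y \<Longrightarrow> \<beta> \<in> \<Phi> \<Longrightarrow> P (reflect \<beta> y)"
  shows "P x"
proof -
  have "P (w \<mu>)" if "w \<in> weyl_group \<Phi>" for w
    using that
  proof (induction w)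
    case (refl w \<beta>)
    then show ?case using step[of "w \<mu>" \<beta>] by (simp add: weyl_orbit_def)
  qed (simp add: assms)
  with assms show ?thesis by (auto simp: weyl_orbit_def)
qed

lemma norm_weyl_orbit: "x \<in> weyl_orbit \<Phi> \<mu> \<Longrightarrow> norm x = norm \<mu>"
  by (induction rule: weyl_orbit_induct) (auto simp: norm_reflect)

section \<open>Pairings between roots\<close>

locale finite_root_system =
  fixes \<Phi> :: "'a::euclidean_space set"
  assumes root_system: "root_system \<Phi>"
begin

lemma zero_not_root: "0 \<notin> \<Phi>" and span_roots: "span \<Phi> = UNIV"
  using root_system by (auto simp: root_system_def)

lemma root_nonzero: "\<beta> \<in> \<Phi> \<Longrightarrow> \<beta> \<noteq> 0"
  using zero_not_root by auto

lemma reflect_root: "\<beta> \<in> \<Phi> \<Longrightarrow> \<gamma> \<in> \<Phi> \<Longrightarrow> reflect \<beta> \<gamma> \<in> \<Phi>"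
  using root_system by (auto simp: root_system_def)

lemma reflect_root_iff: "\<beta> \<in> \<Phi> \<Longrightarrow> reflect \<beta> \<gamma> \<in> \<Phi> \<longleftrightarrow> \<gamma> \<in> \<Phi>"
  using reflect_root reflect_reflect by metis

lemma uminus_root: "\<beta> \<in> \<Phi> \<Longrightarrow> - \<beta> \<in> \<Phi>"
  using reflect_root[of \<beta> \<beta>] root_nonzero by (simp add: reflect_self)

lemma inner_coroot_Ints: "\<beta> \<in> \<Phi> \<Longrightarrow> \<gamma> \<in> \<Phi> \<Longrightarrow> \<beta> \<bullet> coroot \<gamma> \<in> \<int>"
  using root_system by (auto simp: root_system_def)

lemma root_multiple: "\<beta> \<in> \<Phi> \<Longrightarrow> c *\<^sub>R \<beta> \<in> \<Phi> \<Longrightarrow> c = 1 \<or> c = - 1"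
  using root_system by (auto simp: root_system_def)

lemma eq_if_inner_roots:
  assumes "\<And>\<beta>. \<beta> \<in> \<Phi> \<Longrightarrow> \<nu> \<bullet> \<beta> = 0"
  shows "\<nu> = 0"
proof -
  have "\<nu> \<in> span \<Phi>" by (simp add: span_roots)
  then have "orthogonal \<nu> \<nu>"
    by (intro orthogonal_to_span[of \<nu> \<Phi> \<nu>]) (auto simp: orthogonal_def assms)
  then show ?thesis by (simp add: orthogonal_def)
qed

lemma root_if_orbit_root: "x \<in> weyl_orbit \<Phi> \<mu> \<Longrightarrow> x \<in> \<Phi> \<Longrightarrow> \<mu> \<in> \<Phi>"
proof -
  assume "x \<in> weyl_orbit \<Phi> \<mu>" "x \<in> \<Phi>"
  moreover from this(1) have "x \<in> \<Phi> \<longrightarrow> \<mu> \<in> \<Phi>"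
    by (induction rule: weyl_orbit_induct) (auto simp: reflect_root_iff)
  ultimately show ?thesis by simp
qed

text \<open>Cauchy-Schwarz, made strict by reducedness: equality would make the two roots
  proportional, hence equal or opposite. Dividing by the squared length of \<gamma>, which is at
  least as long, gives the bound.\<close>

lemma abs_inner_coroot_less_2:
  assumes "\<beta> \<in> \<Phi>" "\<gamma> \<in> \<Phi>" "norm \<beta> \<le> norm \<gamma>" "\<gamma> \<noteq> \<beta>" "\<gamma> \<noteq> - \<beta>"
  shows "\<bar>\<beta> \<bullet> coroot \<gamma>\<bar> < 2"
proof -
  have nz: "norm \<beta> > 0" "norm \<gamma> > 0" using assms root_nonzero by auto
  have "\<bar>\<beta> \<bullet> \<gamma>\<bar> \<noteq> norm \<beta> * norm \<gamma>"
  proof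
    assume "\<bar>\<beta> \<bullet> \<gamma>\<bar> = norm \<beta> * norm \<gamma>"
    then have "norm \<beta> *\<^sub>R \<gamma> = norm \<gamma> *\<^sub>R \<beta> \<or> norm \<beta> *\<^sub>R \<gamma> = - norm \<gamma> *\<^sub>R \<beta>"
      by (simp add: norm_cauchy_schwarz_abs_eq)
    then obtain c where "norm \<beta> *\<^sub>R \<gamma> = c *\<^sub>R \<beta>" by blast
    then have "inverse (norm \<beta>) *\<^sub>R norm \<beta> *\<^sub>R \<gamma> = inverse (norm \<beta>) *\<^sub>R c *\<^sub>R \<beta>" by simp
    then have "\<gamma> = (inverse (norm \<beta>) * c) *\<^sub>R \<beta>" using nz by simp
    then show False using root_multiple[of \<beta>] assms by (metis scaleR_minus1_left scaleR_one)
  qed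
  then have "\<bar>\<beta> \<bullet> \<gamma>\<bar> < norm \<beta> * norm \<gamma>"
    using Cauchy_Schwarz_ineq2[of \<beta> \<gamma>] by simp
  also have "\<dots> \<le> norm \<gamma> * norm \<gamma>" using assms(3) by (simp add: mult_right_mono)
  finally have "\<bar>\<beta> \<bullet> \<gamma>\<bar> < \<gamma> \<bullet> \<gamma>" by (simp add: dot_square_norm power2_eq_square)
  then show ?thesis using nz by (simp add: inner_coroot abs_mult divide_less_eq)
qed

text \<open>Integrality sharpens the strict bound 2. Short roots thus pair like minuscule weights,
  except with themselves and their negatives.\<close>

lemma short_root_inner_coroot:
  assumes "short_root \<Phi> \<beta>" "\<gamma> \<in> \<Phi>"
  shows "\<beta> \<bullet> coroot \<gamma> \<in> {0, 1, - 1} \<or> \<gamma> = \<beta> \<or> \<gamma> = - \<beta>"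
proof (rule disjCI)
  assume "\<not> (\<gamma> = \<beta> \<or> \<gamma> = - \<beta>)"
  then have "\<bar>\<beta> \<bullet> coroot \<gamma>\<bar> < 2"
    using assms by (intro abs_inner_coroot_less_2) (auto simp: short_root_def)
  moreover obtain k where k: "\<beta> \<bullet> coroot \<gamma> = of_int k"
    using assms inner_coroot_Ints Ints_cases short_root_def by metis
  ultimately have "\<bar>k\<bar> < 2" by linarith
  then have "k \<in> {0, 1, - 1}" by auto
  with k show "\<beta> \<bullet> coroot \<gamma> \<in> {0, 1, - 1}" by auto
qed

lemma short_root_reflect: "short_root \<Phi> \<beta> \<Longrightarrow> \<gamma> \<in> \<Phi> \<Longrightarrow> short_root \<Phi> (reflect \<gamma> \<beta>)"
  by (auto simp: short_root_def norm_reflect reflect_root)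

lemma short_root_weyl_orbit: "x \<in> weyl_orbit \<Phi> \<mu> \<Longrightarrow> short_root \<Phi> \<mu> \<Longrightarrow> short_root \<Phi> x"
  by (induction rule: weyl_orbit_induct) (auto simp: short_root_reflect)

lemma short_root_uminus: "short_root \<Phi> \<beta> \<Longrightarrow> short_root \<Phi> (- \<beta>)"
  by (auto simp: short_root_def uminus_root)

end

section \<open>What irreducibility contributes\<close>

locale finite_irreducible_root_system =
  fixes \<Phi> :: "'a::euclidean_space set"
  assumes irreducible: "irreducible_root_system \<Phi>"

sublocale finite_irreducible_root_system \<subseteq> finite_root_system
  by unfold_locales (use irreducible in \<open>simp add: irreducible_root_system_def\<close>)

context finite_irreducible_root_system
begin

text \<open>A root that links \<beta> with an arbitrary nonzero vector \<nu>. The roots orthogonal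
  to every root that meets \<nu> split off from the rest, so irreducibility leaves none of
  them.\<close>

lemma ex_non_orthogonal_root:
  assumes "\<beta> \<in> \<Phi>" "\<nu> \<noteq> 0"
  obtains \<delta> where "\<delta> \<in> \<Phi>" "\<delta> \<bullet> \<nu> \<noteq> 0" "\<delta> \<bullet> \<beta> \<noteq> 0"
proof -
  define A where "A = {\<delta>\<in>\<Phi>. \<delta> \<bullet> \<nu> \<noteq> 0}"
  define C where "C = {\<gamma>\<in>\<Phi>. \<forall>\<delta>\<in>A. \<delta> \<bullet> \<gamma> = 0}"
  have "A \<noteq> {}"
    using assms eq_if_inner_roots[of \<nu>] by (auto simp: A_def inner_commute)
  moreover have "A \<subseteq> \<Phi> - C"
    using root_nonzero by (fastforce simp: A_def C_def)
  ultimately have "\<Phi> - C \<noteq> {}" by auto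
  moreover have "\<Phi> = C \<union> (\<Phi> - C)" by (auto simp: C_def)
  moreover have "\<delta> \<bullet> \<eta> = 0" if dh: "\<delta> \<in> C" "\<eta> \<in> \<Phi> - C" for \<delta> \<eta>
  proof (cases "\<eta> \<bullet> \<nu> = 0")
    case True
    obtain \<gamma> where \<gamma>: "\<gamma> \<in> A" "\<gamma> \<bullet> \<eta> \<noteq> 0"
      using dh by (auto simp: C_def)
    \<comment> \<open>Reflecting in \<eta> keeps \<gamma> in \<open>A\<close>, so \<delta> is
      orthogonal to both \<gamma> and its image, whose difference is a nonzero multiple of
      \<eta>.\<close>
    have "reflect \<eta> \<gamma> \<bullet> \<nu> = \<gamma> \<bullet> \<nu>"
      using True by (simp add: reflect_def inner_diff_left)
    then have "reflect \<eta> \<gamma> \<in> A"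
      using \<gamma> that by (auto simp: A_def reflect_root)
    then have "reflect \<eta> \<gamma> \<bullet> \<delta> = 0" "\<gamma> \<bullet> \<delta> = 0"
      using that \<gamma> by (auto simp: C_def)
    then have "(\<gamma> \<bullet> coroot \<eta>) * (\<eta> \<bullet> \<delta>) = 0"
      by (simp add: reflect_def inner_diff_left)
    moreover have "\<gamma> \<bullet> coroot \<eta> \<noteq> 0"
      using \<gamma> that root_nonzero by (subst inner_coroot_eq_0_iff) auto
    ultimately show ?thesis by (simp add: inner_commute)
  next
    case False
    then show ?thesis using that by (auto simp: A_def C_def inner_commute)
  qed
  ultimately have "C = {}"
    using irreducible unfolding irreducible_root_system_def by metis
  then show ?thesis using that assms by (auto simp: A_def C_def)
qed

text \<open>Two short roots have equal length, so their two pairings agree and are 0, 1 or -1 unless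
  the roots are equal or opposite. For the values 1 and -1,
  \<open>reflect \<beta> (reflect \<gamma> \<beta>)\<close> is the negative of \<gamma> or \<gamma>
  itself. Orthogonal roots are first made non-orthogonal by reflecting one of them in a root that
  meets both.\<close>

lemma short_roots_weyl_orbit:
  assumes "short_root \<Phi> \<beta>" "short_root \<Phi> \<gamma>"
  shows "\<gamma> \<in> weyl_orbit \<Phi> \<beta>"
proof -
  have in\<Phi>: "\<beta> \<in> \<Phi>" "\<gamma> \<in> \<Phi>" using assms by (auto simp: short_root_def)
  have nonorth: "\<gamma> \<in> weyl_orbit \<Phi> \<beta>" if \<gamma>: "short_root \<Phi> \<gamma>" "\<gamma> \<bullet> \<beta> \<noteq> 0" for \<gamma>
  proof -
    have in\<Phi>: "\<beta> \<in> \<Phi>" "\<gamma> \<in> \<Phi>" and nn: "norm \<beta> = norm \<gamma>"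
      using assms \<gamma> by (auto simp: short_root_def intro: antisym)
    have mem: "reflect \<beta> (reflect \<gamma> \<beta>) \<in> weyl_orbit \<Phi> \<beta>"
      by (intro weyl_orbit_reflect weyl_orbit_self in\<Phi>)
    have "\<beta> \<bullet> coroot \<gamma> \<noteq> 0"
      using \<gamma> in\<Phi> root_nonzero by (simp add: inner_coroot_eq_0_iff inner_commute)
    have "\<beta> \<bullet> \<beta> = \<gamma> \<bullet> \<gamma>" by (simp add: dot_square_norm nn)
    then have sym: "\<gamma> \<bullet> coroot \<beta> = \<beta> \<bullet> coroot \<gamma>"
      unfolding inner_coroot inner_commute[of \<gamma> \<beta>] by simp
    from \<open>\<beta> \<bullet> coroot \<gamma> \<noteq> 0\<close> consider "\<gamma> = \<beta>" | "\<gamma> = - \<beta>" | "\<beta> \<bullet> coroot \<gamma> = 1" | "\<beta> \<bullet> coroot \<gamma> = - 1"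
      using short_root_inner_coroot[OF assms(1) in\<Phi>(2)] by auto
    then show ?thesis
    proof cases
      case 1 then show ?thesis by (simp add: weyl_orbit_self)
    next
      case 2 then show ?thesis
        using weyl_orbit_reflect[OF weyl_orbit_self[of \<beta>] in\<Phi>(1)] in\<Phi> root_nonzero by (simp add: reflect_self)
    next
      case 3
      then have "\<gamma> \<bullet> coroot \<beta> = 1"
        using sym by simp
      with 3 have "reflect \<beta> (reflect \<gamma> \<beta>) = - \<gamma>"
        using in\<Phi> root_nonzero by (simp add: reflect_def inner_diff_left inner_coroot_self scaleR_2)
      then show ?thesis
        using weyl_orbit_reflect[OF mem in\<Phi>(2)] in\<Phi> root_nonzero
        by (simp add: reflect_minus reflect_self)
    next
      case 4
      then have "\<gamma> \<bullet> coroot \<beta> = - 1"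
        using sym by simp
      with 4 have "reflect \<beta> (reflect \<gamma> \<beta>) = \<gamma>"
        using in\<Phi> root_nonzero by (simp add: reflect_def inner_add_left inner_coroot_self scaleR_2)
      then show ?thesis using mem by simp
    qed
  qed
  show ?thesis
  proof (cases "\<gamma> \<bullet> \<beta> = 0")
    case True
    obtain \<delta> where \<delta>: "\<delta> \<in> \<Phi>" "\<delta> \<bullet> \<gamma> \<noteq> 0" "\<delta> \<bullet> \<beta> \<noteq> 0"
      using ex_non_orthogonal_root[of \<beta> \<gamma>] in\<Phi> root_nonzero by metis
    have "reflect \<delta> \<gamma> \<bullet> \<beta> = - ((\<gamma> \<bullet> coroot \<delta>) * (\<delta> \<bullet> \<beta>))"
      using True by (simp add: reflect_def inner_diff_left)
    moreover have "\<gamma> \<bullet> coroot \<delta> \<noteq> 0"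
      using \<delta> root_nonzero by (simp add: inner_coroot_eq_0_iff inner_commute)
    ultimately have "reflect \<delta> \<gamma> \<in> weyl_orbit \<Phi> \<beta>"
      using \<delta> assms by (intro nonorth short_root_reflect) auto
    then show ?thesis using weyl_orbit_reflect[OF _ \<delta>(1)] reflect_reflect by metis
  qed (use nonorth assms in blast)
qed

text \<open>The only candidate is the root \<beta> with pairing 2, and \<mu> turns out to be equal
  to it. A root that meets \<beta> pairs with \<mu> as with \<beta>; if the difference were nonzero,
  some root would meet both it and \<beta>.\<close>

lemma quasi_minuscule_short_root:
  assumes bound: "\<And>\<gamma>. \<gamma> \<in> \<Phi> \<Longrightarrow> \<mu> \<bullet> coroot \<gamma> \<in> {0, 1, - 1, 2, - 2}"
    and uniq: "\<exists>!\<beta>. \<beta> \<in> \<Phi> \<and> \<mu> \<bullet> coroot \<beta> = 2"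
  shows "short_root \<Phi> \<mu>"
proof -
  obtain \<beta> where \<beta>: "\<beta> \<in> \<Phi>" "\<mu> \<bullet> coroot \<beta> = 2"
    and \<beta>_uniq: "\<And>\<gamma>. \<gamma> \<in> \<Phi> \<Longrightarrow> \<mu> \<bullet> coroot \<gamma> = 2 \<Longrightarrow> \<gamma> = \<beta>"
    using uniq by blast
  have pos: "\<mu> \<bullet> coroot \<gamma> = \<beta> \<bullet> coroot \<gamma> \<and> (\<gamma> = \<beta> \<or> \<beta> \<bullet> coroot \<gamma> = 1)"
    if \<gamma>: "\<gamma> \<in> \<Phi>" "\<gamma> \<bullet> \<beta> > 0" for \<gamma>
  proof (cases "\<gamma> = \<beta>")
    case True
    then show ?thesis using \<beta> root_nonzero by (auto simp: inner_coroot_self)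
  next
    case False
    have g: "\<gamma> \<bullet> coroot \<beta> > 0" "\<beta> \<bullet> coroot \<gamma> > 0"
      using \<gamma> \<beta> root_nonzero by (simp_all add: inner_coroot_pos_iff inner_commute)
    \<comment> \<open>Uniqueness of \<beta> forbids the pairing 2 at the reflected root, so the
      product subtracted from 2 is positive. The pairing of \<mu> with the coroot of \<gamma> is
      then positive, and being different from 2 by uniqueness again, it is 1.\<close>
    have "reflect \<gamma> \<beta> \<noteq> \<beta>"
      using \<gamma> root_nonzero by (simp add: reflect_eq_self_iff inner_commute)
    then have ne: "\<mu> \<bullet> coroot (reflect \<gamma> \<beta>) \<noteq> 2"
      using \<beta>_uniq \<gamma> \<beta> reflect_root by blast
    have "\<mu> \<bullet> coroot (reflect \<gamma> \<beta>) = 2 - (\<mu> \<bullet> coroot \<gamma>) * (\<gamma> \<bullet> coroot \<beta>)"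
      using \<beta> by (subst inner_coroot_reflect) (simp add: reflect_def inner_diff_left)
    with ne bound[OF reflect_root[OF \<gamma>(1) \<beta>(1)]]
    have "(\<mu> \<bullet> coroot \<gamma>) * (\<gamma> \<bullet> coroot \<beta>) > 0"
      by auto
    then have "\<mu> \<bullet> coroot \<gamma> > 0"
      using g(1) by (simp add: zero_less_mult_iff)
    with bound[OF \<gamma>(1)] \<beta>_uniq[OF \<gamma>(1)] False have 1: "\<mu> \<bullet> coroot \<gamma> = 1"
      by auto
    \<comment> \<open>The lower bound -2 leaves only 1 for the positive integer by which \<beta>
      pairs with the coroot of \<gamma>: the value 2 would already give -3.\<close>
    have "\<mu> \<bullet> coroot (reflect \<beta> \<gamma>) = 1 - 2 * (\<beta> \<bullet> coroot \<gamma>)"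
      using \<beta> 1 by (subst inner_coroot_reflect) (simp add: reflect_def inner_diff_left)
    then have "1 - 2 * (\<beta> \<bullet> coroot \<gamma>) \<ge> - 2"
      using bound[OF reflect_root[OF \<beta>(1) \<gamma>(1)]] by auto
    moreover obtain k where "\<beta> \<bullet> coroot \<gamma> = of_int k"
      using inner_coroot_Ints[OF \<beta>(1) \<gamma>(1)] by (auto elim: Ints_cases)
    ultimately have "\<beta> \<bullet> coroot \<gamma> = 1" using g(2) by auto
    with 1 show ?thesis by simp
  qed
  have nonorth: "\<mu> \<bullet> coroot \<gamma> = \<beta> \<bullet> coroot \<gamma> \<and> norm \<beta> \<le> norm \<gamma>"
    if \<gamma>: "\<gamma> \<in> \<Phi>" "\<gamma> \<bullet> \<beta> \<noteq> 0" for \<gamma>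
  proof -
    \<comment> \<open>Pairing 1 says that twice the inner product is the squared length of \<gamma>;
      the opposite pairing, a positive integer, makes it at least the squared length of
      \<beta>.\<close>
    have le: "norm \<beta> \<le> norm \<gamma>" if \<gamma>: "\<gamma> \<in> \<Phi>" "\<gamma> \<bullet> \<beta> > 0" for \<gamma>
    proof (cases "\<gamma> = \<beta>")
      case False
      then have "\<beta> \<bullet> coroot \<gamma> = 1" using pos[OF that] by blast
      then have *: "2 * (\<beta> \<bullet> \<gamma>) = \<gamma> \<bullet> \<gamma>"
        using that root_nonzero by (simp add: inner_coroot divide_eq_eq split: if_splits)
      have "\<gamma> \<bullet> coroot \<beta> > 0"
        using that \<beta> root_nonzero by (simp add: inner_coroot_pos_iff)
      moreover obtain k where "\<gamma> \<bullet> coroot \<beta> = of_int k"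
        using inner_coroot_Ints[OF \<gamma>(1) \<beta>(1)] by (auto elim: Ints_cases)
      ultimately have "\<gamma> \<bullet> coroot \<beta> \<ge> 1" by auto
      then have "\<gamma> \<bullet> \<gamma> \<ge> \<beta> \<bullet> \<beta>"
        using \<beta> root_nonzero * by (simp add: inner_coroot inner_commute le_divide_eq split: if_splits)
      then show ?thesis by (simp add: norm_eq_sqrt_inner)
    qed simp
    show ?thesis
    proof (cases "\<gamma> \<bullet> \<beta> > 0")
      case False
      then have "- \<gamma> \<in> \<Phi>" "- \<gamma> \<bullet> \<beta> > 0" using \<gamma> uminus_root by auto
      from pos[OF this] le[OF this] show ?thesis by (auto simp: coroot_minus)
    qed (use pos le \<gamma> in blast)
  qed
  have "\<mu> - \<beta> = 0"
  proof (rule ccontr)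
    assume "\<mu> - \<beta> \<noteq> 0"
    then obtain \<delta> where \<delta>: "\<delta> \<in> \<Phi>" "\<delta> \<bullet> (\<mu> - \<beta>) \<noteq> 0" "\<delta> \<bullet> \<beta> \<noteq> 0"
      using ex_non_orthogonal_root[OF \<beta>(1)] by metis
    then have "(\<mu> - \<beta>) \<bullet> coroot \<delta> = 0"
      using nonorth by (simp add: inner_diff_left)
    then have "(\<mu> - \<beta>) \<bullet> \<delta> = 0"
      using inner_coroot_eq_0_iff[OF root_nonzero[OF \<delta>(1)]] by blast
    with \<delta>(2) show False by (simp add: inner_commute)
  qed
  moreover have "norm \<beta> \<le> norm \<gamma>" if \<gamma>: "\<gamma> \<in> \<Phi>" for \<gamma>
  proof (cases "\<gamma> \<bullet> \<beta> = 0")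
    case True
    obtain \<delta> where \<delta>: "\<delta> \<in> \<Phi>" "\<delta> \<bullet> \<gamma> \<noteq> 0" "\<delta> \<bullet> \<beta> \<noteq> 0"
      using ex_non_orthogonal_root[of \<beta> \<gamma>] \<beta> \<gamma> root_nonzero by metis
    \<comment> \<open>A root orthogonal to \<beta> is compared through an image of the same length
      that is not orthogonal to \<beta>.\<close>
    have "reflect \<delta> \<gamma> \<bullet> \<beta> = - ((\<gamma> \<bullet> coroot \<delta>) * (\<delta> \<bullet> \<beta>))"
      using True by (simp add: reflect_def inner_diff_left)
    moreover have "\<gamma> \<bullet> coroot \<delta> \<noteq> 0"
      using \<delta> root_nonzero by (simp add: inner_coroot_eq_0_iff inner_commute)
    ultimately have "norm \<beta> \<le> norm (reflect \<delta> \<gamma>)"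
      using \<delta> \<gamma> nonorth reflect_root by simp
    then show ?thesis by (simp add: norm_reflect)
  qed (use nonorth \<gamma> in blast)
  ultimately show ?thesis using \<beta> by (simp add: short_root_def)
qed

end

section \<open>Simple roots\<close>

locale simple_root_system = finite_root_system \<Phi> for \<Phi> :: "'a::euclidean_space set" +
  fixes I :: "'i set" and \<alpha> :: "'i \<Rightarrow> 'a"
  assumes simple_roots: "simple_roots \<Phi> I \<alpha>"
begin

lemma inj_simple: "inj_on \<alpha> I"
  and simple_root: "i \<in> I \<Longrightarrow> \<alpha> i \<in> \<Phi>"
  and independent_simple: "independent (\<alpha> ` I)"
  and span_simple: "span (\<alpha> ` I) = UNIV"
  using simple_roots by (auto simp: simple_roots_def)

lemma simple_nonzero: "i \<in> I \<Longrightarrow> \<alpha> i \<noteq> 0"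
  using simple_root root_nonzero by blast

lemma root_coeffs:
  assumes "\<beta> \<in> \<Phi>"
  obtains c :: "'i \<Rightarrow> int" where "\<beta> = (\<Sum>i\<in>I. of_int (c i) *\<^sub>R \<alpha> i)"
    "(\<forall>i\<in>I. c i \<ge> 0) \<or> (\<forall>i\<in>I. c i \<le> 0)"
  using simple_roots assms unfolding simple_roots_def by blast

lemma finite_I: "finite I"
  using independent_imp_finite[OF independent_simple] inj_simple by (rule finite_imageD)

lemma simple_coeffs_zero:
  assumes "(\<Sum>i\<in>I. c i *\<^sub>R \<alpha> i) = 0" "i \<in> I"
  shows "c i = 0"
proof -
  have "(\<Sum>v\<in>\<alpha> ` I. c (inv_into I \<alpha> v) *\<^sub>R v) = (\<Sum>i\<in>I. c i *\<^sub>R \<alpha> i)"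
    using inj_simple by (subst sum.reindex) (auto intro!: sum.cong)
  then have "c (inv_into I \<alpha> (\<alpha> i)) = 0"
    using independentD[OF independent_simple, of "\<alpha> ` I" "\<lambda>v. c (inv_into I \<alpha> v)" "\<alpha> i"] assms finite_I
    by auto
  then show ?thesis using inj_simple assms by simp
qed

lemma simple_coeffs_unique:
  assumes "(\<Sum>i\<in>I. c i *\<^sub>R \<alpha> i) = (\<Sum>i\<in>I. d i *\<^sub>R \<alpha> i)" "i \<in> I"
  shows "c i = d i"
  using simple_coeffs_zero[of "\<lambda>i. c i - d i" i] assms
  by (simp add: scaleR_diff_left sum_subtractf)

lemma simple_combination_eq:
  assumes "i \<in> I"
  shows "(\<Sum>j\<in>I. c j *\<^sub>R \<alpha> j) - k *\<^sub>R \<alpha> i = (\<Sum>j\<in>I. (if j = i then c i - k else c j) *\<^sub>R \<alpha> j)"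
proof -
  have "(\<Sum>j\<in>I. (if j = i then c i - k else c j) *\<^sub>R \<alpha> j)
      = (\<Sum>j\<in>I. c j *\<^sub>R \<alpha> j - (if j = i then k *\<^sub>R \<alpha> i else 0))"
    by (rule sum.cong) (auto simp: algebra_simps)
  then show ?thesis using assms finite_I by (simp add: sum_subtractf)
qed

lemma eq_if_inner_coroots:
  assumes "\<And>j. j \<in> I \<Longrightarrow> v \<bullet> coroot (\<alpha> j) = w \<bullet> coroot (\<alpha> j)"
  shows "v = w"
proof -
  have "v - w \<in> span (\<alpha> ` I)" by (simp add: span_simple)
  moreover have "orthogonal (v - w) x" if x: "x \<in> \<alpha> ` I" for x
  proof -
    from x have "x \<noteq> 0" "(v - w) \<bullet> coroot x = 0"
      using assms simple_nonzero by (auto simp: inner_diff_left)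
    then show ?thesis by (simp add: orthogonal_def inner_coroot_eq_0_iff)
  qed
  ultimately have "orthogonal (v - w) (v - w)"
    by (meson orthogonal_to_span)
  then show ?thesis by (simp add: orthogonal_def)
qed

text \<open>The second index is that of the coroot, so \<open>cartan i j\<close> is the change of
  the coordinate \<open>j\<close> of a weight along an edge of color \<open>i\<close>. For simple
  roots the pairing is an integer and the floor only changes its type.\<close>

definition cartan :: "'i \<Rightarrow> 'i \<Rightarrow> int" where
  "cartan i j = \<lfloor>\<alpha> i \<bullet> coroot (\<alpha> j)\<rfloor>"

lemma inner_coroot_cartan: "i \<in> I \<Longrightarrow> j \<in> I \<Longrightarrow> \<alpha> i \<bullet> coroot (\<alpha> j) = of_int (cartan i j)"
  using inner_coroot_Ints[of "\<alpha> i" "\<alpha> j"] simple_root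
  by (auto simp: cartan_def elim: Ints_cases)

lemma cartan_self: "i \<in> I \<Longrightarrow> cartan i i = 2"
  using simple_nonzero by (simp add: cartan_def inner_coroot_self)

lemma cartan_eq_0_sym:
  assumes "i \<in> I" "j \<in> I" "cartan i j = 0"
  shows "cartan j i = 0"
proof -
  have "\<alpha> i \<bullet> coroot (\<alpha> j) = 0" using assms inner_coroot_cartan by simp
  then have "\<alpha> i \<bullet> \<alpha> j = 0"
    using inner_coroot_eq_0_iff[OF simple_nonzero[OF assms(2)]] by blast
  then have "\<alpha> j \<bullet> coroot (\<alpha> i) = 0"
    unfolding inner_coroot inner_commute[of "\<alpha> j" "\<alpha> i"] by simp
  then show ?thesis by (simp add: cartan_def)
qed

text \<open>The root \<open>reflect (\<alpha> j) (\<alpha> i)\<close> has coefficient 1 at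
  \<open>i\<close> and \<open>- cartan i j\<close> at \<open>j\<close>, and the coefficients of a
  root never have mixed signs.\<close>

lemma cartan_nonpos:
  assumes "i \<in> I" "j \<in> I" "i \<noteq> j"
  shows "cartan i j \<le> 0"
proof -
  define c :: "'i \<Rightarrow> real" where "c = (\<lambda>k. if k = i then 1 else 0)"
  have "\<alpha> i = (\<Sum>k\<in>I. if k = i then \<alpha> k else 0)"
    using assms finite_I by simp
  also have "\<dots> = (\<Sum>k\<in>I. c k *\<^sub>R \<alpha> k)"
    by (rule sum.cong) (auto simp: c_def)
  finally have "reflect (\<alpha> j) (\<alpha> i) = (\<Sum>k\<in>I. c k *\<^sub>R \<alpha> k) - of_int (cartan i j) *\<^sub>R \<alpha> j"
    unfolding reflect_def inner_coroot_cartan[OF assms(1,2)] by simp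
  also have "\<dots> = (\<Sum>k\<in>I. (if k = j then c j - of_int (cartan i j) else c k) *\<^sub>R \<alpha> k)"
    using assms by (intro simple_combination_eq)
  finally have eq: "reflect (\<alpha> j) (\<alpha> i) =
      (\<Sum>k\<in>I. (if k = j then c j - of_int (cartan i j) else c k) *\<^sub>R \<alpha> k)" .
  have "reflect (\<alpha> j) (\<alpha> i) \<in> \<Phi>" using assms by (simp add: reflect_root simple_root)
  then obtain d :: "'i \<Rightarrow> int" where d: "reflect (\<alpha> j) (\<alpha> i) = (\<Sum>k\<in>I. of_int (d k) *\<^sub>R \<alpha> k)"
    "(\<forall>k\<in>I. d k \<ge> 0) \<or> (\<forall>k\<in>I. d k \<le> 0)"
    by (rule root_coeffs)
  have e: "of_int (d k) = (if k = j then c j - of_int (cartan i j) else c k)" if "k \<in> I" for k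
    using simple_coeffs_unique[OF d(1)[symmetric, unfolded eq] that] by simp
  from e[of i] assms have "d i = 1" by (simp add: c_def)
  moreover from e[of j] assms have "d j = - cartan i j" by (simp add: c_def)
  ultimately show ?thesis using d(2) assms by force
qed

lemma fund_weight:
  assumes "i \<in> I" "j \<in> I"
  shows "fund_weight I \<alpha> i \<bullet> coroot (\<alpha> j) = (if j = i then 1 else 0)"
proof -
  \<comment> \<open>The weight is the vector that represents the functional \<open>g\<close>, namely
    its adjoint at 1. The value at \<open>\<alpha> i\<close> is half the squared length because the
    coroot carries the factor 2 over the squared length.\<close>
  obtain g where g: "linear g"
    "\<forall>x\<in>\<alpha> ` I. g x = (if x = \<alpha> i then (\<alpha> i \<bullet> \<alpha> i) / 2 else (0::real))"
    using linear_independent_extend[OF independent_simple,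
        of "\<lambda>x. if x = \<alpha> i then (\<alpha> i \<bullet> \<alpha> i) / 2 else (0::real)"] by (elim exE conjE)
  have "adjoint g 1 \<bullet> coroot (\<alpha> j) = (if j = i then 1 else 0)" if "j \<in> I" for j
  proof -
    have "adjoint g 1 \<bullet> \<alpha> j = g (\<alpha> j)"
      using adjoint_works[OF g(1), of "\<alpha> j" 1] by (simp add: inner_commute)
    moreover have "\<alpha> j = \<alpha> i \<longleftrightarrow> j = i"
      using inj_simple assms that by (auto simp: inj_on_def)
    ultimately show ?thesis using g(2) that simple_nonzero[OF that] by (auto simp: inner_coroot)
  qed
  then have "\<exists>!w. \<forall>j\<in>I. w \<bullet> coroot (\<alpha> j) = (if j = i then 1 else 0)"
    by (intro ex1I[of _ "adjoint g 1"]) (auto intro!: eq_if_inner_coroots)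
  from theI'[OF this] show ?thesis using assms unfolding fund_weight_def by blast
qed

lemma inner_fund_weight_combination:
  assumes "j \<in> I"
  shows "(\<Sum>i\<in>I. c i *\<^sub>R fund_weight I \<alpha> i) \<bullet> coroot (\<alpha> j) = c j"
proof -
  have "(\<Sum>i\<in>I. c i *\<^sub>R fund_weight I \<alpha> i) \<bullet> coroot (\<alpha> j) = (\<Sum>i\<in>I. if i = j then c i else 0)"
    using assms by (auto simp: inner_sum_left fund_weight intro!: sum.cong)
  then show ?thesis using assms finite_I by simp
qed

text \<open>Descent on the height, the sum of the coefficients: a positive root that is not simple
  has a simple reflection that lowers its height and keeps it positive.\<close>

lemma root_induct [consumes 1, case_names simple reflect]:
  assumes "\<beta> \<in> \<Phi>"
    and simple: "\<And>i. i \<in> I \<Longrightarrow> P (\<alpha> i)"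
    and reflect: "\<And>i \<gamma>. i \<in> I \<Longrightarrow> \<gamma> \<in> \<Phi> \<Longrightarrow> P \<gamma> \<Longrightarrow> P (reflect (\<alpha> i) \<gamma>)"
  shows "P \<beta>"
proof -
  \<comment> \<open>The negative is carried along so that negative roots are covered as well; for a
    simple root it is reached by the reflection in that root itself.\<close>
  have pos: "P \<beta> \<and> P (- \<beta>)"
    if "\<beta> \<in> \<Phi>" "\<beta> = (\<Sum>i\<in>I. of_int (c i) *\<^sub>R \<alpha> i)" "\<forall>i\<in>I. c i \<ge> 0" for \<beta> and c :: "'i \<Rightarrow> int"
    using that
  proof (induction "nat (\<Sum>i\<in>I. c i)" arbitrary: \<beta> c rule: less_induct)
    case less
    \<comment> \<open>Otherwise every term of \<beta> \<bullet> \<beta>, expanded in simple roots,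
      would be at most 0.\<close>
    have "\<exists>i\<in>I. c i > 0 \<and> \<beta> \<bullet> \<alpha> i > 0"
    proof (rule ccontr)
      assume *: "\<not> ?thesis"
      have "\<beta> \<bullet> \<beta> = (\<Sum>i\<in>I. of_int (c i) * (\<beta> \<bullet> \<alpha> i))"
        by (subst (2) less.prems(2)) (simp add: inner_sum_right)
      also have "\<dots> \<le> 0"
      proof (rule sum_nonpos)
        fix i assume i: "i \<in> I"
        show "of_int (c i) * (\<beta> \<bullet> \<alpha> i) \<le> 0"
        proof (cases "c i = 0")
          case False
          then have "c i > 0" using less.prems(3) i by force
          then show ?thesis using * i by (auto intro!: mult_nonneg_nonpos)
        qed simp
      qed
      finally have "\<beta> = 0" by (metis inner_gt_zero_iff not_le)
      then show False using less.prems(1) zero_not_root by simp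
    qed
    then obtain i where i: "i \<in> I" "c i > 0" "\<beta> \<bullet> \<alpha> i > 0" by blast
    show ?case
    proof (cases "\<exists>j\<in>I. j \<noteq> i \<and> c j > 0")
      case True
      then obtain j where j: "j \<in> I" "j \<noteq> i" "c j > 0" by blast
      have "\<beta> \<bullet> coroot (\<alpha> i) > 0" using i simple_nonzero by (simp add: inner_coroot_pos_iff)
      moreover obtain k where k: "\<beta> \<bullet> coroot (\<alpha> i) = of_int k"
        using inner_coroot_Ints less.prems(1) simple_root i(1) Ints_cases by metis
      ultimately have "k > 0" by simp
      define \<gamma> where "\<gamma> = reflect (\<alpha> i) \<beta>"
      define d where "d = (\<lambda>j. if j = i then c i - k else c j)"
      have \<gamma>: "\<gamma> \<in> \<Phi>" using less.prems(1) i simple_root by (simp add: \<gamma>_def reflect_root)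
      have "\<gamma> = (\<Sum>j\<in>I. of_int (c j) *\<^sub>R \<alpha> j) - of_int k *\<^sub>R \<alpha> i"
        using k less.prems(2) by (simp add: \<gamma>_def reflect_def)
      also have "\<dots> = (\<Sum>j\<in>I. of_int (d j) *\<^sub>R \<alpha> j)"
        using i by (subst simple_combination_eq) (auto simp: d_def intro!: sum.cong)
      finally have \<gamma>_eq: "\<gamma> = (\<Sum>j\<in>I. of_int (d j) *\<^sub>R \<alpha> j)" .
      obtain e :: "'i \<Rightarrow> int" where e: "\<gamma> = (\<Sum>k\<in>I. of_int (e k) *\<^sub>R \<alpha> k)"
        "(\<forall>k\<in>I. e k \<ge> 0) \<or> (\<forall>k\<in>I. e k \<le> 0)"
        using root_coeffs[OF \<gamma>] by blast
      have ed: "e k = d k" if "k \<in> I" for k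
        using simple_coeffs_unique[OF e(1)[symmetric, unfolded \<gamma>_eq] that] by simp
      \<comment> \<open>Only the coefficient at \<open>i\<close> has changed. The positive one at
        \<open>j\<close> remains and fixes the sign of all the others.\<close>
      have "d j > 0" using j by (simp add: d_def)
      then have nn: "\<forall>k\<in>I. d k \<ge> 0" using e(2) ed j(1) by force
      have "(\<Sum>j\<in>I. d j) < (\<Sum>j\<in>I. c j)"
        using i \<open>k > 0\<close> finite_I by (intro sum_strict_mono_ex1) (auto simp: d_def)
      moreover have "(\<Sum>j\<in>I. d j) \<ge> 0" using nn by (simp add: sum_nonneg)
      ultimately have "P \<gamma> \<and> P (- \<gamma>)"
        by (intro less.hyps[OF _ \<gamma> \<gamma>_eq nn]) simp
      then have "P (reflect (\<alpha> i) \<gamma>)" "P (reflect (\<alpha> i) (- \<gamma>))"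
        using reflect i \<gamma> uminus_root by blast+
      then show ?thesis by (simp add: \<gamma>_def reflect_minus)
    next
      case False
      then have "\<forall>j\<in>I - {i}. c j = 0" using less.prems(3) by force
      then have "\<beta> = of_int (c i) *\<^sub>R \<alpha> i"
        using less.prems(2) i finite_I by (simp add: sum.remove[of I i])
      moreover from this have "of_int (c i) = (1::real) \<or> of_int (c i) = (- 1::real)"
        using less.prems(1) root_multiple[OF simple_root[OF i(1)]] by metis
      then have "c i = 1" using i by auto
      ultimately have "\<beta> = \<alpha> i" by simp
      then show ?thesis
        using simple reflect[OF i(1) simple_root[OF i(1)]] i simple_nonzero
        by (simp add: reflect_self)
    qed
  qed
  obtain c :: "'i \<Rightarrow> int" where c: "\<beta> = (\<Sum>i\<in>I. of_int (c i) *\<^sub>R \<alpha> i)"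
    "(\<forall>i\<in>I. c i \<ge> 0) \<or> (\<forall>i\<in>I. c i \<le> 0)"
    using root_coeffs[OF assms(1)] by blast
  show ?thesis
  proof (cases "\<forall>i\<in>I. c i \<ge> 0")
    case True
    then show ?thesis using pos[OF assms(1) c(1)] by blast
  next
    case False
    have "- \<beta> = (\<Sum>i\<in>I. of_int (- c i) *\<^sub>R \<alpha> i)"
      by (subst c(1)) (simp add: sum_negf)
    from pos[OF uminus_root[OF assms(1)] this] False c(2) have "P (- (- \<beta>))" by fastforce
    then show ?thesis by simp
  qed
qed

text \<open>Closure under a reflection passes to its conjugates by simple reflections, hence to the
  reflection in every root.\<close>

lemma weyl_orbit_subset:
  assumes "\<mu> \<in> S" and closed: "\<And>i x. i \<in> I \<Longrightarrow> x \<in> S \<Longrightarrow> reflect (\<alpha> i) x \<in> S"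
  shows "weyl_orbit \<Phi> \<mu> \<subseteq> S"
proof
  have *: "\<forall>x\<in>S. reflect \<beta> x \<in> S" if "\<beta> \<in> \<Phi>" for \<beta>
    using that by (induction rule: root_induct) (auto simp: closed reflect_reflect_root)
  fix x assume "x \<in> weyl_orbit \<Phi> \<mu>"
  then show "x \<in> S"
    by (induction rule: weyl_orbit_induct) (auto simp: assms *)
qed

text \<open>A simple reflection moved from the coroot to the vector stays inside \<open>S\<close>,
  so a restriction known for simple coroots spreads to all of them.\<close>

lemma inner_coroot_mem_if_closed:
  assumes closed: "\<And>i x. i \<in> I \<Longrightarrow> x \<in> S \<Longrightarrow> reflect (\<alpha> i) x \<in> S"
    and simple: "\<And>i x. i \<in> I \<Longrightarrow> x \<in> S \<Longrightarrow> x \<bullet> coroot (\<alpha> i) \<in> B"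
    and "\<beta> \<in> \<Phi>" "x \<in> S"
  shows "x \<bullet> coroot \<beta> \<in> B"
proof -
  have "\<forall>x\<in>S. x \<bullet> coroot \<beta> \<in> B"
    using \<open>\<beta> \<in> \<Phi>\<close> by (induction rule: root_induct) (auto simp: closed simple inner_coroot_reflect)
  with \<open>x \<in> S\<close> show ?thesis by blast
qed

text \<open>The same transport; the equation between weight and root survives because both are
  reflected together.\<close>

lemma inner_coroot_eq_2_if_closed:
  assumes closed: "\<And>i x. i \<in> I \<Longrightarrow> x \<in> S \<Longrightarrow> reflect (\<alpha> i) x \<in> S"
    and simple: "\<And>i x. i \<in> I \<Longrightarrow> x \<in> S \<Longrightarrow> x \<bullet> coroot (\<alpha> i) = 2 \<Longrightarrow> x = \<alpha> i"
    and "\<beta> \<in> \<Phi>" "x \<in> S" "x \<bullet> coroot \<beta> = 2"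
  shows "x = \<beta>"
proof -
  have "\<forall>x\<in>S. x \<bullet> coroot \<beta> = 2 \<longrightarrow> x = \<beta>"
    using \<open>\<beta> \<in> \<Phi>\<close>
  proof (induction rule: root_induct)
    case (reflect i \<gamma>)
    then show ?case using closed by (metis inner_coroot_reflect reflect_reflect)
  qed (use simple in blast)
  with assms show ?thesis by blast
qed

lemma ex_short_simple_root:
  assumes "short_root \<Phi> \<beta>"
  obtains i where "i \<in> I" "short_root \<Phi> (\<alpha> i)"
proof -
  have "\<exists>i\<in>I. norm (\<alpha> i) = norm \<beta>" if "\<beta> \<in> \<Phi>" for \<beta>
    using that by (induction rule: root_induct) (auto simp: norm_reflect)
  then obtain i where "i \<in> I" "norm (\<alpha> i) = norm \<beta>"
    using assms by (auto simp: short_root_def)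
  with that show ?thesis using assms simple_root by (auto simp: short_root_def)
qed

end

section \<open>Ranked posets with colored edges\<close>

text \<open>Newman's lemma, with \<open>A\<close> pointing upward: well-foundedness of the converse
  excludes infinite ascents.\<close>

lemma confluent_if_locally_confluent:
  assumes "wf (A\<inverse>)"
    and local: "\<And>s t u. (s, t) \<in> A \<Longrightarrow> (s, u) \<in> A \<Longrightarrow> \<exists>v. (t, v) \<in> A\<^sup>* \<and> (u, v) \<in> A\<^sup>*"
  shows "(s, t) \<in> A\<^sup>* \<Longrightarrow> (s, u) \<in> A\<^sup>* \<Longrightarrow> \<exists>v. (t, v) \<in> A\<^sup>* \<and> (u, v) \<in> A\<^sup>*"
  using assms(1)
proof (induction s arbitrary: t u rule: wf_induct_rule)
  case (less s)
  show ?case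
  proof (cases "s = t \<or> s = u")
    case True
    then show ?thesis using less.prems by blast
  next
    case False
    then obtain t' u' where tu: "(s, t') \<in> A" "(t', t) \<in> A\<^sup>*" "(s, u') \<in> A" "(u', u) \<in> A\<^sup>*"
      using less.prems by (metis converse_rtranclE)
    obtain v where v: "(t', v) \<in> A\<^sup>*" "(u', v) \<in> A\<^sup>*" using local tu(1,3) by blast
    obtain w where w: "(t, w) \<in> A\<^sup>*" "(v, w) \<in> A\<^sup>*"
      using less.IH[of t' t v] tu v by auto
    have "(u', w) \<in> A\<^sup>*" using v w by simp
    then obtain z where "(u, z) \<in> A\<^sup>*" "(w, z) \<in> A\<^sup>*"
      using less.IH[of u' u w] tu by auto
    then show ?thesis using w by (meson rtrancl_trans)
  qed
qed

text \<open>The Church-Rosser form for zigzags: an upward step is absorbed by confluence, a downward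
  one just lengthens a path to the common bound.\<close>

lemma joinable_if_locally_confluent:
  assumes "wf (A\<inverse>)"
    and local: "\<And>s t u. (s, t) \<in> A \<Longrightarrow> (s, u) \<in> A \<Longrightarrow> \<exists>v. (t, v) \<in> A\<^sup>* \<and> (u, v) \<in> A\<^sup>*"
    and "(x, y) \<in> (A \<union> A\<inverse>)\<^sup>*"
  shows "\<exists>v. (x, v) \<in> A\<^sup>* \<and> (y, v) \<in> A\<^sup>*"
  using assms(3)
proof (induction rule: rtrancl_induct)
  case (step y z)
  then obtain v where v: "(x, v) \<in> A\<^sup>*" "(y, v) \<in> A\<^sup>*" by blast
  show ?case
  proof (cases "(y, z) \<in> A")
    case True
    then obtain w where "(v, w) \<in> A\<^sup>*" "(z, w) \<in> A\<^sup>*"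
      using confluent_if_locally_confluent[OF assms(1), of y v z] local v(2) by blast
    then show ?thesis using v by (meson rtrancl_trans)
  next
    case False
    then have "(z, y) \<in> A" using step by auto
    then show ?thesis using v by (meson converse_rtrancl_into_rtrancl)
  qed
qed blast

section \<open>Components of a ranked colored graph\<close>

locale ranked_poset =
  fixes I :: "'i set" and R :: "('v, 'i) colored_digraph" and r :: "'v \<Rightarrow> nat"
  assumes finite_verts: "finite (verts R)"
    and edges_subset: "edges R \<subseteq> verts R \<times> I \<times> verts R"
    and rank_edge: "(s, i, t) \<in> edges R \<Longrightarrow> r t = Suc (r s)"
begin

lemma edgeD: "(s, i, t) \<in> edges R \<Longrightarrow> s \<in> verts R \<and> i \<in> I \<and> t \<in> verts R"
  using edges_subset by auto

definition step :: "'i set \<Rightarrow> 'v rel" where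
  "step J = {(s, t). \<exists>j\<in>J. (s, j, t) \<in> edges R}"

definition conn :: "'i set \<Rightarrow> 'v rel" where
  "conn J = (step J \<union> (step J)\<inverse>)\<^sup>*"

lemma stepI: "(s, j, t) \<in> edges R \<Longrightarrow> j \<in> J \<Longrightarrow> (s, t) \<in> step J"
  by (auto simp: step_def)

lemma step_verts: "(s, t) \<in> step J \<Longrightarrow> s \<in> verts R \<and> t \<in> verts R"
  using edgeD by (auto simp: step_def)

lemma rank_step: "(s, t) \<in> step J \<Longrightarrow> r t = Suc (r s)"
  using rank_edge by (auto simp: step_def)

lemma rank_steps: "(s, t) \<in> (step J)\<^sup>* \<Longrightarrow> s = t \<or> r s < r t"
  by (induction rule: rtrancl_induct) (auto dest: rank_step)

lemma steps_verts: "(s, t) \<in> (step J)\<^sup>* \<Longrightarrow> s \<in> verts R \<Longrightarrow> t \<in> verts R"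
  by (induction rule: rtrancl_induct) (auto dest: step_verts)

lemma wf_step: "wf ((step J)\<inverse>)"
proof (rule wf_subset[OF wf_measure])
  show "(step J)\<inverse> \<subseteq> Wellfounded.measure (\<lambda>v. Max (r ` verts R) - r v)"
  proof clarify
    fix s t assume st: "(s, t) \<in> step J"
    have "r t \<le> Max (r ` verts R)"
      using step_verts[OF st] finite_verts by simp
    with rank_step[OF st] show "(t, s) \<in> Wellfounded.measure (\<lambda>v. Max (r ` verts R) - r v)"
      by simp
  qed
qed

lemma conn_refl: "(x, x) \<in> conn J"
  by (simp add: conn_def)

lemma conn_sym: "(x, y) \<in> conn J \<Longrightarrow> (y, x) \<in> conn J"
  unfolding conn_def by (meson sym_Un_converse sym_rtrancl symD)

lemma conn_trans: "(x, y) \<in> conn J \<Longrightarrow> (y, z) \<in> conn J \<Longrightarrow> (x, z) \<in> conn J"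
  unfolding conn_def by (rule rtrancl_trans)

lemma step_conn: "(x, y) \<in> step J \<Longrightarrow> (x, y) \<in> conn J"
  unfolding conn_def by blast

lemma arcs_retain_colors: "arcs (retain_colors R J) = step J"
  by (auto simp: arcs_def retain_colors_def step_def)

lemma arcs_eq_step: "arcs R = step I"
  using edgeD by (auto simp: arcs_def step_def)

lemma verts_component: "verts (component R J x) = {y \<in> verts R. (x, y) \<in> conn J}"
  by (simp add: component_def arcs_retain_colors conn_def Let_def)

text \<open>An edge whose source lies in a component has its target there too, so the source alone
  decides membership.\<close>

lemma edges_component:
  "edges (component R J x) = {(s, j, t). (s, j, t) \<in> edges R \<and> j \<in> J \<and> s \<in> verts (component R J x)}"
proof -
  have "t \<in> verts (component R J x)"
    if "(s, j, t) \<in> edges R" "j \<in> J" "s \<in> verts (component R J x)" for s j t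
    using that edgeD[OF that(1)] conn_trans[OF _ step_conn[OF stepI]] by (auto simp: verts_component)
  then show ?thesis
    by (auto simp: component_def retain_colors_def Let_def)
qed

lemma component_eq:
  assumes "y \<in> verts (component R J x)"
  shows "component R J y = component R J x"
proof -
  have v: "verts (component R J y) = verts (component R J x)"
    using assms conn_trans conn_sym unfolding verts_component by blast
  show ?thesis
    by (rule colored_digraph.equality) (use v in \<open>simp_all add: edges_component\<close>)
qed

lemma arcs_component: "arcs (component R J x) = {(s, t) \<in> step J. s \<in> verts (component R J x)}"
  by (auto simp: arcs_def edges_component step_def)

lemma component_step:
  "(s, t) \<in> step J \<Longrightarrow> s \<in> verts (component R J x) \<longleftrightarrow> t \<in> verts (component R J x)"
  using step_verts step_conn conn_trans conn_sym unfolding verts_component by blast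

lemma component_steps:
  "(s, t) \<in> (step J)\<^sup>* \<Longrightarrow> s \<in> verts (component R J x) \<Longrightarrow> t \<in> verts (component R J x)"
  by (induction rule: rtrancl_induct) (auto simp: component_step)

lemma arcs_component_rtrancl:
  assumes "s \<in> verts (component R J x)"
  shows "(s, t) \<in> (arcs (component R J x))\<^sup>* \<longleftrightarrow> (s, t) \<in> (step J)\<^sup>*"
proof
  show "(s, t) \<in> (arcs (component R J x))\<^sup>* \<Longrightarrow> (s, t) \<in> (step J)\<^sup>*"
    by (rule subsetD[OF rtrancl_mono]) (auto simp: arcs_component)
  assume "(s, t) \<in> (step J)\<^sup>*"
  then show "(s, t) \<in> (arcs (component R J x))\<^sup>*"
  proof (induction rule: rtrancl_induct)
    case (step y z)
    then have "y \<in> verts (component R J x)" using component_steps assms by blast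
    with step have "(y, z) \<in> arcs (component R J x)" by (simp add: arcs_component)
    with step show ?case by simp
  qed simp
qed

lemma self_in_component: "x \<in> verts R \<Longrightarrow> x \<in> verts (component R J x)"
  by (simp add: verts_component conn_refl)

lemma finite_component: "finite (verts (component R J x))"
  using finite_verts by (simp add: verts_component)

text \<open>A discrete intermediate value principle along a zigzag, whose rank changes by one at
  each step. It makes the shifted rank surjective onto an interval.\<close>

lemma rank_between:
  assumes "(x, y) \<in> conn J" "x \<in> verts R" "r x \<le> k" "k \<le> r y"
  shows "\<exists>z\<in>verts (component R J x). r z = k"
proof -
  have "k \<le> r y \<longrightarrow> (\<exists>z\<in>verts (component R J x). r z = k)"
    using assms(1) unfolding conn_def
  proof (induction rule: rtrancl_induct)
    case base
    then show ?case using assms self_in_component by force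
  next
    case (step y z)
    have yz: "(x, z) \<in> conn J" "z \<in> verts R"
      using step(1,2) step_verts unfolding conn_def by (auto intro: rtrancl_into_rtrancl)
    from step(2) have "r z = Suc (r y) \<or> r y = Suc (r z)" by (auto dest: rank_step)
    then show ?case using step(3) yz by (cases "k = r z") (auto simp: verts_component)
  qed
  with assms show ?thesis by blast
qed

text \<open>A rank function on a component differs from \<open>r\<close> by a constant, and its
  minimal value 0 fixes the constant. Hence the definite descriptions in \<open>rank_of\<close> and
  \<open>length_of\<close> denote.\<close>

lemma rank_function_component:
  fixes x J
  assumes "x \<in> verts R"
  defines "C \<equiv> verts (component R J x)"
  shows "rank_function (component R J x) \<rho> l \<longleftrightarrow>
    l = Max (r ` C) - Min (r ` C) \<and> (\<forall>y\<in>C. \<rho> y = r y - Min (r ` C))"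
proof -
  have fin: "finite (r ` C)" "r ` C \<noteq> {}" and xC: "x \<in> C"
    using finite_component self_in_component[OF assms(1)] by (auto simp: C_def)
  obtain a where a: "a \<in> C" "r a = Min (r ` C)" using Min_in[OF fin] by auto
  obtain b where b: "b \<in> C" "r b = Max (r ` C)" using Max_in[OF fin] by auto
  have le: "r a \<le> r y" "r y \<le> r b" if "y \<in> C" for y
    using that fin a b by simp_all
  have conn: "(y, z) \<in> conn J" if "y \<in> C" "z \<in> C" for y z
    using that conn_trans conn_sym unfolding C_def verts_component by blast
  have surj: "\<exists>z\<in>C. r z = k" if "r a \<le> k" "k \<le> r b" for k
  proof -
    have "a \<in> verts R" using a(1) by (simp add: C_def verts_component)
    from rank_between[OF conn[OF a(1) b(1)] this that] show ?thesis
      using component_eq[of a J x] a(1) by (simp add: C_def)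
  qed
  show ?thesis
  proof
    assume l: "l = Max (r ` C) - Min (r ` C) \<and> (\<forall>y\<in>C. \<rho> y = r y - Min (r ` C))"
    have "\<rho> ` C = {0..l}"
    proof (intro equalityI subsetI)
      fix k assume "k \<in> \<rho> ` C"
      then show "k \<in> {0..l}" using l le a b by (auto simp: diff_le_mono)
    next
      fix k assume "k \<in> {0..l}"
      then have "k + r a \<le> r b" using l a b le[OF b(1)] by simp
      then obtain z where "z \<in> C" "r z = k + r a"
        using surj[of "k + r a"] by auto
      then show "k \<in> \<rho> ` C" using l a by (intro image_eqI[of _ _ z]) auto
    qed
    moreover have "\<rho> s + 1 = \<rho> t" if "(s, t) \<in> arcs (component R J x)" for s t
    proof -
      have "(s, t) \<in> step J" "s \<in> C" using that by (auto simp: arcs_component C_def)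
      then have "r t = Suc (r s)" "t \<in> C" "s \<in> C"
        using rank_step component_step C_def by auto
      then show ?thesis using l a le[of s] by auto
    qed
    ultimately show "rank_function (component R J x) \<rho> l"
      by (auto simp: rank_function_def C_def)
  next
    assume rf: "rank_function (component R J x) \<rho> l"
    \<comment> \<open>The constant difference is taken in the integers because its sign is
      unknown.\<close>
    have "int (\<rho> y) - int (r y) = int (\<rho> x) - int (r x)" if "(x, y) \<in> conn J" for y
      using that unfolding conn_def
    proof (induction rule: rtrancl_induct)
      case (step y z)
      then have *: "y \<in> C"
        using rtrancl_into_rtrancl[OF step(1,2)] step_verts unfolding C_def verts_component conn_def
        by auto
      show ?case
      proof (cases "(y, z) \<in> step J")
        case True
        then have "(y, z) \<in> arcs (component R J x)" using * by (simp add: arcs_component C_def)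
        then have "\<rho> y + 1 = \<rho> z" using rf by (auto simp: rank_function_def)
        then show ?thesis using step(3) rank_step[OF True] by auto
      next
        case False
        with step have zy: "(z, y) \<in> step J" by auto
        then have "(z, y) \<in> arcs (component R J x)"
          using * component_step[OF zy] by (simp add: arcs_component C_def)
        then have "\<rho> z + 1 = \<rho> y" using rf by (auto simp: rank_function_def)
        then show ?thesis using step(3) rank_step[OF zy] by auto
      qed
    qed simp
    then have *: "int (\<rho> y) - int (r y) = int (\<rho> z) - int (r z)" if "y \<in> C" "z \<in> C" for y z
      using that unfolding C_def verts_component by force
    have im: "\<rho> ` C = {0..l}" using rf by (simp add: rank_function_def C_def)
    then have "0 \<in> \<rho> ` C" "l \<in> \<rho> ` C" by simp_all
    then obtain y0 y1 where y: "y0 \<in> C" "\<rho> y0 = 0" "y1 \<in> C" "\<rho> y1 = l" by auto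
    have 1: "\<rho> y = r y - r a" if "y \<in> C" for y
      using *[OF that y(1)] *[OF a(1) y(1)] y(2) le(1)[OF y(1)] le(1)[OF that] by linarith
    have "\<rho> b \<le> l" using im b(1) by auto
    then have "l = r b - r a" using 1[OF y(3)] 1[OF b(1)] y(4) le(2)[OF y(3)] by linarith
    with 1 show "l = Max (r ` C) - Min (r ` C) \<and> (\<forall>y\<in>C. \<rho> y = r y - Min (r ` C))"
      using a b by simp
  qed
qed

lemma rank_of_component:
  assumes "x \<in> verts R" "y \<in> verts (component R J x)"
  shows "rank_of (component R J x) y = r y - Min (r ` verts (component R J x))"
  unfolding rank_of_def
proof (rule the_equality)
  show "\<exists>\<rho> l. rank_function (component R J x) \<rho> l \<and>
      \<rho> y = r y - Min (r ` verts (component R J x))"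
    using rank_function_component[OF assms(1)]
    by (intro exI[of _ "\<lambda>y. r y - Min (r ` verts (component R J x))"]) blast
qed (use assms rank_function_component[OF assms(1)] in blast)

lemma length_of_component:
  assumes "x \<in> verts R"
  shows "length_of (component R J x) =
    Max (r ` verts (component R J x)) - Min (r ` verts (component R J x))"
  unfolding length_of_def
proof (rule the_equality)
  show "\<exists>\<rho>. rank_function (component R J x) \<rho>
      (Max (r ` verts (component R J x)) - Min (r ` verts (component R J x)))"
    using rank_function_component[OF assms]
    by (intro exI[of _ "\<lambda>y. r y - Min (r ` verts (component R J x))"]) blast
qed (use rank_function_component[OF assms] in blast)

lemma rho_eq: "x \<in> verts R \<Longrightarrow> rho R i x = r x - Min (r ` verts (color_comp R i x))"
  by (simp add: rho_def rank_of_component self_in_component)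

lemma delta_eq: "x \<in> verts R \<Longrightarrow> delta R i x = Max (r ` verts (color_comp R i x)) - r x"
proof -
  assume x: "x \<in> verts R"
  have fin: "finite (r ` verts (color_comp R i x))" "r x \<in> r ` verts (color_comp R i x)"
    using finite_component self_in_component[OF x] by auto
  then show ?thesis
    using x Min_le[OF fin] Max_ge[OF fin]
    by (simp add: delta_def len_def length_of_component rho_eq)
qed

lemma len_eq_rho_delta: "x \<in> verts R \<Longrightarrow> len R i x = rho R i x + delta R i x"
proof -
  assume x: "x \<in> verts R"
  have fin: "finite (r ` verts (color_comp R i x))" "r x \<in> r ` verts (color_comp R i x)"
    using finite_component self_in_component[OF x] by auto
  then show ?thesis
    using x Min_le[OF fin] Max_ge[OF fin]
    by (simp add: delta_eq len_def length_of_component rho_eq)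
qed

lemma color_comp_edge:
  assumes "(s, i, t) \<in> edges R"
  shows "color_comp R i t = color_comp R i s"
proof (rule component_eq)
  have "s \<in> verts (color_comp R i s)" using edgeD[OF assms] by (simp add: self_in_component)
  then show "t \<in> verts (color_comp R i s)"
    using component_step[OF stepI[OF assms singletonI]] by blast
qed

lemma rho_edge:
  assumes "(s, i, t) \<in> edges R"
  shows "rho R i t = Suc (rho R i s)"
proof -
  have "r s \<in> r ` verts (color_comp R i s)"
    using edgeD[OF assms] self_in_component by auto
  then have "Min (r ` verts (color_comp R i s)) \<le> r s"
    using finite_component by simp
  then show ?thesis
    using assms edgeD[OF assms] by (simp add: rho_eq color_comp_edge rank_edge)
qed

lemma delta_edge:
  assumes "(s, i, t) \<in> edges R"
  shows "delta R i s = Suc (delta R i t)"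
proof -
  have "r t \<in> r ` verts (color_comp R i t)"
    using edgeD[OF assms] self_in_component by auto
  then have "r t \<le> Max (r ` verts (color_comp R i t))"
    using finite_component by simp
  then show ?thesis
    using assms edgeD[OF assms] by (simp add: delta_eq color_comp_edge rank_edge)
qed

lemma ex_maximal_above:
  "\<exists>m. (x, m) \<in> (step J)\<^sup>* \<and> (\<forall>j\<in>J. \<forall>t. (m, j, t) \<notin> edges R)"
proof (induction x rule: wf_induct_rule[OF wf_step[of J]])
  case (1 x)
  show ?case
  proof (cases "\<exists>j\<in>J. \<exists>t. (x, j, t) \<in> edges R")
    case True
    then obtain t where t: "(x, t) \<in> step J" by (auto simp: step_def)
    with 1[of t] show ?thesis by (meson converse_iff converse_rtrancl_into_rtrancl)
  qed blast
qed

lemma maximal_component_iff: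
  "maximal_elem (component R J x) m \<longleftrightarrow>
     m \<in> verts (component R J x) \<and> (\<forall>j\<in>J. \<forall>t. (m, j, t) \<notin> edges R)"
proof (cases "m \<in> verts (component R J x)")
  case True
  have "(\<forall>t\<in>verts (component R J x). (m, t) \<in> (step J)\<^sup>* \<longrightarrow> t = m) \<longleftrightarrow>
      (\<forall>j\<in>J. \<forall>t. (m, j, t) \<notin> edges R)"
  proof (intro iffI ballI allI notI impI)
    fix j t assume *: "\<forall>t\<in>verts (component R J x). (m, t) \<in> (step J)\<^sup>* \<longrightarrow> t = m"
      "j \<in> J" "(m, j, t) \<in> edges R"
    then have "(m, t) \<in> step J" by (simp add: stepI)
    then have "t = m" using * True component_step by blast
    then show False using rank_edge[OF *(3)] by simp
  next
    fix t assume "\<forall>j\<in>J. \<forall>t. (m, j, t) \<notin> edges R" "(m, t) \<in> (step J)\<^sup>*"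
    then show "t = m" by (auto simp: step_def elim: converse_rtranclE)
  qed
  then show ?thesis using True by (simp add: maximal_elem_def arcs_component_rtrancl)
qed (simp add: maximal_elem_def)

lemma maximal_iff: "maximal_elem R m \<longleftrightarrow> m \<in> verts R \<and> (\<forall>i t. (m, i, t) \<notin> edges R)"
proof (intro iffI conjI allI notI)
  fix i t assume m: "maximal_elem R m" "(m, i, t) \<in> edges R"
  then have "(m, t) \<in> (arcs R)\<^sup>*" "t \<in> verts R"
    using edgeD by (auto simp: arcs_eq_step stepI)
  then have "t = m" using m by (auto simp: maximal_elem_def)
  then show False using rank_edge[OF m(2)] by simp
next
  assume m: "m \<in> verts R \<and> (\<forall>i t. (m, i, t) \<notin> edges R)"
  then have "t = m" if "(m, t) \<in> (arcs R)\<^sup>*" for t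
    using that by (auto simp: arcs_def elim: converse_rtranclE)
  then show "maximal_elem R m" using m by (auto simp: maximal_elem_def)
qed (auto simp: maximal_elem_def)

text \<open>Newman's lemma inside one component: two maximal elements are joined by a zigzag, hence
  have a common upper bound, which must equal each of them.\<close>

lemma unique_maximal_component:
  assumes "x \<in> verts R"
    and local: "\<And>s t u. (s, t) \<in> step J \<Longrightarrow> (s, u) \<in> step J \<Longrightarrow>
      \<exists>v. (t, v) \<in> (step J)\<^sup>* \<and> (u, v) \<in> (step J)\<^sup>*"
  shows "\<exists>!m. maximal_elem (component R J x) m"
proof -
  obtain m where m: "(x, m) \<in> (step J)\<^sup>*" "\<forall>j\<in>J. \<forall>t. (m, j, t) \<notin> edges R"
    using ex_maximal_above by blast
  have mC: "m \<in> verts (component R J x)"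
    using component_steps[OF m(1) self_in_component[OF assms(1)]] .
  show ?thesis
  proof (rule ex1I[of _ m])
    show "maximal_elem (component R J x) m" using m mC by (simp add: maximal_component_iff)
    fix m' assume m': "maximal_elem (component R J x) m'"
    then have "(m', m) \<in> conn J"
      using mC conn_trans conn_sym unfolding maximal_component_iff verts_component by blast
    then obtain v where v: "(m', v) \<in> (step J)\<^sup>*" "(m, v) \<in> (step J)\<^sup>*"
      using joinable_if_locally_confluent[OF wf_step, of J m' m] local unfolding conn_def by blast
    have "v = m" using v(2) m(2) by (auto simp: step_def elim: converse_rtranclE)
    moreover have "v = m'"
      using v(1) m' by (auto simp: maximal_component_iff step_def elim: converse_rtranclE)
    ultimately show "m' = m" by simp
  qed
qed

text \<open>Climbing from \<open>t\<close> and from \<open>u\<close> within the component of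
  \<open>s\<close> ends in maximal elements, which coincide. In this way the axioms on components of
  two colors supply local confluence.\<close>

lemma joinable_if_unique_maximal:
  assumes "\<exists>!m. maximal_elem (component R J s) m" "(s, t) \<in> step J" "(s, u) \<in> step J"
  shows "\<exists>v. (t, v) \<in> (step J)\<^sup>* \<and> (u, v) \<in> (step J)\<^sup>*"
proof -
  have tu: "t \<in> verts (component R J s)" "u \<in> verts (component R J s)"
    using assms component_step step_verts self_in_component by blast+
  obtain m where m: "(t, m) \<in> (step J)\<^sup>*" "\<forall>j\<in>J. \<forall>t. (m, j, t) \<notin> edges R"
    using ex_maximal_above by blast
  obtain n where n: "(u, n) \<in> (step J)\<^sup>*" "\<forall>j\<in>J. \<forall>t. (n, j, t) \<notin> edges R"
    using ex_maximal_above by blast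
  have "maximal_elem (component R J s) m" "maximal_elem (component R J s) n"
    using m n component_steps tu by (simp_all add: maximal_component_iff)
  then have "m = n" using assms(1) by blast
  with m n show ?thesis by blast
qed

lemma connected_iff: "connected_digraph R \<longleftrightarrow> (\<forall>x\<in>verts R. \<forall>y\<in>verts R. (x, y) \<in> conn I)"
  by (simp add: connected_digraph_def arcs_eq_step conn_def)

lemma step_mono: "J \<subseteq> K \<Longrightarrow> step J \<subseteq> step K"
  by (auto simp: step_def)

lemma unique_maximal:
  assumes "connected_digraph R" "verts R \<noteq> {}"
    and local: "\<And>s t u. (s, t) \<in> step I \<Longrightarrow> (s, u) \<in> step I \<Longrightarrow>
      \<exists>v. (t, v) \<in> (step I)\<^sup>* \<and> (u, v) \<in> (step I)\<^sup>*"
  shows "\<exists>!m. maximal_elem R m"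
proof -
  obtain x where x: "x \<in> verts R" using assms(2) by blast
  have "maximal_elem R m \<longleftrightarrow> maximal_elem (component R I x) m" for m
    using assms(1) x edgeD unfolding maximal_iff maximal_component_iff verts_component connected_iff
    by blast
  then show ?thesis using unique_maximal_component[OF x, of I] local by simp
qed

text \<open>Two targets of edges of one color are comparable in the chain and have the same
  rank.\<close>

lemma fibrous_unique_out:
  assumes "fibrous I R" "(s, i, t) \<in> edges R" "(s, i, u) \<in> edges R"
  shows "t = u"
proof -
  let ?C = "color_comp R i s"
  have s: "i \<in> I" "s \<in> verts R" using edgeD assms by auto
  have tu: "t \<in> verts ?C" "u \<in> verts ?C"
    using assms(2,3) self_in_component[OF s(2)] component_step[OF stepI] by blast+
  then have "(t, u) \<in> (step {i})\<^sup>* \<or> (u, t) \<in> (step {i})\<^sup>*"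
    using assms(1) s unfolding fibrous_def is_chain_def by (metis arcs_component_rtrancl)
  then show ?thesis using rank_steps rank_edge[OF assms(2)] rank_edge[OF assms(3)] by fastforce
qed

lemma fibrous_unique_in:
  assumes "fibrous I R" "(t, i, s) \<in> edges R" "(u, i, s) \<in> edges R"
  shows "t = u"
proof -
  let ?C = "color_comp R i s"
  have s: "i \<in> I" "s \<in> verts R" using edgeD assms by auto
  have tu: "t \<in> verts ?C" "u \<in> verts ?C"
    using assms(2,3) self_in_component[OF s(2)] component_step[OF stepI] by blast+
  then have "(t, u) \<in> (step {i})\<^sup>* \<or> (u, t) \<in> (step {i})\<^sup>*"
    using assms(1) s unfolding fibrous_def is_chain_def by (metis arcs_component_rtrancl)
  then show ?thesis using rank_steps rank_edge[OF assms(2)] rank_edge[OF assms(3)] by fastforce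
qed

end

section \<open>Fibrous posets, with at most one edge of each color into and out of a vertex\<close>

locale fibrous_poset = ranked_poset +
  assumes unique_out: "(s, i, t) \<in> edges R \<Longrightarrow> (s, i, u) \<in> edges R \<Longrightarrow> t = u"
    and unique_in: "(t, i, s) \<in> edges R \<Longrightarrow> (u, i, s) \<in> edges R \<Longrightarrow> t = u"
begin

text \<open>By uniqueness of edges, a zigzag of one color can only continue in its direction or
  retrace itself.\<close>

lemma conn_color_comparable:
  assumes "(x, y) \<in> conn {i}"
  shows "(x, y) \<in> (step {i})\<^sup>* \<or> (y, x) \<in> (step {i})\<^sup>*"
  using assms unfolding conn_def
proof (induction rule: rtrancl_induct)
  case (step y z)
  show ?case
  proof (cases "(y, z) \<in> step {i}")
    case yz: True
    show ?thesis
    proof (cases "(x, y) \<in> (step {i})\<^sup>*")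
      case True
      then show ?thesis using yz by (meson rtrancl_into_rtrancl)
    next
      case False
      then have "(y, x) \<in> (step {i})\<^sup>*" "y \<noteq> x" using step(3) by auto
      then obtain w where "(y, w) \<in> step {i}" "(w, x) \<in> (step {i})\<^sup>*"
        by (metis converse_rtranclE)
      moreover from this have "w = z" using yz unique_out by (auto simp: step_def)
      ultimately show ?thesis by blast
    qed
  next
    case False
    then have zy: "(z, y) \<in> step {i}" using step(2) by auto
    show ?thesis
    proof (cases "(y, x) \<in> (step {i})\<^sup>*")
      case True
      then show ?thesis using zy by (meson converse_rtrancl_into_rtrancl)
    next
      case False
      then have "(x, y) \<in> (step {i})\<^sup>*" "y \<noteq> x" using step(3) by auto
      then obtain w where "(x, w) \<in> (step {i})\<^sup>*" "(w, y) \<in> step {i}"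
        by (metis rtranclE)
      moreover from this have "w = z" using zy unique_in by (auto simp: step_def)
      ultimately show ?thesis by blast
    qed
  qed
qed simp

lemma fibrous: "fibrous I R"
  unfolding fibrous_def is_chain_def
proof (intro ballI)
  fix i x s t assume "s \<in> verts (color_comp R i x)" "t \<in> verts (color_comp R i x)"
  moreover from this have "(s, t) \<in> conn {i}"
    using conn_trans conn_sym unfolding verts_component by blast
  ultimately show "(s, t) \<in> (arcs (color_comp R i x))\<^sup>* \<or> (t, s) \<in> (arcs (color_comp R i x))\<^sup>*"
    using conn_color_comparable by (simp add: arcs_component_rtrancl)
qed

text \<open>A vertex of least rank in the chain lies strictly below, and the path from it ends with
  the desired edge.\<close>

lemma rho_pos_edge:
  assumes "x \<in> verts R" "rho R i x > 0"
  obtains s where "(s, i, x) \<in> edges R"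
proof -
  let ?C = "verts (color_comp R i x)"
  have "Min (r ` ?C) \<in> r ` ?C"
    using finite_component self_in_component[OF assms(1)] by (intro Min_in) auto
  then obtain y where y: "y \<in> ?C" "r y = Min (r ` ?C)" by auto
  then have "r y < r x" using assms by (simp add: rho_eq)
  moreover have "(x, y) \<in> (step {i})\<^sup>* \<or> (y, x) \<in> (step {i})\<^sup>*"
    using conn_color_comparable y by (simp add: verts_component)
  ultimately have "(y, x) \<in> (step {i})\<^sup>*" "y \<noteq> x" using rank_steps[of x y "{i}"] by auto
  then obtain s where "(s, x) \<in> step {i}" by (metis rtranclE)
  then show ?thesis using that by (auto simp: step_def)
qed

lemma delta_pos_edge:
  assumes "x \<in> verts R" "delta R i x > 0"
  obtains t where "(x, i, t) \<in> edges R"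
proof -
  let ?C = "verts (color_comp R i x)"
  have "Max (r ` ?C) \<in> r ` ?C"
    using finite_component self_in_component[OF assms(1)] by (intro Max_in) auto
  then obtain y where y: "y \<in> ?C" "r y = Max (r ` ?C)" by auto
  then have "r x < r y" using assms by (simp add: delta_eq)
  moreover have "(x, y) \<in> (step {i})\<^sup>* \<or> (y, x) \<in> (step {i})\<^sup>*"
    using conn_color_comparable y by (simp add: verts_component)
  ultimately have "(x, y) \<in> (step {i})\<^sup>*" "y \<noteq> x" using rank_steps[of y x "{i}"] by auto
  then obtain t where "(x, t) \<in> step {i}" by (metis converse_rtranclE)
  then show ?thesis using that by (auto simp: step_def)
qed

lemma rho_0: "x \<in> verts R \<Longrightarrow> (\<And>s. (s, i, x) \<notin> edges R) \<Longrightarrow> rho R i x = 0"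
  using rho_pos_edge by blast

lemma delta_0: "x \<in> verts R \<Longrightarrow> (\<And>t. (x, i, t) \<notin> edges R) \<Longrightarrow> delta R i x = 0"
  using delta_pos_edge by blast

end

section \<open>Weights of colored posets\<close>

context finite_root_system
begin

lemma weyl_orbit_inner_coroot:
  assumes "x \<in> weyl_orbit \<Phi> \<mu>" "\<And>\<beta>. \<beta> \<in> \<Phi> \<Longrightarrow> \<mu> \<bullet> coroot \<beta> \<in> B" "\<beta> \<in> \<Phi>"
  shows "x \<bullet> coroot \<beta> \<in> B"
proof -
  have "\<forall>\<beta>\<in>\<Phi>. x \<bullet> coroot \<beta> \<in> B"
    using assms(1)
  proof (induction rule: weyl_orbit_induct)
    case (refl y \<gamma>)
    then show ?case by (metis inner_coroot_reflect reflect_root)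
  qed (use assms(2) in blast)
  with assms(3) show ?thesis by blast
qed

text \<open>The two points have equal length, which fixes the lower pairing at -1; adding the root
  raises it by 2.\<close>

lemma weyl_orbit_add_root:
  assumes "x \<in> weyl_orbit \<Phi> \<mu>" "x + \<beta> \<in> weyl_orbit \<Phi> \<mu>" "\<beta> \<in> \<Phi>"
  shows "x \<bullet> coroot \<beta> = - 1" "(x + \<beta>) \<bullet> coroot \<beta> = 1"
proof -
  show 1: "x \<bullet> coroot \<beta> = - 1"
  proof -
    have "norm (x + \<beta>) = norm x"
      using norm_weyl_orbit[OF assms(1)] norm_weyl_orbit[OF assms(2)] by simp
    then show ?thesis using norm_add_eq_iff[OF root_nonzero[OF assms(3)]] by blast
  qed
  have "\<beta> \<bullet> coroot \<beta> = 2" by (rule inner_coroot_self[OF root_nonzero[OF assms(3)]])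
  with 1 show "(x + \<beta>) \<bullet> coroot \<beta> = 1" by (simp only: inner_add_left)
qed

end

lemma reflect_if_coroot_minus_1: "x \<bullet> coroot \<beta> = - 1 \<Longrightarrow> reflect \<beta> x = x + \<beta>"
  by (simp add: reflect_def)

lemma reflect_if_coroot_1: "x \<bullet> coroot \<beta> = 1 \<Longrightarrow> reflect \<beta> x = x - \<beta>"
  by (simp add: reflect_def)

lemma reflect_if_coroot_0: "x \<bullet> coroot \<beta> = 0 \<Longrightarrow> reflect \<beta> x = x"
  by (simp add: reflect_def)

locale weighted_poset = simple_root_system \<Phi> I \<alpha> + ranked_poset I R r
  for \<Phi> :: "'a::euclidean_space set" and I :: "'i set" and \<alpha> :: "'i \<Rightarrow> 'a"
    and R :: "('v, 'i) colored_digraph" and r :: "'v \<Rightarrow> nat"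
begin

definition m :: "'i \<Rightarrow> 'v \<Rightarrow> int" where
  "m i x = int (rho R i x) - int (delta R i x)"

lemma wt_inner_coroot: "i \<in> I \<Longrightarrow> wt I \<alpha> R x \<bullet> coroot (\<alpha> i) = of_int (m i x)"
  unfolding wt_def m_def by (rule inner_fund_weight_combination)

lemma wt_eqI: "(\<And>i. i \<in> I \<Longrightarrow> v \<bullet> coroot (\<alpha> i) = of_int (m i x)) \<Longrightarrow> wt I \<alpha> R x = v"
  by (rule eq_if_inner_coroots) (simp add: wt_inner_coroot)

lemma wt_in_weights: "wt I \<alpha> R x \<in> weights I \<alpha>"
  unfolding wt_def weights_def
  by (intro CollectI exI[of _ "\<lambda>i. int (rho R i x) - int (delta R i x)"]) simp

lemma wt_in_dominant_weights:
  assumes "\<And>i. i \<in> I \<Longrightarrow> m i x \<ge> 0"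
  shows "wt I \<alpha> R x \<in> dominant_weights I \<alpha>"
proof -
  have "wt I \<alpha> R x = (\<Sum>i\<in>I. of_nat (nat (m i x)) *\<^sub>R fund_weight I \<alpha> i)"
    unfolding wt_def using assms by (intro sum.cong) (auto simp: m_def)
  then show ?thesis unfolding dominant_weights_def by (intro CollectI exI[of _ "\<lambda>i. nat (m i x)"]) simp
qed

end

locale structured_poset = weighted_poset \<Phi> I \<alpha> R r + fibrous_poset I R r
  for \<Phi> :: "'a::euclidean_space set" and I :: "'i set" and \<alpha> :: "'i \<Rightarrow> 'a"
    and R :: "('v, 'i) colored_digraph" and r :: "'v \<Rightarrow> nat" +
  assumes structured: "structured I \<alpha> R" and connected: "connected_digraph R"
begin

lemma wt_edge: "(s, i, t) \<in> edges R \<Longrightarrow> wt I \<alpha> R t = wt I \<alpha> R s + \<alpha> i"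
  using structured by (force simp: structured_def)

lemma m_edge:
  assumes "(s, i, t) \<in> edges R" "j \<in> I"
  shows "m j t = m j s + cartan i j"
proof -
  have i: "i \<in> I" using edgeD[OF assms(1)] by blast
  have "real_of_int (m j t) = wt I \<alpha> R t \<bullet> coroot (\<alpha> j)"
    using wt_inner_coroot[OF assms(2)] by simp
  also have "\<dots> = of_int (m j s) + of_int (cartan i j)"
    unfolding wt_edge[OF assms(1)] inner_add_left wt_inner_coroot[OF assms(2)]
      inner_coroot_cartan[OF i assms(2)] ..
  finally show ?thesis by linarith
qed

lemma steps_to_maximal:
  assumes "\<exists>!m. maximal_elem R m" "maximal_elem R mx" "x \<in> verts R"
  shows "(x, mx) \<in> (step I)\<^sup>*"
proof -
  obtain n where n: "(x, n) \<in> (step I)\<^sup>*" "\<forall>i\<in>I. \<forall>t. (n, i, t) \<notin> edges R"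
    using ex_maximal_above by blast
  then have "maximal_elem R n"
    using steps_verts assms(3) edgeD unfolding maximal_iff by blast
  with n(1) assms show ?thesis by blast
qed

text \<open>Peaks of one color are trivial because outgoing edges are unique, and joining inside a
  component of two colors also joins in the whole poset.\<close>

lemma unique_maximal_if_peaks:
  assumes "verts R \<noteq> {}"
    and peak: "\<And>s i t j u. (s, i, t) \<in> edges R \<Longrightarrow> (s, j, u) \<in> edges R \<Longrightarrow> i \<noteq> j \<Longrightarrow>
      \<exists>!m. maximal_elem (component R {i, j} s) m"
  shows "\<exists>!m. maximal_elem R m"
proof (rule unique_maximal[OF connected assms(1)])
  fix s t u assume "(s, t) \<in> step I" "(s, u) \<in> step I"
  then obtain i j where ij: "i \<in> I" "j \<in> I" "(s, i, t) \<in> edges R" "(s, j, u) \<in> edges R"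
    by (auto simp: step_def)
  show "\<exists>v. (t, v) \<in> (step I)\<^sup>* \<and> (u, v) \<in> (step I)\<^sup>*"
  proof (cases "i = j")
    case True
    then show ?thesis using unique_out ij by blast
  next
    case False
    have "\<exists>v. (t, v) \<in> (step {i, j})\<^sup>* \<and> (u, v) \<in> (step {i, j})\<^sup>*"
      using ij by (intro joinable_if_unique_maximal[OF peak[OF ij(3,4) False]] stepI) auto
    moreover have "(step {i, j})\<^sup>* \<subseteq> (step I)\<^sup>*"
      using ij by (intro rtrancl_mono step_mono) auto
    ultimately show ?thesis by blast
  qed
qed

lemma m_maximal: "maximal_elem R x \<Longrightarrow> m i x \<ge> 0"
  unfolding maximal_iff m_def using delta_0[of x i] by simp

end

section \<open>Minuscule splitting posets\<close>

context structured_poset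
begin

theorem minuscule_splitting_poset_if:
  assumes nonempty: "edges R \<noteq> {}"
    and len: "\<And>i x. i \<in> I \<Longrightarrow> x \<in> verts R \<Longrightarrow> len R i x \<le> 1"
    and diamond: "\<And>i j x. i \<in> I \<Longrightarrow> j \<in> I \<Longrightarrow> \<alpha> i \<bullet> coroot (\<alpha> j) = 0 \<Longrightarrow> \<alpha> j \<bullet> coroot (\<alpha> i) = 0 \<Longrightarrow>
      x \<in> verts R \<Longrightarrow> \<exists>!m. maximal_elem (component R {i, j} x) m"
  shows "\<exists>m. maximal_elem R m \<and> (\<forall>m'. maximal_elem R m' \<longrightarrow> m' = m) \<and>
    wt I \<alpha> R m \<in> dominant_weights I \<alpha> \<and> minuscule \<Phi> I \<alpha> (wt I \<alpha> R m) \<and>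
    R \<cong>\<^sub>c minuscule_splitting_poset \<Phi> I \<alpha> (wt I \<alpha> R m)"
proof -
  let ?w = "wt I \<alpha> R"
  have rd: "rho R i x + delta R i x \<le> 1" if "i \<in> I" "x \<in> verts R" for i x
    using len[OF that] len_eq_rho_delta[OF that(2)] by simp
  have m_range: "m i x \<in> {0, 1, - 1}" if "i \<in> I" "x \<in> verts R" for i x
    using rd[OF that] unfolding m_def by auto
  \<comment> \<open>An outgoing edge uses up the total length 1 of the chain, so \<open>rho\<close>
    vanishes at its source.\<close>
  have m_edge_out: "m i s = - 1" if "(s, i, t) \<in> edges R" for s i t
    using rd[of i s] delta_edge[OF that] edgeD[OF that] by (simp add: m_def)
  have ex_out: "\<exists>t. (x, i, t) \<in> edges R" if "x \<in> verts R" "m i x = - 1" for x i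
    using delta_0[OF that(1), of i] that(2) by (auto simp: m_def)
  have ex_in: "\<exists>s. (s, i, x) \<in> edges R" if "x \<in> verts R" "m i x = 1" for x i
    using rho_0[OF that(1), of i] that(2) by (auto simp: m_def)
  have w_edge: "?w t = reflect (\<alpha> i) (?w s)" if "(s, i, t) \<in> edges R" for s i t
    using wt_edge[OF that] wt_inner_coroot[of i s] m_edge_out[OF that] edgeD[OF that]
    by (simp add: reflect_if_coroot_minus_1)
  have peak: "\<exists>!m. maximal_elem (component R {i, j} s) m"
    if st: "(s, i, t) \<in> edges R" and su: "(s, j, u) \<in> edges R" and ij: "i \<noteq> j" for s i t j u
  proof -
    have I: "i \<in> I" "j \<in> I" "s \<in> verts R" "t \<in> verts R" using edgeD st su by auto
    \<comment> \<open>After the edge of color \<open>i\<close> the coordinate \<open>j\<close> is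
      \<open>- 1 + cartan i j\<close>. It must stay at least -1, while the Cartan integer is at most
      0.\<close>
    have "cartan i j = 0"
      using m_edge[OF st I(2)] m_edge_out[OF su] m_range[OF I(2,4)] cartan_nonpos[OF I(1,2) ij] by auto
    with cartan_eq_0_sym[OF I(1,2)] show ?thesis
      using I inner_coroot_cartan by (intro diamond) auto
  qed
  have "verts R \<noteq> {}" using nonempty edgeD by auto
  then have ex1: "\<exists>!m. maximal_elem R m" using peak by (rule unique_maximal_if_peaks)
  then obtain mx where mx: "maximal_elem R mx" by blast
  have reach: "(x, mx) \<in> (step I)\<^sup>*" if "x \<in> verts R" for x
    using steps_to_maximal[OF ex1 mx that] .
  have topV: "mx \<in> verts R" using mx by (simp add: maximal_iff)
  define S where "S = ?w ` verts R"
  have S_closed: "reflect (\<alpha> i) y \<in> S" if iy: "i \<in> I" "y \<in> S" for i y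
  proof -
    obtain x where x: "x \<in> verts R" "y = ?w x" using iy(2) by (auto simp: S_def)
    consider "m i x = 0" | "m i x = 1" | "m i x = - 1" using m_range[OF iy(1) x(1)] by auto
    then show ?thesis
    proof cases
      case 1
      then show ?thesis using iy x wt_inner_coroot[OF iy(1), of x] by (simp add: reflect_if_coroot_0)
    next
      case 2
      then obtain s where s: "(s, i, x) \<in> edges R" using ex_in x by blast
      then have "reflect (\<alpha> i) y = ?w s" using w_edge x by simp
      then show ?thesis using edgeD[OF s] by (simp add: S_def)
    next
      case 3
      then obtain t where t: "(x, i, t) \<in> edges R" using ex_out x by blast
      then have "reflect (\<alpha> i) y = ?w t" using w_edge x by simp
      then show ?thesis using edgeD[OF t] by (simp add: S_def)
    qed
  qed
  have "?w x \<in> weyl_orbit \<Phi> (?w mx)" if "x \<in> verts R" for x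
    using reach[OF that]
  proof (induction rule: converse_rtrancl_induct)
    case (step x y)
    then obtain i where i: "(x, i, y) \<in> edges R" "i \<in> I" by (auto simp: step_def)
    then have "?w x = reflect (\<alpha> i) (?w y)" using w_edge by simp
    then show ?case using step weyl_orbit_reflect simple_root[OF i(2)] by simp
  qed (rule weyl_orbit_self)
  moreover have "weyl_orbit \<Phi> (?w mx) \<subseteq> S"
    using topV S_closed by (intro weyl_orbit_subset) (auto simp: S_def)
  ultimately have S_eq: "S = weyl_orbit \<Phi> (?w mx)" by (auto simp: S_def)
  \<comment> \<open>Induction downward from the maximal vertex. Equal weights have the same
    coordinate -1, so both vertices have an edge of the same color to vertices of equal weight;
    these coincide by induction, and uniqueness of incoming edges identifies the sources.\<close>
  have inj: "y = x" if "x \<in> verts R" "y \<in> verts R" "?w y = ?w x" for x y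
    using reach[OF that(1)] that(2,3)
  proof (induction arbitrary: y rule: converse_rtrancl_induct)
    case base
    have "m i y \<ge> 0" if "i \<in> I" for i
      using wt_inner_coroot[OF that, of y] wt_inner_coroot[OF that, of mx] base m_maximal[OF mx, of i]
      by simp
    \<comment> \<open>A dominant weight excludes outgoing edges, since the source of an edge has a
      coordinate -1.\<close>
    then have "(y, i, t) \<notin> edges R" for i t using m_edge_out edgeD by fastforce
    then have "maximal_elem R y" using base by (simp add: maximal_iff)
    then show ?case using ex1 mx by blast
  next
    case (step x z)
    then obtain i where i: "(x, i, z) \<in> edges R" "i \<in> I" by (auto simp: step_def)
    have "m i y = - 1"
      using m_edge_out[OF i(1)] wt_inner_coroot[OF i(2), of y] wt_inner_coroot[OF i(2), of x] step
      by simp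
    then obtain z' where z': "(y, i, z') \<in> edges R" using ex_out step by blast
    then have "z' = z" using step wt_edge[OF i(1)] wt_edge[OF z'] edgeD[OF z'] by simp
    then show ?case using unique_in i z' by blast
  qed
  have edge_iff: "(s, i, t) \<in> edges R \<longleftrightarrow> i \<in> I \<and> ?w s + \<alpha> i = ?w t"
    if st: "s \<in> verts R" "t \<in> verts R" for s i t
  proof
    assume "i \<in> I \<and> ?w s + \<alpha> i = ?w t"
    then have i: "i \<in> I" "?w s + \<alpha> i = ?w t" by auto
    \<comment> \<open>Orbit points that differ by \<open>\<alpha> i\<close> have pairing -1 at the
      lower one, so an edge exists there; injectivity identifies its target.\<close>
    have "?w s \<in> weyl_orbit \<Phi> (?w mx)" "?w s + \<alpha> i \<in> weyl_orbit \<Phi> (?w mx)"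
      using st i S_eq by (auto simp: S_def)
    from weyl_orbit_add_root(1)[OF this simple_root[OF i(1)]]
    have "m i s = - 1" using wt_inner_coroot[OF i(1), of s] by simp
    then obtain t' where t': "(s, i, t') \<in> edges R" using ex_out st by blast
    then have "t' = t" using inj[of t t'] st wt_edge[OF t'] edgeD[OF t'] i by simp
    with t' show "(s, i, t) \<in> edges R" by simp
  qed (use edgeD wt_edge in auto)
  have "bij_betw ?w (verts R) (weyl_orbit \<Phi> (?w mx))"
    using inj unfolding bij_betw_def S_eq[symmetric] S_def by (auto intro: inj_onI)
  moreover have "?w s \<in> weyl_orbit \<Phi> (?w mx)" if "s \<in> verts R" for s
    using that by (simp add: S_def flip: S_eq)
  ultimately have "R \<cong>\<^sub>c minuscule_splitting_poset \<Phi> I \<alpha> (?w mx)"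
    unfolding colored_iso_def minuscule_splitting_poset_def
    by (intro exI[of _ ?w]) (auto simp: edge_iff)
  moreover have "minuscule \<Phi> I \<alpha> (?w mx)"
  proof -
    have "?w mx \<bullet> coroot \<beta> \<in> {0, 1, - 1}" if "\<beta> \<in> \<Phi>" for \<beta>
    proof (rule inner_coroot_mem_if_closed[OF S_closed _ that])
      fix i x assume i: "i \<in> I" and x: "x \<in> S"
      then obtain v where v: "v \<in> verts R" "x = ?w v" by (auto simp: S_def)
      then show "x \<bullet> coroot (\<alpha> i) \<in> {0, 1, - 1}"
        using m_range[OF i v(1)] wt_inner_coroot[OF i, of v] by auto
    qed (auto simp: S_def topV)
    moreover have "?w mx \<noteq> 0"
    proof
      assume "?w mx = 0"
      \<comment> \<open>Weight 0 at the top would make the whole orbit 0, against the coordinate -1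
        at the source of an edge.\<close>
      then have n: "norm (?w s) = 0" if "s \<in> verts R" for s
        using norm_weyl_orbit[of "?w s" \<Phi> "?w mx"] S_eq that by (auto simp: S_def)
      obtain s i t where e: "(s, i, t) \<in> edges R" using nonempty by auto
      then have "?w s \<bullet> coroot (\<alpha> i) = 0" using n edgeD by auto
      then show False using wt_inner_coroot[of i s] m_edge_out[OF e] edgeD[OF e] by simp
    qed
    ultimately show ?thesis by (simp add: minuscule_def wt_in_weights)
  qed
  moreover have "?w mx \<in> dominant_weights I \<alpha>"
    using m_maximal[OF mx] by (rule wt_in_dominant_weights)
  ultimately show ?thesis using mx ex1 by blast
qed

end

section \<open>The minuscule orbit satisfies the axioms\<close>

context weighted_poset
begin

text \<open>The isomorphism labels the vertices by orbit points. The point is that such a label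
  agrees with the weight \<open>wt\<close>, which is computed from positions in chains.\<close>

theorem minuscule_splitting_poset_only_if:
  assumes "minuscule \<Phi> I \<alpha> lam" and "R \<cong>\<^sub>c minuscule_splitting_poset \<Phi> I \<alpha> lam"
  shows "connected_digraph R" "fibrous I R" "structured I \<alpha> R" "edges R \<noteq> {}"
    and "\<forall>i\<in>I. \<forall>x\<in>verts R. len R i x \<le> 1"
    and "\<forall>i\<in>I. \<forall>j\<in>I. \<alpha> i \<bullet> coroot (\<alpha> j) = 0 \<and> \<alpha> j \<bullet> coroot (\<alpha> i) = 0 \<longrightarrow>
      (\<forall>x\<in>verts R. \<exists>!m. maximal_elem (component R {i, j} x) m)"
proof -
  let ?W = "weyl_orbit \<Phi> lam"
  obtain f where bij: "bij_betw f (verts R) ?W"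
    and iso: "\<And>s t i. s \<in> verts R \<Longrightarrow> t \<in> verts R \<Longrightarrow>
      (s, i, t) \<in> edges R \<longleftrightarrow> (f s, i, f t) \<in> edges (minuscule_splitting_poset \<Phi> I \<alpha> lam)"
    using assms(2) unfolding colored_iso_def by (auto simp: minuscule_splitting_poset_def)
  have fW: "f x \<in> ?W" if "x \<in> verts R" for x using bij that by (auto simp: bij_betw_def)
  have f_surj: "\<exists>x\<in>verts R. f x = y" if "y \<in> ?W" for y using bij that by (force simp: bij_betw_def)
  have f_inj: "x = y" if "f x = f y" "x \<in> verts R" "y \<in> verts R" for x y
    using bij that by (auto simp: bij_betw_def inj_on_def)
  have edge: "(s, i, t) \<in> edges R \<longleftrightarrow> s \<in> verts R \<and> t \<in> verts R \<and> i \<in> I \<and> f s + \<alpha> i = f t" for s i t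
    using iso[of s t i] edgeD[of s i t] fW by (auto simp: minuscule_splitting_poset_def)
  interpret fibrous_poset I R r
  proof
    show "t = u" if "(s, i, t) \<in> edges R" "(s, i, u) \<in> edges R" for s i t u
      using that f_inj[of t u] by (simp add: edge)
    show "t = u" if "(t, i, s) \<in> edges R" "(u, i, s) \<in> edges R" for s i t u
      using that f_inj[of t u] by (auto simp: edge) (metis add_right_cancel)
  qed
  have val: "f x \<bullet> coroot (\<alpha> i) \<in> {0, 1, - 1}" if "x \<in> verts R" "i \<in> I" for x i
    using assms(1) by (intro weyl_orbit_inner_coroot[OF fW[OF that(1)]])
      (auto simp: minuscule_def simple_root that)
  have edge_val: "f s \<bullet> coroot (\<alpha> i) = - 1" "f t \<bullet> coroot (\<alpha> i) = 1" if "(s, i, t) \<in> edges R" for s i t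
    using that weyl_orbit_add_root[of "f s" lam "\<alpha> i"] fW[of s] fW[of t] simple_root[of i]
    by (auto simp: edge)
  have out: "\<exists>t. (x, i, t) \<in> edges R" if x: "x \<in> verts R" and i: "i \<in> I" "f x \<bullet> coroot (\<alpha> i) = - 1" for x i
  proof -
    have "reflect (\<alpha> i) (f x) \<in> ?W" using fW[OF x] simple_root[OF i(1)] by (rule weyl_orbit_reflect)
    then obtain t where "t \<in> verts R" "f t = f x + \<alpha> i"
      using f_surj i by (auto simp: reflect_if_coroot_minus_1)
    then show ?thesis using x i by (auto simp: edge)
  qed
  have inn: "\<exists>s. (s, i, x) \<in> edges R" if x: "x \<in> verts R" and i: "i \<in> I" "f x \<bullet> coroot (\<alpha> i) = 1" for x i
  proof -
    have "reflect (\<alpha> i) (f x) \<in> ?W" using fW[OF x] simple_root[OF i(1)] by (rule weyl_orbit_reflect)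
    then obtain s where "s \<in> verts R" "f s = f x - \<alpha> i"
      using f_surj i by (auto simp: reflect_if_coroot_1)
    then show ?thesis using x i by (auto simp: edge)
  qed
  have rho: "rho R i x = (if f x \<bullet> coroot (\<alpha> i) = 1 then 1 else 0)" if xi: "x \<in> verts R" "i \<in> I" for x i
  proof (cases "f x \<bullet> coroot (\<alpha> i) = 1")
    case True
    then obtain s where s: "(s, i, x) \<in> edges R" using inn xi True by blast
    \<comment> \<open>The source of an edge has pairing -1 and a target has pairing 1, so no edge of
      the same color ends in \<open>s\<close>.\<close>
    have "rho R i s = 0" using edge_val(1)[OF s] edge_val(2) edgeD[OF s] by (intro rho_0) fastforce+
    then show ?thesis using rho_edge[OF s] True by simp
  next
    case False
    then show ?thesis using edge_val(2) xi by (auto intro: rho_0)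
  qed
  have delta: "delta R i x = (if f x \<bullet> coroot (\<alpha> i) = - 1 then 1 else 0)" if xi: "x \<in> verts R" "i \<in> I" for x i
  proof (cases "f x \<bullet> coroot (\<alpha> i) = - 1")
    case True
    then obtain t where t: "(x, i, t) \<in> edges R" using out xi True by blast
    have "delta R i t = 0" using edge_val(2)[OF t] edge_val(1) edgeD[OF t] by (intro delta_0) fastforce+
    then show ?thesis using delta_edge[OF t] True by simp
  next
    case False
    then show ?thesis using edge_val(1) xi by (auto intro: delta_0)
  qed
  have wt: "wt I \<alpha> R x = f x" if "x \<in> verts R" for x
  proof (rule wt_eqI)
    show "f x \<bullet> coroot (\<alpha> i) = of_int (m i x)" if "i \<in> I" for i
      using val[OF \<open>x \<in> verts R\<close> that] rho[OF \<open>x \<in> verts R\<close> that] delta[OF \<open>x \<in> verts R\<close> that]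
      by (auto simp: m_def)
  qed
  show "fibrous I R" by (rule fibrous)
  show "structured I \<alpha> R"
    by (auto simp: structured_def wt edge)
  show "\<forall>i\<in>I. \<forall>x\<in>verts R. len R i x \<le> 1"
    by (auto simp: len_eq_rho_delta rho delta)
  show "edges R \<noteq> {}"
  proof -
    \<comment> \<open>A nonzero vector pairs nontrivially with some simple coroot, and the value 1
      or -1 there produces an edge.\<close>
    obtain i where i: "i \<in> I" "lam \<bullet> coroot (\<alpha> i) \<noteq> 0"
      using eq_if_inner_coroots[of lam 0] assms(1) by (auto simp: minuscule_def)
    obtain x where x: "x \<in> verts R" "f x = lam" using f_surj[OF weyl_orbit_self] by blast
    then have "f x \<bullet> coroot (\<alpha> i) = 1 \<or> f x \<bullet> coroot (\<alpha> i) = - 1" using val[OF x(1) i(1)] i(2) by simp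
    then show ?thesis using out[OF x(1) i(1)] inn[OF x(1) i(1)] by blast
  qed
  show "connected_digraph R"
  proof -
    obtain x0 where x0: "x0 \<in> verts R" "f x0 = lam" using f_surj[OF weyl_orbit_self] by blast
    \<comment> \<open>The labels reachable from the vertex of \<open>lam\<close> are closed under
      simple reflections, each of which is trivial or travels along one edge; hence they fill the
      orbit.\<close>
    define S where "S = f ` {x \<in> verts R. (x0, x) \<in> conn I}"
    have "?W \<subseteq> S"
    proof (rule weyl_orbit_subset)
      show "lam \<in> S" using x0 conn_refl by (auto simp: S_def)
      fix i y assume i: "i \<in> I" and "y \<in> S"
      then obtain x where x: "x \<in> verts R" "(x0, x) \<in> conn I" "y = f x" by (auto simp: S_def)
      consider "f x \<bullet> coroot (\<alpha> i) = 0" | "f x \<bullet> coroot (\<alpha> i) = 1" | "f x \<bullet> coroot (\<alpha> i) = - 1"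
        using val[OF x(1) i] by auto
      then show "reflect (\<alpha> i) y \<in> S"
      proof cases
        case 1
        then show ?thesis using x \<open>y \<in> S\<close> by (simp add: reflect_if_coroot_0)
      next
        case 2
        then obtain s where s: "(s, i, x) \<in> edges R" using inn x(1) i by blast
        then have "(x0, s) \<in> conn I"
          using conn_trans[OF x(2) conn_sym[OF step_conn[OF stepI[OF s i]]]] by simp
        moreover have "reflect (\<alpha> i) y = f s" using 2 s x by (auto simp: edge reflect_if_coroot_1 algebra_simps)
        ultimately show ?thesis using edgeD[OF s] by (auto simp: S_def)
      next
        case 3
        then obtain t where t: "(x, i, t) \<in> edges R" using out x(1) i by blast
        then have "(x0, t) \<in> conn I"
          using conn_trans[OF x(2) step_conn[OF stepI[OF t i]]] by simp
        moreover have "reflect (\<alpha> i) y = f t" using 3 t x by (simp add: edge reflect_if_coroot_minus_1)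
        ultimately show ?thesis using edgeD[OF t] by (auto simp: S_def)
      qed
    qed
    then have "(x0, y) \<in> conn I" if "y \<in> verts R" for y
      using fW[OF that] f_inj[OF _ that] that unfolding S_def by blast
    then show ?thesis unfolding connected_iff using conn_trans conn_sym by blast
  qed
  have peak: "\<exists>v. (t, v) \<in> (step {i, j})\<^sup>* \<and> (u, v) \<in> (step {i, j})\<^sup>*"
    if o: "\<alpha> i \<bullet> coroot (\<alpha> j) = 0" "\<alpha> j \<bullet> coroot (\<alpha> i) = 0"
      and st: "(s, i, t) \<in> edges R" and su: "(s, j, u) \<in> edges R" for s i j t u
  proof -
    have tv: "f t = f s + \<alpha> i" "f u = f s + \<alpha> j" "t \<in> verts R" "u \<in> verts R" "i \<in> I" "j \<in> I"
      using st su by (auto simp: edge)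
    \<comment> \<open>Orthogonality leaves the other pairing at -1, so both sides continue to the
      label \<open>f s + \<alpha> i + \<alpha> j\<close> and close a square.\<close>
    have "f t \<bullet> coroot (\<alpha> j) = - 1" "f u \<bullet> coroot (\<alpha> i) = - 1"
      using edge_val(1)[OF st] edge_val(1)[OF su] o by (simp_all add: tv inner_add_left)
    then obtain v w where v: "(t, j, v) \<in> edges R" and w: "(u, i, w) \<in> edges R"
      using out tv by metis
    have "v = w"
    proof (rule f_inj)
      show "f v = f w" using v w tv by (simp add: edge) (metis add.commute add.left_commute)
    qed (use edgeD v w in auto)
    then have "(t, v) \<in> step {i, j}" "(u, v) \<in> step {i, j}" using v w by (auto intro: stepI)
    then show ?thesis by blast
  qed
  show "\<forall>i\<in>I. \<forall>j\<in>I. \<alpha> i \<bullet> coroot (\<alpha> j) = 0 \<and> \<alpha> j \<bullet> coroot (\<alpha> i) = 0 \<longrightarrow>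
      (\<forall>x\<in>verts R. \<exists>!m. maximal_elem (component R {i, j} x) m)"
  proof (intro ballI impI)
    fix i j x assume ij: "i \<in> I" "j \<in> I" and o: "\<alpha> i \<bullet> coroot (\<alpha> j) = 0 \<and> \<alpha> j \<bullet> coroot (\<alpha> i) = 0"
      and x: "x \<in> verts R"
    show "\<exists>!m. maximal_elem (component R {i, j} x) m"
    proof (rule unique_maximal_component[OF x])
      fix s t u assume "(s, t) \<in> step {i, j}" "(s, u) \<in> step {i, j}"
      then consider "t = u" | "(s, i, t) \<in> edges R" "(s, j, u) \<in> edges R"
        | "(s, j, t) \<in> edges R" "(s, i, u) \<in> edges R"
        using unique_out by (auto simp: step_def)
      then show "\<exists>v. (t, v) \<in> (step {i, j})\<^sup>* \<and> (u, v) \<in> (step {i, j})\<^sup>*"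
      proof cases
        case 2 then show ?thesis using peak o by blast
      next
        case 3 then show ?thesis using peak[of i j s u t] o by blast
      qed blast
    qed
  qed
qed

end

section \<open>Quasi-minuscule splitting posets\<close>

lemma edges_quasi_minuscule_splitting_poset:
  "(a, i, b) \<in> edges (quasi_minuscule_splitting_poset \<Phi> I \<alpha> lam) \<longleftrightarrow> i \<in> I \<and>
    ((\<exists>\<mu>. a = Inl \<mu> \<and> b = Inl (\<mu> + \<alpha> i) \<and> \<mu> \<in> weyl_orbit \<Phi> lam \<and> \<mu> + \<alpha> i \<in> weyl_orbit \<Phi> lam) \<or>
     a = Inl (- \<alpha> i) \<and> b = Inr i \<and> short_root \<Phi> (\<alpha> i) \<or>
     a = Inr i \<and> b = Inl (\<alpha> i) \<and> short_root \<Phi> (\<alpha> i))"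
  by (auto simp: quasi_minuscule_splitting_poset_def)

section \<open>From the axioms to the short roots: chains of length two and weight zero\<close>

locale quasi_minuscule_like_poset = structured_poset \<Phi> I \<alpha> R r
  for \<Phi> :: "'a::euclidean_space set" and I :: "'i set" and \<alpha> :: "'i \<Rightarrow> 'a"
    and R :: "('v, 'i) colored_digraph" and r :: "'v \<Rightarrow> nat" +
  assumes irreducible: "irreducible_root_system \<Phi>"
    and ex_long: "\<exists>i\<in>I. \<exists>x\<in>verts R. len R i x \<ge> 2"
    and long_component: "i \<in> I \<Longrightarrow> x \<in> verts R \<Longrightarrow> len R i x \<ge> 2 \<Longrightarrow>
      \<exists>x\<^sub>0 x\<^sub>1 x\<^sub>2. color_comp R i x = \<lparr>verts = {x\<^sub>0, x\<^sub>1, x\<^sub>2}, edges = {(x\<^sub>0, i, x\<^sub>1), (x\<^sub>1, i, x\<^sub>2)}\<rparr> \<and>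
        (\<forall>j\<in>I. j \<noteq> i \<longrightarrow>
           delta R j x\<^sub>0 = 0 \<and> rho R j x\<^sub>2 = 0 \<and> verts (color_comp R j x\<^sub>1) = {x\<^sub>1})"
    and diamond: "i \<in> I \<Longrightarrow> j \<in> I \<Longrightarrow> \<alpha> i \<bullet> coroot (\<alpha> j) = 0 \<Longrightarrow> \<alpha> j \<bullet> coroot (\<alpha> i) = 0 \<Longrightarrow>
      x \<in> verts R \<Longrightarrow> \<exists>!m. maximal_elem (component R {i, j} x) m"
    and hexagon: "i \<in> I \<Longrightarrow> j \<in> I \<Longrightarrow> \<alpha> i \<bullet> coroot (\<alpha> j) = - 1 \<Longrightarrow> \<alpha> j \<bullet> coroot (\<alpha> i) = - 1 \<Longrightarrow>
      x \<in> verts R \<Longrightarrow> \<exists>!m. maximal_elem (component R {i, j} x) m"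
begin

abbreviation w :: "'v \<Rightarrow> 'a" where "w \<equiv> wt I \<alpha> R"

text \<open>The equation for the component, read as facts about edges: nothing of color
  \<open>i\<close> enters its bottom or leaves its top, and a component of one point means that no
  edge of that other color touches the middle.\<close>

lemma long_component_cases:
  assumes "i \<in> I" "x \<in> verts R" "rho R i x + delta R i x \<ge> 2"
  obtains x\<^sub>0 x\<^sub>1 x\<^sub>2 where "(x\<^sub>0, i, x\<^sub>1) \<in> edges R" "(x\<^sub>1, i, x\<^sub>2) \<in> edges R" "x \<in> {x\<^sub>0, x\<^sub>1, x\<^sub>2}"
    "rho R i x\<^sub>0 = 0" "delta R i x\<^sub>2 = 0"
    "\<And>j. j \<in> I \<Longrightarrow> j \<noteq> i \<Longrightarrow> delta R j x\<^sub>0 = 0"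
    "\<And>j. j \<in> I \<Longrightarrow> j \<noteq> i \<Longrightarrow> rho R j x\<^sub>1 = 0 \<and> delta R j x\<^sub>1 = 0"
proof -
  obtain x\<^sub>0 x\<^sub>1 x\<^sub>2 where C: "color_comp R i x =
      \<lparr>verts = {x\<^sub>0, x\<^sub>1, x\<^sub>2}, edges = {(x\<^sub>0, i, x\<^sub>1), (x\<^sub>1, i, x\<^sub>2)}\<rparr>"
    and 0: "\<And>j. j \<in> I \<Longrightarrow> j \<noteq> i \<Longrightarrow> delta R j x\<^sub>0 = 0"
    and 1: "\<And>j. j \<in> I \<Longrightarrow> j \<noteq> i \<Longrightarrow> verts (color_comp R j x\<^sub>1) = {x\<^sub>1}"
    using long_component[OF assms(1,2)] assms(3) len_eq_rho_delta[OF assms(2)] by auto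
  have E: "(s, i, t) \<in> edges R \<and> s \<in> {x\<^sub>0, x\<^sub>1, x\<^sub>2} \<longleftrightarrow> (s, i, t) \<in> {(x\<^sub>0, i, x\<^sub>1), (x\<^sub>1, i, x\<^sub>2)}" for s t
  proof -
    have "(s, i, t) \<in> edges (color_comp R i x) \<longleftrightarrow>
        (s, i, t) \<in> edges R \<and> s \<in> verts (color_comp R i x)"
      by (subst edges_component) simp
    then show ?thesis unfolding C by simp
  qed
  from E have e: "(x\<^sub>0, i, x\<^sub>1) \<in> edges R" "(x\<^sub>1, i, x\<^sub>2) \<in> edges R" by blast+
  have V: "x\<^sub>0 \<in> verts R" "x\<^sub>1 \<in> verts R" "x\<^sub>2 \<in> verts R" using e edgeD by blast+
  have rk: "r x\<^sub>1 = Suc (r x\<^sub>0)" "r x\<^sub>2 = Suc (r x\<^sub>1)" using e rank_edge by blast+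
  have "(s, i, x\<^sub>0) \<notin> edges R" for s
  proof
    assume s: "(s, i, x\<^sub>0) \<in> edges R"
    have "s \<in> verts (color_comp R i x)"
      using component_step[OF stepI[OF s singletonI], of x] by (simp add: C)
    then show False using E[of s x\<^sub>0] s rk by (auto simp: C)
  qed
  then have 2: "rho R i x\<^sub>0 = 0" using V by (simp add: rho_0)
  have "(x\<^sub>2, i, t) \<notin> edges R" for t using E[of x\<^sub>2 t] rk by auto
  then have 3: "delta R i x\<^sub>2 = 0" using V by (simp add: delta_0)
  have 4: "rho R j x\<^sub>1 = 0 \<and> delta R j x\<^sub>1 = 0" if j: "j \<in> I" "j \<noteq> i" for j
  proof -
    have "(s, j, x\<^sub>1) \<notin> edges R" for s
    proof
      assume s: "(s, j, x\<^sub>1) \<in> edges R"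
      have "s = x\<^sub>1" using component_step[OF stepI[OF s singletonI], of x\<^sub>1] 1[OF j] by simp
      then show False using rank_edge[OF s] by simp
    qed
    moreover have "(x\<^sub>1, j, t) \<notin> edges R" for t
    proof
      assume t: "(x\<^sub>1, j, t) \<in> edges R"
      have "t = x\<^sub>1" using component_step[OF stepI[OF t singletonI], of x\<^sub>1] 1[OF j] by simp
      then show False using rank_edge[OF t] by simp
    qed
    ultimately show ?thesis using V by (simp add: rho_0 delta_0)
  qed
  have "x \<in> {x\<^sub>0, x\<^sub>1, x\<^sub>2}"
    using self_in_component[OF assms(2), of "{i}"] by (simp add: C)
  then show thesis using that e 2 3 0 4 by blast
qed

lemma rho_delta_le_2:
  assumes "i \<in> I" "x \<in> verts R"
  shows "rho R i x + delta R i x \<le> 2"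
proof (rule ccontr)
  assume *: "\<not> ?thesis"
  then have "rho R i x + delta R i x \<ge> 2" by simp
  with assms obtain x\<^sub>0 x\<^sub>1 x\<^sub>2 where e: "(x\<^sub>0, i, x\<^sub>1) \<in> edges R" "(x\<^sub>1, i, x\<^sub>2) \<in> edges R" "x \<in> {x\<^sub>0, x\<^sub>1, x\<^sub>2}"
    "rho R i x\<^sub>0 = 0" "delta R i x\<^sub>2 = 0" by (rule long_component_cases)
  show False using * e rho_edge[OF e(1)] rho_edge[OF e(2)] delta_edge[OF e(1)] delta_edge[OF e(2)] by auto
qed

text \<open>An interior vertex of a chain must be the middle of a chain of length two. Its
  coordinate \<open>i\<close> is 1 - 1, and all the others vanish by the axiom on such
  middles.\<close>

lemma middle:
  assumes "i \<in> I" "x \<in> verts R" "rho R i x > 0" "delta R i x > 0"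
  shows "rho R i x = 1" "delta R i x = 1" "\<And>j. j \<in> I \<Longrightarrow> j \<noteq> i \<Longrightarrow> rho R j x = 0 \<and> delta R j x = 0"
    "w x = 0"
proof -
  show 1: "rho R i x = 1" "delta R i x = 1" using rho_delta_le_2[OF assms(1,2)] assms(3,4) by auto
  then have "rho R i x + delta R i x \<ge> 2" by simp
  with assms(1,2) obtain x\<^sub>0 x\<^sub>1 x\<^sub>2 where e: "(x\<^sub>0, i, x\<^sub>1) \<in> edges R" "(x\<^sub>1, i, x\<^sub>2) \<in> edges R" "x \<in> {x\<^sub>0, x\<^sub>1, x\<^sub>2}"
    "rho R i x\<^sub>0 = 0" "delta R i x\<^sub>2 = 0"
    "\<And>j. j \<in> I \<Longrightarrow> j \<noteq> i \<Longrightarrow> rho R j x\<^sub>1 = 0 \<and> delta R j x\<^sub>1 = 0"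
    by (rule long_component_cases) blast
  have "x = x\<^sub>1" using e(3-5) assms(3,4) by auto
  then show 2: "rho R j x = 0 \<and> delta R j x = 0" if "j \<in> I" "j \<noteq> i" for j using e(6)[OF that] by simp
  show "w x = 0"
  proof (rule wt_eqI)
    fix j assume "j \<in> I"
    then show "0 \<bullet> coroot (\<alpha> j) = of_int (m j x)" using 1 2[of j] by (cases "j = i") (auto simp: m_def)
  qed
qed

lemma delta_2:
  assumes "i \<in> I" "x \<in> verts R" "delta R i x = 2" "j \<in> I" "j \<noteq> i"
  shows "delta R j x = 0"
proof -
  have "rho R i x + delta R i x \<ge> 2" using assms by simp
  with assms(1,2) obtain x\<^sub>0 x\<^sub>1 x\<^sub>2 where e: "(x\<^sub>0, i, x\<^sub>1) \<in> edges R" "(x\<^sub>1, i, x\<^sub>2) \<in> edges R" "x \<in> {x\<^sub>0, x\<^sub>1, x\<^sub>2}"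
    "delta R i x\<^sub>2 = 0" "\<And>j. j \<in> I \<Longrightarrow> j \<noteq> i \<Longrightarrow> delta R j x\<^sub>0 = 0"
    by (rule long_component_cases) blast
  have "x = x\<^sub>0" using e(3,4) assms(3) delta_edge[OF e(2)] by auto
  then show ?thesis using e(5)[OF assms(4,5)] by simp
qed

lemma m_range: "i \<in> I \<Longrightarrow> x \<in> verts R \<Longrightarrow> m i x \<in> {0, 1, - 1, 2, - 2}"
  using rho_delta_le_2[of i x] unfolding m_def by auto

text \<open>Away from weight zero no vertex is interior to a chain, so one of \<open>rho\<close> and
  \<open>delta\<close> vanishes and both are recovered from their difference.\<close>

lemma rho_delta_nonzero_weight:
  assumes "i \<in> I" "x \<in> verts R" "w x \<noteq> 0"
  shows "int (rho R i x) = max 0 (m i x)" "int (delta R i x) = max 0 (- m i x)"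
  using middle(4)[OF assms(1,2)] assms(3) unfolding m_def by fastforce+

lemma unique_maximal_elem: "\<exists>!m. maximal_elem R m"
proof (rule unique_maximal_if_peaks)
  show "verts R \<noteq> {}" using ex_long by auto
  fix s i t j u assume st: "(s, i, t) \<in> edges R" and su: "(s, j, u) \<in> edges R" and ij: "i \<noteq> j"
  have I: "i \<in> I" "j \<in> I" "s \<in> verts R" "t \<in> verts R" "u \<in> verts R" using edgeD st su by auto
  have d: "delta R i s > 0" "delta R j s > 0" using delta_edge[OF st] delta_edge[OF su] by auto
  \<comment> \<open>A positive value would make \<open>s\<close> interior to its chain of color
    \<open>i\<close>, and such a vertex has no edge of color \<open>j\<close>.\<close>
  have "rho R i s = 0" using middle(3)[OF I(1,3) _ d(1) I(2)] ij d by auto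
  moreover have "rho R j s = 0" using middle(3)[OF I(2,3) _ d(2) I(1)] ij d by auto
  \<comment> \<open>The value 2 would make \<open>s\<close> the bottom of a chain of length two,
    from which no edge of another color leaves.\<close>
  moreover have "delta R i s = 1"
    using delta_2[OF I(1,3) _ I(2)] rho_delta_le_2[OF I(1,3)] ij d by fastforce
  moreover have "delta R j s = 1"
    using delta_2[OF I(2,3) _ I(1)] rho_delta_le_2[OF I(2,3)] ij d by fastforce
  ultimately have "m i s = - 1" "m j s = - 1" by (auto simp: m_def)
  \<comment> \<open>Starting from -1, one edge of the other color must not lead below -2.\<close>
  then have "cartan i j \<ge> - 1" "cartan j i \<ge> - 1"
    using m_edge[OF st I(2)] m_edge[OF su I(1)] m_range[OF I(2,4)] m_range[OF I(1,5)] by auto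
  then have "cartan i j \<in> {0, - 1}" "cartan j i \<in> {0, - 1}"
    using cartan_nonpos[OF I(1,2)] cartan_nonpos[OF I(2,1)] ij by force+
  \<comment> \<open>Vanishing of Cartan integers is symmetric, which excludes the mixed
    pairs.\<close>
  then consider "cartan i j = 0" "cartan j i = 0" | "cartan i j = - 1" "cartan j i = - 1"
    using cartan_eq_0_sym[OF I(1,2)] cartan_eq_0_sym[OF I(2,1)] by auto
  then show "\<exists>!m. maximal_elem (component R {i, j} s) m"
  proof cases
    case 1 then show ?thesis using I inner_coroot_cartan by (intro diamond) auto
  next
    case 2 then show ?thesis using I inner_coroot_cartan by (intro hexagon) auto
  qed
qed

lemma zero_weight_m: "i \<in> I \<Longrightarrow> w x = 0 \<Longrightarrow> m i x = 0"
  using wt_inner_coroot[of i x] by simp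

lemma wt_edge_ne: "(s, i, t) \<in> edges R \<Longrightarrow> w s = 0 \<Longrightarrow> w t = 0 \<Longrightarrow> False"
  using wt_edge[of s i t] edgeD[of s i t] simple_nonzero by simp

text \<open>At a maximal vertex of weight zero \<open>rho\<close> equals \<open>delta\<close>, which
  is 0. Such a vertex would be isolated, hence the only one, leaving no room for a chain of length
  two.\<close>

lemma maximal_nonzero_weight:
  assumes "maximal_elem R x"
  shows "w x \<noteq> 0"
proof
  assume 0: "w x = 0"
  have "(s, i, x) \<notin> edges R" for s i
  proof
    assume s: "(s, i, x) \<in> edges R"
    have "delta R i x = 0" using assms by (simp add: maximal_iff delta_0)
    then show False using zero_weight_m[of i x] rho_edge[OF s] edgeD[OF s] 0 by (simp add: m_def)
  qed
  then have "y = x" if "y \<in> verts R" for y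
    using steps_to_maximal[OF unique_maximal_elem assms that] by (auto simp: step_def elim: rtranclE)
  moreover obtain i y where i: "i \<in> I" "y \<in> verts R" "rho R i y + delta R i y \<ge> 2"
    using ex_long len_eq_rho_delta by force
  moreover from i obtain s t where "(s, i, t) \<in> edges R" by (rule long_component_cases)
  ultimately show False using edgeD rank_edge by (metis n_not_Suc_n)
qed

lemma ex_out: "i \<in> I \<Longrightarrow> x \<in> verts R \<Longrightarrow> delta R i x > 0 \<Longrightarrow> \<exists>t. (x, i, t) \<in> edges R"
  using delta_pos_edge by blast

lemma ex_in: "i \<in> I \<Longrightarrow> x \<in> verts R \<Longrightarrow> rho R i x > 0 \<Longrightarrow> \<exists>s. (s, i, x) \<in> edges R"
  using rho_pos_edge by blast

lemma m_minus_1_edge: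
  assumes "i \<in> I" "x \<in> verts R" "m i x = - 1"
  obtains t where "(x, i, t) \<in> edges R" "w t = w x + \<alpha> i" "w t \<noteq> 0"
proof -
  have "w x \<noteq> 0" using zero_weight_m[OF assms(1)] assms(3) by force
  from rho_delta_nonzero_weight(2)[OF assms(1,2) this] assms(3) have "delta R i x > 0" by simp
  then obtain t where t: "(x, i, t) \<in> edges R" using ex_out assms by blast
  have "m i t = 1" using m_edge[OF t assms(1)] cartan_self[OF assms(1)] assms(3) by simp
  then have "w t \<noteq> 0" using zero_weight_m[OF assms(1)] by force
  with t show ?thesis using that wt_edge by blast
qed

lemma m_1_edge:
  assumes "i \<in> I" "x \<in> verts R" "m i x = 1"
  obtains s where "(s, i, x) \<in> edges R" "w x = w s + \<alpha> i" "w s \<noteq> 0"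
proof -
  have "w x \<noteq> 0" using zero_weight_m[OF assms(1)] assms(3) by force
  from rho_delta_nonzero_weight(1)[OF assms(1,2) this] assms(3) have "rho R i x > 0" by simp
  then obtain s where s: "(s, i, x) \<in> edges R" using ex_in assms by blast
  have "m i s = - 1" using m_edge[OF s assms(1)] cartan_self[OF assms(1)] assms(3) by simp
  then have "w s \<noteq> 0" using zero_weight_m[OF assms(1)] by force
  with s show ?thesis using that wt_edge by blast
qed

text \<open>The value -2 forces the bottom of a chain of length two. Its middle has weight zero, and
  this pins the weights of both ends.\<close>

lemma m_minus_2_edges:
  assumes "i \<in> I" "x \<in> verts R" "m i x = - 2"
  obtains y z where "(x, i, y) \<in> edges R" "(y, i, z) \<in> edges R" "w x = - \<alpha> i" "w y = 0" "w z = \<alpha> i"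
proof -
  have "w x \<noteq> 0" using zero_weight_m[OF assms(1)] assms(3) by force
  from rho_delta_nonzero_weight[OF assms(1,2) this] assms(3) have x: "rho R i x = 0" "delta R i x = 2"
    by simp_all
  then obtain y where y: "(x, i, y) \<in> edges R" using ex_out assms by force
  have yV: "y \<in> verts R" using edgeD[OF y] by simp
  have y1: "rho R i y > 0" "delta R i y > 0" using rho_edge[OF y] delta_edge[OF y] x by simp_all
  then obtain z where z: "(y, i, z) \<in> edges R" using ex_out assms yV by blast
  have "w y = 0" using middle(4)[OF assms(1) yV y1] .
  with that[OF y z] show ?thesis using wt_edge[OF y] wt_edge[OF z] by (simp add: eq_neg_iff_add_eq_0)
qed

lemma m_2_edges:
  assumes "i \<in> I" "x \<in> verts R" "m i x = 2"
  obtains y s where "(s, i, y) \<in> edges R" "(y, i, x) \<in> edges R" "w s = - \<alpha> i" "w y = 0" "w x = \<alpha> i"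
    "rho R i y = 1" "delta R i y = 1"
proof -
  have "w x \<noteq> 0" using zero_weight_m[OF assms(1)] assms(3) by force
  from rho_delta_nonzero_weight[OF assms(1,2) this] assms(3) have x: "rho R i x = 2" "delta R i x = 0"
    by simp_all
  then obtain y where y: "(y, i, x) \<in> edges R" using ex_in assms by force
  have yV: "y \<in> verts R" using edgeD[OF y] by simp
  have y1: "rho R i y > 0" "delta R i y > 0" using rho_edge[OF y] delta_edge[OF y] x by simp_all
  then obtain s where s: "(s, i, y) \<in> edges R" using ex_in assms yV by blast
  have "w y = 0" using middle(4)[OF assms(1) yV y1] .
  with that[OF s y] show ?thesis
    using wt_edge[OF y] wt_edge[OF s] middle(1,2)[OF assms(1) yV y1] by (simp add: eq_neg_iff_add_eq_0)
qed

lemma nonzero_weight_edge_out: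
  assumes "(x, i, t) \<in> edges R" "w x \<noteq> 0"
  shows "m i x = - 1 \<or> m i x = - 2"
  using rho_delta_nonzero_weight(2)[of i x] delta_edge[OF assms(1)] edgeD[OF assms(1)] assms(2)
    m_range[of i x] by auto

text \<open>A simple reflection raising a nonzero weight is realised by one edge, or by two edges through a
  vertex of weight zero.  The last property turns equality of weights into equality of vertices by
  induction from the top.\<close>

lemma nonzero_weight_ascend:
  assumes "x \<in> verts R" "i \<in> I" "m i x < 0"
  obtains z where "z \<in> verts R" "w z \<noteq> 0" "r x < r z" "w z = reflect (\<alpha> i) (w x)"
    "\<And>y. y \<in> verts R \<Longrightarrow> w y = w x \<Longrightarrow> \<exists>z'\<in>verts R. w z' = w z \<and> (z' = z \<longrightarrow> y = x)"
proof -
  have m_eq: "m i y = m i x" if "w y = w x" for y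
    using wt_inner_coroot[OF assms(2), of x] wt_inner_coroot[OF assms(2), of y] that by simp
  consider "m i x = - 1" | "m i x = - 2" using m_range[OF assms(2,1)] assms(3) by auto
  then show thesis
  proof cases
    case 1
    then obtain t where t: "(x, i, t) \<in> edges R" "w t = w x + \<alpha> i" "w t \<noteq> 0"
      using m_minus_1_edge assms by metis
    show thesis
    proof (rule that[of t])
      show "t \<in> verts R" "r x < r t" using edgeD[OF t(1)] rank_edge[OF t(1)] by simp_all
      show "w t = reflect (\<alpha> i) (w x)"
        using t(2) 1 wt_inner_coroot[OF assms(2), of x] by (simp add: reflect_if_coroot_minus_1)
      fix y assume y: "y \<in> verts R" "w y = w x"
      then obtain z' where z': "(y, i, z') \<in> edges R" "w z' = w y + \<alpha> i"
        using m_minus_1_edge[OF assms(2) y(1)] m_eq[OF y(2)] 1 by metis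
      then show "\<exists>z'\<in>verts R. w z' = w t \<and> (z' = t \<longrightarrow> y = x)"
        using edgeD[OF z'(1)] t y unique_in by (intro bexI[of _ z']) auto
    qed (rule t(3))
  next
    case 2
    then obtain t z where t: "(x, i, t) \<in> edges R" "(t, i, z) \<in> edges R" "w x = - \<alpha> i" "w z = \<alpha> i"
      using m_minus_2_edges[OF assms(2,1)] by metis
    show thesis
    proof (rule that[of z])
      show "z \<in> verts R" "r x < r z" using edgeD[OF t(2)] rank_edge[OF t(1)] rank_edge[OF t(2)] by simp_all
      show "w z \<noteq> 0" using t simple_nonzero assms by simp
      show "w z = reflect (\<alpha> i) (w x)"
        using t simple_nonzero[OF assms(2)] by (simp add: reflect_minus reflect_self)
      fix y assume y: "y \<in> verts R" "w y = w x"
      then obtain t' z' where z': "(y, i, t') \<in> edges R" "(t', i, z') \<in> edges R" "w z' = \<alpha> i"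
        using m_minus_2_edges[OF assms(2) y(1)] m_eq[OF y(2)] 2 by metis
      then have "z' = z \<longrightarrow> y = x" using t(1,2) unique_in by metis
      then show "\<exists>z'\<in>verts R. w z' = w z \<and> (z' = z \<longrightarrow> y = x)"
        using edgeD[OF z'(2)] t z' by (intro bexI[of _ z']) auto
    qed
  qed
qed

text \<open>Downward induction by rank rather than along edges: the ascent from a nonzero weight may
  skip a vertex of weight zero and so climb two ranks.\<close>

lemma rank_induct [case_names greater]:
  assumes "\<And>x. (\<And>z. z \<in> verts R \<Longrightarrow> r x < r z \<Longrightarrow> P z) \<Longrightarrow> P x"
  shows "P x"
proof (induction x rule: measure_induct_rule[where f = "\<lambda>x. Max (r ` verts R) - r x"])
  case (less x)
  show ?case
  proof (rule assms)
    fix z assume z: "z \<in> verts R" "r x < r z"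
    then have "r z \<le> Max (r ` verts R)" using finite_verts by simp
    then show "P z" using z by (intro less) simp
  qed
qed

lemma nonzero_weight_maximal:
  assumes "x \<in> verts R" "w x \<noteq> 0" "\<And>i. i \<in> I \<Longrightarrow> m i x \<ge> 0"
  shows "maximal_elem R x"
  unfolding maximal_iff using assms nonzero_weight_edge_out edgeD by fastforce

text \<open>A common negative coordinate raises both vertices to equal nonzero weights, where the
  induction hypothesis applies; without one, both are maximal.\<close>

lemma wt_inj:
  assumes "x \<in> verts R" "w x \<noteq> 0" "y \<in> verts R" "w y = w x"
  shows "y = x"
  using assms
proof (induction x arbitrary: y rule: rank_induct)
  case (greater x)
  have m_eq: "m i y = m i x" if "i \<in> I" for i
    using wt_inner_coroot[OF that, of x] wt_inner_coroot[OF that, of y] greater.prems by simp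
  show ?case
  proof (cases "\<exists>i\<in>I. m i x < 0")
    case True
    then obtain i where "i \<in> I" "m i x < 0" by blast
    with greater.prems(1) obtain z where z: "z \<in> verts R" "w z \<noteq> 0" "r x < r z"
      "w z = reflect (\<alpha> i) (w x)"
      "\<And>y. y \<in> verts R \<Longrightarrow> w y = w x \<Longrightarrow> \<exists>z'\<in>verts R. w z' = w z \<and> (z' = z \<longrightarrow> y = x)"
      by (rule nonzero_weight_ascend) blast
    from z(5)[OF greater.prems(3,4)] show ?thesis using greater.IH[OF z(1,3,1,2)] by blast
  next
    case False
    then have "maximal_elem R x" "maximal_elem R y"
      using greater.prems m_eq by (auto intro!: nonzero_weight_maximal simp: not_less)
    then show ?thesis using unique_maximal_elem by blast
  qed
qed

definition S :: "'a set" where "S = {w x | x. x \<in> verts R \<and> w x \<noteq> 0}"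

text \<open>The reflection is followed along the chain of color \<open>i\<close>: it fixes the
  weight, takes one edge, or runs between the two ends of a chain of length two. It never stops at
  weight zero.\<close>

lemma S_closed:
  assumes "i \<in> I" "y \<in> S"
  shows "reflect (\<alpha> i) y \<in> S"
proof -
  obtain x where x: "x \<in> verts R" "w x \<noteq> 0" "y = w x" using assms(2) by (auto simp: S_def)
  have "\<exists>s\<in>verts R. w s \<noteq> 0 \<and> w s = reflect (\<alpha> i) (w x)"
  proof -
    consider "m i x < 0" | "m i x = 0" | "m i x = 1" | "m i x = 2"
      using m_range[OF assms(1) x(1)] by auto
    then show ?thesis
    proof cases
      case 1
      with x(1) assms(1) show ?thesis by (rule nonzero_weight_ascend) blast
    next
      case 2
      then show ?thesis using x wt_inner_coroot[OF assms(1), of x] by (auto simp: reflect_if_coroot_0)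
    next
      case 3
      then obtain s where s: "(s, i, x) \<in> edges R" "w x = w s + \<alpha> i" "w s \<noteq> 0"
        using m_1_edge[OF assms(1) x(1)] by blast
      then have "w s = reflect (\<alpha> i) (w x)"
        using 3 wt_inner_coroot[OF assms(1), of x] by (simp add: reflect_if_coroot_1)
      then show ?thesis using s edgeD[OF s(1)] by blast
    next
      case 4
      then obtain s t where s: "(s, i, t) \<in> edges R" "w s = - \<alpha> i" "w x = \<alpha> i"
        using m_2_edges[OF assms(1) x(1)] by metis
      then show ?thesis
        using edgeD[OF s(1)] simple_nonzero[OF assms(1)] by (intro bexI[of _ s]) (auto simp: reflect_self)
    qed
  qed
  then obtain s where s: "s \<in> verts R" "w s \<noteq> 0" "w s = reflect (\<alpha> i) y" using x by blast
  have "w s \<in> S" unfolding S_def using s(1,2) by blast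
  with s(3) show ?thesis by simp
qed

lemma wt_in_orbit:
  assumes mx: "maximal_elem R mx" and "x \<in> verts R" "w x \<noteq> 0"
  shows "w x \<in> weyl_orbit \<Phi> (w mx)"
  using assms(2,3)
proof (induction x rule: rank_induct)
  case (greater x)
  show ?case
  proof (cases "\<exists>i\<in>I. m i x < 0")
    case True
    then obtain i where i: "i \<in> I" "m i x < 0" by blast
    with greater.prems(1) obtain z where z: "z \<in> verts R" "w z \<noteq> 0" "r x < r z" "w z = reflect (\<alpha> i) (w x)"
      by (rule nonzero_weight_ascend) blast
    have "w z \<in> weyl_orbit \<Phi> (w mx)" using greater.IH[OF z(1,3,1,2)] .
    then have "reflect (\<alpha> i) (w z) \<in> weyl_orbit \<Phi> (w mx)"
      using simple_root[OF i(1)] by (rule weyl_orbit_reflect)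
    then show ?thesis using z by simp
  next
    case False
    then have "maximal_elem R x"
      using greater.prems by (auto intro!: nonzero_weight_maximal simp: not_less)
    then have "x = mx" using mx unique_maximal_elem by blast
    then show ?thesis by (simp add: weyl_orbit_self)
  qed
qed

lemma S_eq_orbit:
  assumes mx: "maximal_elem R mx"
  shows "S = weyl_orbit \<Phi> (w mx)"
proof
  show "S \<subseteq> weyl_orbit \<Phi> (w mx)" using wt_in_orbit[OF mx] by (auto simp: S_def)
  have "w mx \<in> S" using maximal_nonzero_weight[OF mx] mx by (auto simp: S_def maximal_iff)
  then show "weyl_orbit \<Phi> (w mx) \<subseteq> S" using S_closed by (rule weyl_orbit_subset)
qed

lemma m_2_weight:
  assumes "i \<in> I" "x \<in> S" "x \<bullet> coroot (\<alpha> i) = 2"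
  shows "x = \<alpha> i"
proof -
  obtain v where v: "v \<in> verts R" "x = w v" using assms(2) by (auto simp: S_def)
  then have "m i v = 2" using assms(3) wt_inner_coroot[OF assms(1), of v] by simp
  then show ?thesis using m_2_edges[OF assms(1) v(1)] v(2) by metis
qed

text \<open>A weight in \<open>S\<close> that pairs to 2 with a simple coroot is that simple root;
  transported to all roots, this shows that only the weight itself can be the root with pairing 2.
  That the weight is a root follows because the top of a chain of length two has a simple root as
  its weight, which lies in the same orbit.\<close>

lemma quasi_minuscule_maximal:
  assumes mx: "maximal_elem R mx"
  shows "quasi_minuscule \<Phi> I \<alpha> (w mx)"
proof -
  have mxS: "w mx \<in> S" using S_eq_orbit[OF mx] weyl_orbit_self by metis
  have bound: "w mx \<bullet> coroot \<beta> \<in> {0, 1, - 1, 2, - 2}" if "\<beta> \<in> \<Phi>" for \<beta>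
  proof (rule inner_coroot_mem_if_closed[OF S_closed _ that mxS])
    fix i x assume i: "i \<in> I" and "x \<in> S"
    then obtain v where v: "v \<in> verts R" "x = w v" by (auto simp: S_def)
    then show "x \<bullet> coroot (\<alpha> i) \<in> {0, 1, - 1, 2, - 2}"
      using m_range[OF i v(1)] wt_inner_coroot[OF i, of v] by auto
  qed
  have uniq: "w mx = \<beta>" if "\<beta> \<in> \<Phi>" "w mx \<bullet> coroot \<beta> = 2" for \<beta>
    using inner_coroot_eq_2_if_closed[OF S_closed m_2_weight that(1) mxS that(2)] .
  obtain i y where i: "i \<in> I" "y \<in> verts R" "rho R i y + delta R i y \<ge> 2"
    using ex_long len_eq_rho_delta by force
  from i obtain s t u where e: "(s, i, t) \<in> edges R" "(t, i, u) \<in> edges R"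
    by (rule long_component_cases)
  have "w t = 0"
    using middle(4)[OF i(1), of t] edgeD[OF e(1)] rho_edge[OF e(1)] delta_edge[OF e(2)] by simp
  then have u: "w u = \<alpha> i" using wt_edge[OF e(2)] by simp
  have "\<alpha> i \<in> weyl_orbit \<Phi> (w mx)"
    using wt_in_orbit[OF mx, of u] edgeD[OF e(2)] u simple_nonzero[OF i(1)] by simp
  then have "w mx \<in> \<Phi>" using simple_root[OF i(1)] by (rule root_if_orbit_root)
  then have "\<exists>!\<beta>. \<beta> \<in> \<Phi> \<and> w mx \<bullet> coroot \<beta> = 2"
    using uniq root_nonzero by (intro ex1I[of _ "w mx"]) (auto simp: inner_coroot_self)
  with bound maximal_nonzero_weight[OF mx] show ?thesis
    by (simp add: quasi_minuscule_def wt_in_weights)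
qed

lemma short_root_maximal: "maximal_elem R mx \<Longrightarrow> short_root \<Phi> (w mx)"
proof -
  assume "maximal_elem R mx"
  interpret finite_irreducible_root_system \<Phi> by unfold_locales (rule irreducible)
  show ?thesis using quasi_minuscule_maximal[OF \<open>maximal_elem R mx\<close>] unfolding quasi_minuscule_def
    by (intro quasi_minuscule_short_root) auto
qed

text \<open>Weight zero makes \<open>rho\<close> equal to \<open>delta\<close> for every color; if
  all of them were 0, the vertex would be maximal.\<close>

lemma ex_zero_weight_color:
  assumes "x \<in> verts R" "w x = 0"
  shows "\<exists>i. i \<in> I \<and> rho R i x > 0 \<and> delta R i x > 0"
proof (rule ccontr)
  assume *: "\<not> ?thesis"
  have "delta R i x = 0" if "i \<in> I" for i
    using * that zero_weight_m[OF that assms(2)] by (auto simp: m_def)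
  then have "maximal_elem R x"
    unfolding maximal_iff using assms(1) delta_edge edgeD by fastforce
  then show False using maximal_nonzero_weight assms(2) by blast
qed

text \<open>A choice in form only: by \<open>middle\<close>, an interior vertex has edges of a
  single color, so the value is determined on vertices of weight zero.\<close>

definition color :: "'v \<Rightarrow> 'i" where
  "color x = (SOME i. i \<in> I \<and> rho R i x > 0 \<and> delta R i x > 0)"

lemma color:
  assumes "x \<in> verts R" "w x = 0"
  shows "color x \<in> I" "rho R (color x) x > 0" "delta R (color x) x > 0"
  using someI_ex[OF ex_zero_weight_color[OF assms]] by (simp_all add: color_def)

lemma color_eqI:
  assumes "x \<in> verts R" "w x = 0" "i \<in> I" "rho R i x > 0 \<or> delta R i x > 0"
  shows "color x = i"
proof (rule ccontr)
  assume "color x \<noteq> i"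
  then show False
    using middle(3)[OF color(1)[OF assms(1,2)] assms(1) color(2,3)[OF assms(1,2)] assms(3)] assms(4) by simp
qed

lemma zero_weight_edge_out:
  assumes "(x, i, z) \<in> edges R" "w x = 0"
  shows "color x = i" "w z = \<alpha> i"
  using color_eqI[of x i] edgeD[OF assms(1)] delta_edge[OF assms(1)] wt_edge[OF assms(1)] assms(2) by auto

lemma zero_weight_edge_in:
  assumes "(s, i, x) \<in> edges R" "w x = 0"
  shows "color x = i" "w s = - \<alpha> i"
  using color_eqI[of x i] edgeD[OF assms(1)] rho_edge[OF assms(1)] wt_edge[OF assms(1)] assms(2)
  by (auto simp: eq_neg_iff_add_eq_0)

lemma zero_weight_edges:
  assumes "x \<in> verts R" "w x = 0"
  obtains s z where "(s, color x, x) \<in> edges R" "(x, color x, z) \<in> edges R"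
    "w s = - \<alpha> (color x)" "w z = \<alpha> (color x)"
proof -
  obtain s where s: "(s, color x, x) \<in> edges R" using ex_in color[OF assms] assms by blast
  obtain z where z: "(x, color x, z) \<in> edges R" using ex_out color[OF assms] assms by blast
  show ?thesis using that[OF s z] zero_weight_edge_in(2)[OF s] zero_weight_edge_out(2)[OF z] assms by blast
qed

text \<open>The weight cannot tell apart the middles of different chains. Their color can, and it is
  the index of the corresponding bar vertex.\<close>

definition f :: "'v \<Rightarrow> 'a + 'i" where
  "f x = (if w x = 0 then Inr (color x) else Inl (w x))"

lemma f_eq_Inl: "f x = Inl \<mu> \<longleftrightarrow> w x \<noteq> 0 \<and> w x = \<mu>"
  by (simp add: f_def)

lemma f_eq_Inr: "f x = Inr i \<longleftrightarrow> w x = 0 \<and> color x = i"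
  by (simp add: f_def)

text \<open>Two middles of color \<open>i\<close> have upper neighbours of the same nonzero weight
  \<open>\<alpha> i\<close>. These coincide, and incoming edges are unique.\<close>

lemma f_inj: "inj_on f (verts R)"
proof (rule inj_onI)
  fix x y assume xy: "x \<in> verts R" "y \<in> verts R" "f x = f y"
  show "x = y"
  proof (cases "w x = 0")
    case True
    then have y: "w y = 0" "color y = color x" using xy(3) by (auto simp: f_def split: if_splits)
    obtain z where z: "(x, color x, z) \<in> edges R" "w z = \<alpha> (color x)"
      using zero_weight_edges[OF xy(1) True] by metis
    obtain z' where z': "(y, color x, z') \<in> edges R" "w z' = \<alpha> (color x)"
      using zero_weight_edges[OF xy(2) y(1)] y(2) by metis
    have "z' = z"
      using wt_inj[of z z'] edgeD[OF z(1)] edgeD[OF z'(1)] z z' simple_nonzero by simp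
    then show ?thesis using unique_in z z' by blast
  next
    case False
    then have "w y = w x" using xy(3) by (auto simp: f_def split: if_splits)
    then show ?thesis using wt_inj[OF xy(1) False xy(2)] by simp
  qed
qed

text \<open>Every bar vertex is hit because the short roots form a single orbit: a short
  \<open>\<alpha> i\<close> is itself the weight of a vertex, its coordinate \<open>i\<close> is 2,
  and just below sits a middle of color \<open>i\<close>.\<close>

lemma f_image:
  assumes mx: "maximal_elem R mx"
  shows "f ` verts R = Inl ` weyl_orbit \<Phi> (w mx) \<union> Inr ` {i \<in> I. short_root \<Phi> (\<alpha> i)}"
proof (intro equalityI subsetI)
  fix y assume "y \<in> f ` verts R"
  then obtain x where x: "x \<in> verts R" "y = f x" by auto
  show "y \<in> Inl ` weyl_orbit \<Phi> (w mx) \<union> Inr ` {i \<in> I. short_root \<Phi> (\<alpha> i)}"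
  proof (cases "w x = 0")
    case True
    then obtain z where z: "(x, color x, z) \<in> edges R" "w z = \<alpha> (color x)"
      using zero_weight_edges[OF x(1)] by metis
    have "\<alpha> (color x) \<in> weyl_orbit \<Phi> (w mx)"
      using wt_in_orbit[OF mx, of z] edgeD[OF z(1)] z(2) simple_nonzero by simp
    then have "short_root \<Phi> (\<alpha> (color x))"
      using short_root_maximal[OF mx] by (rule short_root_weyl_orbit)
    then show ?thesis using x True color(1)[OF x(1) True] by (auto simp: f_def)
  next
    case False
    then show ?thesis using wt_in_orbit[OF mx x(1)] x by (auto simp: f_def)
  qed
next
  interpret finite_irreducible_root_system \<Phi> by unfold_locales (rule irreducible)
  fix y assume "y \<in> Inl ` weyl_orbit \<Phi> (w mx) \<union> Inr ` {i \<in> I. short_root \<Phi> (\<alpha> i)}"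
  then consider u where "u \<in> weyl_orbit \<Phi> (w mx)" "y = Inl u"
    | i where "i \<in> I" "short_root \<Phi> (\<alpha> i)" "y = Inr i" by blast
  then show "y \<in> f ` verts R"
  proof cases
    case 1
    then have "u \<in> S" using S_eq_orbit[OF mx] by simp
    then obtain x where "x \<in> verts R" "w x \<noteq> 0" "u = w x" by (auto simp: S_def)
    then show ?thesis using 1 by (intro image_eqI[of _ _ x]) (auto simp: f_def)
  next
    case 2
    have "\<alpha> i \<in> S"
      using short_roots_weyl_orbit[OF short_root_maximal[OF mx] 2(2)] S_eq_orbit[OF mx] by simp
    then obtain x where x: "x \<in> verts R" "w x = \<alpha> i" by (auto simp: S_def)
    then have "m i x = 2"
      using wt_inner_coroot[OF 2(1), of x] simple_nonzero[OF 2(1)] by (simp add: inner_coroot_self)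
    then obtain t where t: "(t, i, x) \<in> edges R" "w t = 0"
      using m_2_edges[OF 2(1) x(1)] by metis
    then have "f t = y" using zero_weight_edge_out(1)[OF t] 2 by (simp add: f_def)
    then show ?thesis using edgeD[OF t(1)] by auto
  qed
qed

text \<open>From right to left, the labels show which edge must leave or enter; the vertex at its
  other end has the required nonzero weight, and injectivity of nonzero weights identifies
  it.\<close>

lemma f_edge:
  assumes mx: "maximal_elem R mx" and st: "s \<in> verts R" "t \<in> verts R"
  shows "(s, i, t) \<in> edges R \<longleftrightarrow>
    (f s, i, f t) \<in> edges (quasi_minuscule_splitting_poset \<Phi> I \<alpha> (w mx))"
proof
  assume e: "(s, i, t) \<in> edges R"
  have i: "i \<in> I" using edgeD[OF e] by simp
  have short: "short_root \<Phi> (\<alpha> (color x))" if "x \<in> verts R" "w x = 0" for x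
  proof -
    have "Inr (color x) \<in> f ` verts R" using that by (auto simp: f_def image_iff)
    then show ?thesis unfolding f_image[OF mx] by auto
  qed
  consider "w s = 0" "w t \<noteq> 0" | "w s \<noteq> 0" "w t = 0" | "w s \<noteq> 0" "w t \<noteq> 0"
    using wt_edge_ne[OF e] by blast
  then show "(f s, i, f t) \<in> edges (quasi_minuscule_splitting_poset \<Phi> I \<alpha> (w mx))"
  proof cases
    case 1
    then show ?thesis
      using zero_weight_edge_out[OF e] short[OF st(1)] i
      by (auto simp: f_def quasi_minuscule_splitting_poset_def)
  next
    case 2
    then show ?thesis
      using zero_weight_edge_in[OF e] short[OF st(2)] i
      by (auto simp: f_def quasi_minuscule_splitting_poset_def)
  next
    case 3
    then show ?thesis
      using wt_edge[OF e] wt_in_orbit[OF mx st(1)] wt_in_orbit[OF mx st(2)] i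
      by (auto simp: f_def quasi_minuscule_splitting_poset_def)
  qed
next
  assume e: "(f s, i, f t) \<in> edges (quasi_minuscule_splitting_poset \<Phi> I \<alpha> (w mx))"
  then have i: "i \<in> I" by (simp add: edges_quasi_minuscule_splitting_poset)
  from e have "w s \<noteq> 0 \<and> w t \<noteq> 0 \<and> w s + \<alpha> i = w t \<or>
      w s = - \<alpha> i \<and> w t = 0 \<and> i = color t \<or> w s = 0 \<and> w t = \<alpha> i \<and> i = color s"
    unfolding edges_quasi_minuscule_splitting_poset f_eq_Inl f_eq_Inr
    by (elim conjE disjE exE) simp_all
  then consider "w s \<noteq> 0" "w t \<noteq> 0" "w s + \<alpha> i = w t"
    | "w s = - \<alpha> i" "w t = 0" "i = color t"
    | "w s = 0" "w t = \<alpha> i" "i = color s"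
    by (elim disjE conjE)
  then show "(s, i, t) \<in> edges R"
  proof cases
    case 1
    have "w s \<bullet> coroot (\<alpha> i) = - 1"
      using weyl_orbit_add_root(1)[of "w s" "w mx" "\<alpha> i"] wt_in_orbit[OF mx st(1)] wt_in_orbit[OF mx st(2)]
        simple_root[OF i] 1 by simp
    then have "m i s = - 1" using wt_inner_coroot[OF i, of s] by simp
    then obtain t' where t': "(s, i, t') \<in> edges R" "w t' = w t"
      using m_minus_1_edge[OF i st(1)] 1(3) by metis
    then have "t' = t" using wt_inj[OF st(2) 1(2)] edgeD by blast
    with t' show ?thesis by simp
  next
    case 2
    obtain s' where s': "(s', i, t) \<in> edges R" "w s' = - \<alpha> i"
      using zero_weight_edges[OF st(2) 2(2)] 2(3) by metis
    have "s' = s" using wt_inj[of s s'] st(1) edgeD[OF s'(1)] 2 s'(2) simple_nonzero[OF i] by simp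
    with s' show ?thesis by simp
  next
    case 3
    obtain t' where t': "(s, i, t') \<in> edges R" "w t' = \<alpha> i"
      using zero_weight_edges[OF st(1) 3(1)] 3(3) by metis
    have "t' = t" using wt_inj[of t t'] st(2) edgeD[OF t'(1)] 3 t'(2) simple_nonzero[OF i] by simp
    with t' show ?thesis by simp
  qed
qed

theorem quasi_minuscule_splitting_poset_if:
  "\<exists>m. maximal_elem R m \<and> (\<forall>m'. maximal_elem R m' \<longrightarrow> m' = m) \<and>
    wt I \<alpha> R m \<in> dominant_weights I \<alpha> \<and> quasi_minuscule \<Phi> I \<alpha> (wt I \<alpha> R m) \<and>
    R \<cong>\<^sub>c quasi_minuscule_splitting_poset \<Phi> I \<alpha> (wt I \<alpha> R m)"
proof -
  obtain mx where mx: "maximal_elem R mx" using unique_maximal_elem by blast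
  have "bij_betw f (verts R) (verts (quasi_minuscule_splitting_poset \<Phi> I \<alpha> (w mx)))"
    using f_inj f_image[OF mx] by (simp add: bij_betw_def quasi_minuscule_splitting_poset_def)
  then have "R \<cong>\<^sub>c quasi_minuscule_splitting_poset \<Phi> I \<alpha> (w mx)"
    unfolding colored_iso_def using f_edge[OF mx] by blast
  moreover have "w mx \<in> dominant_weights I \<alpha>"
    using m_maximal[OF mx] by (rule wt_in_dominant_weights)
  ultimately show ?thesis using mx unique_maximal_elem quasi_minuscule_maximal[OF mx] by blast
qed

end

context ranked_poset
begin

lemma component_subset:
  assumes "x \<in> T" "\<And>s t. (s, t) \<in> step J \<Longrightarrow> s \<in> T \<longleftrightarrow> t \<in> T"
  shows "verts (component R J x) \<subseteq> T"
proof -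
  have "y \<in> T" if "(x, y) \<in> conn J" for y
    using that unfolding conn_def by (induction rule: rtrancl_induct) (use assms in auto)
  then show ?thesis by (auto simp: verts_component)
qed

end

section \<open>The orbit of short roots satisfies the axioms\<close>

context weighted_poset
begin

text \<open>The orbit is the set of all short roots, so pairings with a simple coroot are 0, 1 or -1
  except at the simple root itself and its negative. These exceptional labels are the ends of the
  strings through the bar vertices.\<close>

theorem quasi_minuscule_splitting_poset_only_if:
  assumes irreducible: "irreducible_root_system \<Phi>"
    and qm: "quasi_minuscule \<Phi> I \<alpha> lam" and cong: "R \<cong>\<^sub>c quasi_minuscule_splitting_poset \<Phi> I \<alpha> lam"
  shows "connected_digraph R" "fibrous I R" "structured I \<alpha> R"
    and "\<exists>i\<in>I. \<exists>x\<in>verts R. len R i x \<ge> 2"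
    and "\<forall>i\<in>I. \<forall>x\<in>verts R. len R i x \<ge> 2 \<longrightarrow>
      (\<exists>x\<^sub>0 x\<^sub>1 x\<^sub>2.
         color_comp R i x = \<lparr>verts = {x\<^sub>0, x\<^sub>1, x\<^sub>2}, edges = {(x\<^sub>0, i, x\<^sub>1), (x\<^sub>1, i, x\<^sub>2)}\<rparr> \<and>
         (\<forall>j\<in>I. j \<noteq> i \<longrightarrow>
            delta R j x\<^sub>0 = 0 \<and> rho R j x\<^sub>2 = 0 \<and> verts (color_comp R j x\<^sub>1) = {x\<^sub>1}))"
    and "\<forall>i\<in>I. \<forall>j\<in>I. \<alpha> i \<bullet> coroot (\<alpha> j) = 0 \<and> \<alpha> j \<bullet> coroot (\<alpha> i) = 0 \<longrightarrow>
      (\<forall>x\<in>verts R. \<exists>!m. maximal_elem (component R {i, j} x) m)"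
    and "\<forall>i\<in>I. \<forall>j\<in>I. \<alpha> i \<bullet> coroot (\<alpha> j) = - 1 \<and> \<alpha> j \<bullet> coroot (\<alpha> i) = - 1 \<longrightarrow>
      (\<forall>x\<in>verts R. \<exists>!m. maximal_elem (component R {i, j} x) m)"
proof -
  interpret finite_irreducible_root_system \<Phi> by unfold_locales (rule irreducible)
  let ?W = "weyl_orbit \<Phi> lam"
  have short: "short_root \<Phi> lam"
    using qm unfolding quasi_minuscule_def by (intro quasi_minuscule_short_root) auto
  have W_iff: "y \<in> ?W \<longleftrightarrow> short_root \<Phi> y" for y
    using short_root_weyl_orbit[OF _ short] short_roots_weyl_orbit[OF short] by blast
  have W_nz: "0 \<notin> ?W" using zero_not_root by (simp add: W_iff short_root_def)
  have W_minus: "- y \<in> ?W" if "y \<in> ?W" for y using that by (simp add: W_iff short_root_uminus)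
  have c2: "\<alpha> i \<bullet> coroot (\<alpha> i) = 2" if "i \<in> I" for i
    using simple_nonzero[OF that] by (rule inner_coroot_self)
  have c_nonpos: "\<alpha> i \<bullet> coroot (\<alpha> j) \<le> 0" if "i \<in> I" "j \<in> I" "i \<noteq> j" for i j
    using cartan_nonpos[OF that] inner_coroot_cartan[OF that(1,2)] by simp
  have \<alpha>_inj: "i = j" if "\<alpha> i = \<alpha> j" "i \<in> I" "j \<in> I" for i j
    using inj_simple that by (auto simp: inj_on_def)
  have val: "\<mu> \<bullet> coroot (\<alpha> i) \<in> {0, 1, - 1} \<or> \<mu> = \<alpha> i \<or> \<mu> = - \<alpha> i" if "\<mu> \<in> ?W" "i \<in> I" for \<mu> i
    using short_root_inner_coroot[of \<mu> "\<alpha> i"] simple_root that by (auto simp: W_iff)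

  let ?Q = "quasi_minuscule_splitting_poset \<Phi> I \<alpha> lam"
  obtain f where bij: "bij_betw f (verts R) (verts ?Q)"
    and iso: "\<And>s t i. s \<in> verts R \<Longrightarrow> t \<in> verts R \<Longrightarrow> (s, i, t) \<in> edges R \<longleftrightarrow> (f s, i, f t) \<in> edges ?Q"
    using cong unfolding colored_iso_def by auto
  have vQ: "verts ?Q = Inl ` ?W \<union> Inr ` {i \<in> I. \<alpha> i \<in> ?W}"
    by (simp add: quasi_minuscule_splitting_poset_def W_iff)
  have f_in: "f x \<in> verts ?Q" if "x \<in> verts R" for x using bij that by (auto simp: bij_betw_def)
  have f_Inl: "\<mu> \<in> ?W" if "x \<in> verts R" "f x = Inl \<mu>" for x \<mu>
    using f_in[OF that(1)] that(2) by (auto simp: vQ)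
  have f_Inr: "i \<in> I" "\<alpha> i \<in> ?W" if "x \<in> verts R" "f x = Inr i" for x i
    using f_in[OF that(1)] that(2) by (auto simp: vQ)
  have f_surj: "\<exists>x\<in>verts R. f x = y" if "y \<in> verts ?Q" for y
    using bij that unfolding bij_betw_def by (metis imageE)
  have ex_Inl: "\<exists>x\<in>verts R. f x = Inl \<mu>" if "\<mu> \<in> ?W" for \<mu> using that by (intro f_surj) (simp add: vQ)
  have ex_Inr: "\<exists>x\<in>verts R. f x = Inr i" if "i \<in> I" "\<alpha> i \<in> ?W" for i
    using that by (intro f_surj) (simp add: vQ)
  have f_inj: "x = y" if "f x = f y" "x \<in> verts R" "y \<in> verts R" for x y
    using bij that by (auto simp: bij_betw_def inj_on_def)
  \<comment> \<open>Membership of labels in the orbit and shortness of simple roots are implicit in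
    the vertices, which leaves only the three shapes of an edge.\<close>
  have edge: "(s, i, t) \<in> edges R \<longleftrightarrow> s \<in> verts R \<and> t \<in> verts R \<and> i \<in> I \<and>
      ((\<exists>\<mu>. f s = Inl \<mu> \<and> f t = Inl (\<mu> + \<alpha> i)) \<or> (f s = Inl (- \<alpha> i) \<and> f t = Inr i) \<or>
       (f s = Inr i \<and> f t = Inl (\<alpha> i)))" for s i t
  proof (cases "s \<in> verts R \<and> t \<in> verts R")
    case True
    then show ?thesis
      using iso[of s t i] f_Inl[of s] f_Inl[of t] f_Inr[of s] f_Inr[of t]
      unfolding edges_quasi_minuscule_splitting_poset by (auto simp: W_iff)
  qed (use edgeD in blast)

  \<comment> \<open>Equal length fixes the pairing at the source of an ordinary edge at -1. This
    excludes \<open>- \<alpha> i\<close>, whose pairing is -2, so the three shapes are mutually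
    exclusive.\<close>
  have out_cases: "(\<exists>\<mu>. f x = Inl \<mu> \<and> f t = Inl (\<mu> + \<alpha> i) \<and> \<mu> \<bullet> coroot (\<alpha> i) = - 1) \<or>
      f x = Inl (- \<alpha> i) \<and> f t = Inr i \<or> f x = Inr i \<and> f t = Inl (\<alpha> i)" if e: "(x, i, t) \<in> edges R" for x i t
  proof -
    have "\<mu> \<bullet> coroot (\<alpha> i) = - 1" if "f x = Inl \<mu>" "f t = Inl (\<mu> + \<alpha> i)" for \<mu>
      using weyl_orbit_add_root(1)[OF f_Inl[OF _ that(1)] f_Inl[OF _ that(2)] simple_root] edgeD[OF e] by blast
    then show ?thesis using e unfolding edge by blast
  qed
  have in_cases: "(\<exists>\<mu>. f t = Inl \<mu> \<and> f x = Inl (\<mu> - \<alpha> i) \<and> \<mu> \<bullet> coroot (\<alpha> i) = 1) \<or>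
      f x = Inl (- \<alpha> i) \<and> f t = Inr i \<or> f x = Inr i \<and> f t = Inl (\<alpha> i)" if e: "(x, i, t) \<in> edges R" for x i t
  proof -
    have "i \<in> I" using edgeD[OF e] by simp
    from out_cases[OF e] show ?thesis
      using c2[OF \<open>i \<in> I\<close>] by (auto simp: inner_add_left)
  qed
  interpret fibrous_poset I R r
  proof
    show "t = u" if e: "(s, i, t) \<in> edges R" "(s, i, u) \<in> edges R" for s i t u
    proof (rule f_inj)
      have "i \<in> I" using edgeD[OF e(1)] by simp
      then show "f t = f u" using out_cases[OF e(1)] out_cases[OF e(2)] c2[of i] by auto
    qed (use e edgeD in auto)
    show "t = u" if e: "(t, i, s) \<in> edges R" "(u, i, s) \<in> edges R" for s i t u
    proof (rule f_inj)
      have "i \<in> I" using edgeD[OF e(1)] by simp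
      then show "f t = f u" using in_cases[OF e(1)] in_cases[OF e(2)] c2[of i] by auto
    qed (use e edgeD in auto)
  qed

  have out: "\<exists>t. (x, i, t) \<in> edges R \<and> f t = Inl (\<mu> + \<alpha> i)"
    if x: "x \<in> verts R" "f x = Inl \<mu>" and i: "i \<in> I" "\<mu> \<bullet> coroot (\<alpha> i) = - 1" for x \<mu> i
  proof -
    have "\<mu> + \<alpha> i \<in> ?W"
      using weyl_orbit_reflect[OF f_Inl[OF x] simple_root[OF i(1)]] i(2)
      by (simp add: reflect_if_coroot_minus_1)
    then obtain t where "t \<in> verts R" "f t = Inl (\<mu> + \<alpha> i)" using ex_Inl by blast
    then show ?thesis using x i by (auto simp: edge)
  qed
  have inn: "\<exists>s. (s, i, x) \<in> edges R \<and> f s = Inl (\<mu> - \<alpha> i)"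
    if x: "x \<in> verts R" "f x = Inl \<mu>" and i: "i \<in> I" "\<mu> \<bullet> coroot (\<alpha> i) = 1" for x \<mu> i
  proof -
    have "\<mu> - \<alpha> i \<in> ?W"
      using weyl_orbit_reflect[OF f_Inl[OF x] simple_root[OF i(1)]] i(2)
      by (simp add: reflect_if_coroot_1)
    then obtain s where "s \<in> verts R" "f s = Inl (\<mu> - \<alpha> i)" using ex_Inl by blast
    then show ?thesis using x i by (auto simp: edge)
  qed
  have string: "\<exists>x\<^sub>0 x\<^sub>1 x\<^sub>2. (x\<^sub>0, i, x\<^sub>1) \<in> edges R \<and> (x\<^sub>1, i, x\<^sub>2) \<in> edges R \<and>
      f x\<^sub>0 = Inl (- \<alpha> i) \<and> f x\<^sub>1 = Inr i \<and> f x\<^sub>2 = Inl (\<alpha> i)" if i: "i \<in> I" "\<alpha> i \<in> ?W" for i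
    using ex_Inl[OF i(2)] ex_Inl[OF W_minus[OF i(2)]] ex_Inr[OF i] i(1) unfolding edge by metis

  have rho_Inl_0: "rho R i x = 0"
    if x: "x \<in> verts R" "f x = Inl \<mu>" and i: "\<mu> \<bullet> coroot (\<alpha> i) \<noteq> 1" "\<mu> \<noteq> \<alpha> i" for x \<mu> i
    using in_cases[of _ i x] x i by (intro rho_0) auto
  have delta_Inl_0: "delta R i x = 0"
    if x: "x \<in> verts R" "f x = Inl \<mu>" and i: "\<mu> \<bullet> coroot (\<alpha> i) \<noteq> - 1" "\<mu> \<noteq> - \<alpha> i" for x \<mu> i
    using out_cases[of x i] x i by (intro delta_0) auto
  have rho_1: "rho R i x = 1"
    if x: "x \<in> verts R" "f x = Inl \<mu>" and i: "i \<in> I" "\<mu> \<bullet> coroot (\<alpha> i) = 1" for x \<mu> i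
  proof -
    obtain s where s: "(s, i, x) \<in> edges R" "f s = Inl (\<mu> - \<alpha> i)" using inn[OF x i] by blast
    have "(\<mu> - \<alpha> i) \<bullet> coroot (\<alpha> i) = - 1" using i c2[OF i(1)] by (simp add: inner_diff_left)
    then have "rho R i s = 0"
      using edgeD[OF s(1)] s(2) c2[OF i(1)] by (intro rho_Inl_0) auto
    then show ?thesis using rho_edge[OF s(1)] by simp
  qed
  have delta_1: "delta R i x = 1"
    if x: "x \<in> verts R" "f x = Inl \<mu>" and i: "i \<in> I" "\<mu> \<bullet> coroot (\<alpha> i) = - 1" for x \<mu> i
  proof -
    obtain t where t: "(x, i, t) \<in> edges R" "f t = Inl (\<mu> + \<alpha> i)" using out[OF x i] by blast
    have "(\<mu> + \<alpha> i) \<bullet> coroot (\<alpha> i) = 1" using i c2[OF i(1)] by (simp add: inner_add_left)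
    then have "delta R i t = 0"
      using edgeD[OF t(1)] t(2) c2[OF i(1)] by (intro delta_Inl_0) auto
    then show ?thesis using delta_edge[OF t(1)] by simp
  qed
  \<comment> \<open>Only the two ends need an argument; the values in between follow by counting
    edges.\<close>
  have string_rho_delta: "rho R i x\<^sub>0 = 0" "rho R i x\<^sub>1 = 1" "rho R i x\<^sub>2 = 2"
      "delta R i x\<^sub>0 = 2" "delta R i x\<^sub>1 = 1" "delta R i x\<^sub>2 = 0"
    if e: "(x\<^sub>0, i, x\<^sub>1) \<in> edges R" "(x\<^sub>1, i, x\<^sub>2) \<in> edges R" "f x\<^sub>0 = Inl (- \<alpha> i)" "f x\<^sub>2 = Inl (\<alpha> i)" for i x\<^sub>0 x\<^sub>1 x\<^sub>2
  proof -
    have i: "i \<in> I" and V: "x\<^sub>0 \<in> verts R" "x\<^sub>2 \<in> verts R" using edgeD[OF e(1)] edgeD[OF e(2)] by auto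
    have ne: "- \<alpha> i \<noteq> \<alpha> i" using c2[OF i] by (metis inner_minus_left neg_equal_zero zero_neq_numeral)
    show "rho R i x\<^sub>0 = 0" using c2[OF i] ne by (intro rho_Inl_0[OF V(1) e(3)]) auto
    moreover show "delta R i x\<^sub>2 = 0" using c2[OF i] ne by (intro delta_Inl_0[OF V(2) e(4)]) auto
    ultimately show "rho R i x\<^sub>1 = 1" "rho R i x\<^sub>2 = 2" "delta R i x\<^sub>0 = 2" "delta R i x\<^sub>1 = 1"
      using rho_edge[OF e(1)] rho_edge[OF e(2)] delta_edge[OF e(1)] delta_edge[OF e(2)] by simp_all
  qed
  have rd_Inl_simple: "rho R i x = 2 \<and> delta R i x = 0" if x: "x \<in> verts R" "f x = Inl (\<alpha> i)" and i: "i \<in> I" for x i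
  proof -
    obtain x\<^sub>0 x\<^sub>1 x\<^sub>2 where e: "(x\<^sub>0, i, x\<^sub>1) \<in> edges R" "(x\<^sub>1, i, x\<^sub>2) \<in> edges R"
      "f x\<^sub>0 = Inl (- \<alpha> i)" "f x\<^sub>2 = Inl (\<alpha> i)"
      using string[OF i f_Inl[OF x]] by blast
    have "x = x\<^sub>2" using f_inj[of x x\<^sub>2] e(4) x edgeD[OF e(2)] by simp
    then show ?thesis using string_rho_delta[OF e] by simp
  qed
  have rd_Inl_minus: "rho R i x = 0 \<and> delta R i x = 2" if x: "x \<in> verts R" "f x = Inl (- \<alpha> i)" and i: "i \<in> I" for x i
  proof -
    have "\<alpha> i \<in> ?W" using W_minus[OF f_Inl[OF x]] by simp
    then obtain x\<^sub>0 x\<^sub>1 x\<^sub>2 where e: "(x\<^sub>0, i, x\<^sub>1) \<in> edges R" "(x\<^sub>1, i, x\<^sub>2) \<in> edges R"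
      "f x\<^sub>0 = Inl (- \<alpha> i)" "f x\<^sub>2 = Inl (\<alpha> i)"
      using string[OF i] by blast
    have "x = x\<^sub>0" using f_inj[of x x\<^sub>0] e(3) x edgeD[OF e(1)] by simp
    then show ?thesis using string_rho_delta[OF e] by simp
  qed
  have rd_Inr_same: "rho R i x = 1 \<and> delta R i x = 1" if x: "x \<in> verts R" "f x = Inr i" for x i
  proof -
    obtain x\<^sub>0 x\<^sub>1 x\<^sub>2 where e: "(x\<^sub>0, i, x\<^sub>1) \<in> edges R" "(x\<^sub>1, i, x\<^sub>2) \<in> edges R"
      "f x\<^sub>0 = Inl (- \<alpha> i)" "f x\<^sub>2 = Inl (\<alpha> i)" and e1: "f x\<^sub>1 = Inr i"
      using string[OF f_Inr[OF x]] by blast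
    have "x = x\<^sub>1" using f_inj[of x x\<^sub>1] e1 x edgeD[OF e(1)] by simp
    then show ?thesis using string_rho_delta[OF e] by simp
  qed
  have rd_Inr_other: "rho R j x = 0 \<and> delta R j x = 0" if x: "x \<in> verts R" "f x = Inr i" and j: "j \<noteq> i" for x i j
  proof
    show "rho R j x = 0" using in_cases[of _ j x] x j by (intro rho_0) auto
    show "delta R j x = 0" using out_cases[of x j] x j by (intro delta_0) auto
  qed

  \<comment> \<open>The intended weight of a vertex. A bar vertex gets 0, since \<open>rho\<close>
    and \<open>delta\<close> agree there for every color.\<close>
  define lab where "lab x = (case f x of Inl \<mu> \<Rightarrow> \<mu> | Inr i \<Rightarrow> 0)" for x
  have m_lab: "lab x \<bullet> coroot (\<alpha> i) = of_int (m i x)" if x: "x \<in> verts R" and i: "i \<in> I" for x i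
  proof (cases "f x")
    case (Inl \<mu>)
    consider "\<mu> = \<alpha> i" | "\<mu> = - \<alpha> i" | "\<mu> \<bullet> coroot (\<alpha> i) = 0" | "\<mu> \<bullet> coroot (\<alpha> i) = 1"
      | "\<mu> \<bullet> coroot (\<alpha> i) = - 1"
      using val[OF f_Inl[OF x Inl] i] by auto
    then show ?thesis
    proof cases
      case 1 then show ?thesis using rd_Inl_simple[OF x _ i] Inl c2[OF i] by (simp add: lab_def m_def)
    next
      case 2 then show ?thesis using rd_Inl_minus[OF x _ i] Inl c2[OF i] by (simp add: lab_def m_def)
    next
      case 3
      then have "rho R i x = 0" using c2[OF i] by (intro rho_Inl_0[OF x Inl]) auto
      moreover have "delta R i x = 0" using 3 c2[OF i] by (intro delta_Inl_0[OF x Inl]) auto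
      ultimately show ?thesis using 3 Inl by (simp add: lab_def m_def)
    next
      case 4
      then have "delta R i x = 0" using c2[OF i] by (intro delta_Inl_0[OF x Inl]) auto
      then show ?thesis using 4 Inl rho_1[OF x Inl i 4] by (simp add: lab_def m_def)
    next
      case 5
      then have "rho R i x = 0" using c2[OF i] by (intro rho_Inl_0[OF x Inl]) auto
      then show ?thesis using 5 Inl delta_1[OF x Inl i 5] by (simp add: lab_def m_def)
    qed
  next
    case (Inr j)
    have "rho R i x = delta R i x"
      using rd_Inr_same[OF x, of i] rd_Inr_other[OF x Inr, of i] Inr by (cases "i = j") auto
    then show ?thesis using Inr by (simp add: lab_def m_def)
  qed
  have wt: "wt I \<alpha> R x = lab x" if "x \<in> verts R" for x
    using m_lab[OF that] by (rule wt_eqI)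

  show "fibrous I R" by (rule fibrous)
  show "structured I \<alpha> R"
    unfolding structured_def
  proof (clarify)
    fix s i t assume e: "(s, i, t) \<in> edges R"
    then show "wt I \<alpha> R s + \<alpha> i = wt I \<alpha> R t"
      using edgeD[OF e] by (auto simp: wt edge lab_def)
  qed
  show "\<exists>i\<in>I. \<exists>x\<in>verts R. len R i x \<ge> 2"
  proof -
    obtain i where i: "i \<in> I" "short_root \<Phi> (\<alpha> i)" using ex_short_simple_root[OF short] by blast
    then obtain x where x: "x \<in> verts R" "f x = Inr i" using ex_Inr W_iff by blast
    then have "len R i x \<ge> 2" using rd_Inr_same[OF x] by (simp add: len_eq_rho_delta)
    then show ?thesis using i x by blast
  qed
  show "\<forall>i\<in>I. \<forall>x\<in>verts R. len R i x \<ge> 2 \<longrightarrow>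
      (\<exists>x\<^sub>0 x\<^sub>1 x\<^sub>2.
         color_comp R i x = \<lparr>verts = {x\<^sub>0, x\<^sub>1, x\<^sub>2}, edges = {(x\<^sub>0, i, x\<^sub>1), (x\<^sub>1, i, x\<^sub>2)}\<rparr> \<and>
         (\<forall>j\<in>I. j \<noteq> i \<longrightarrow>
            delta R j x\<^sub>0 = 0 \<and> rho R j x\<^sub>2 = 0 \<and> verts (color_comp R j x\<^sub>1) = {x\<^sub>1}))"
  proof (intro ballI impI)
    fix i x assume i: "i \<in> I" and x: "x \<in> verts R" and l: "len R i x \<ge> 2"
    then have rd: "rho R i x + delta R i x \<ge> 2" by (simp add: len_eq_rho_delta)
    \<comment> \<open>At every other label the chain of color \<open>i\<close> has length at most
      1.\<close>
    have fx: "f x = Inl (\<alpha> i) \<or> f x = Inl (- \<alpha> i) \<or> f x = Inr i"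
    proof (cases "f x")
      case (Inl \<mu>)
      show ?thesis
      proof (rule ccontr)
        assume "\<not> ?thesis"
        then have ne: "\<mu> \<noteq> \<alpha> i" "\<mu> \<noteq> - \<alpha> i" using Inl by auto
        then consider "\<mu> \<bullet> coroot (\<alpha> i) = 0" | "\<mu> \<bullet> coroot (\<alpha> i) = 1" | "\<mu> \<bullet> coroot (\<alpha> i) = - 1"
          using val[OF f_Inl[OF x Inl] i] by auto
        then show False
        proof cases
          case 1
          then show ?thesis using rd rho_Inl_0[OF x Inl _ ne(1)] delta_Inl_0[OF x Inl _ ne(2)] by simp
        next
          case 2
          then show ?thesis using rd rho_1[OF x Inl i] delta_Inl_0[OF x Inl _ ne(2)] by simp
        next
          case 3
          then show ?thesis using rd delta_1[OF x Inl i] rho_Inl_0[OF x Inl _ ne(1)] by simp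
        qed
      qed
    next
      case (Inr j)
      then show ?thesis using rd rd_Inr_other[OF x Inr, of i] by fastforce
    qed
    then have "\<alpha> i \<in> ?W"
      using f_Inl[OF x] f_Inr[OF x] W_minus[of "- \<alpha> i"] by auto
    then obtain x\<^sub>0 x\<^sub>1 x\<^sub>2 where e: "(x\<^sub>0, i, x\<^sub>1) \<in> edges R" "(x\<^sub>1, i, x\<^sub>2) \<in> edges R"
      "f x\<^sub>0 = Inl (- \<alpha> i)" "f x\<^sub>2 = Inl (\<alpha> i)" and f1: "f x\<^sub>1 = Inr i"
      using string[OF i] by blast
    have V: "x\<^sub>0 \<in> verts R" "x\<^sub>1 \<in> verts R" "x\<^sub>2 \<in> verts R" using edgeD[OF e(1)] edgeD[OF e(2)] by auto
    have x_in: "x \<in> {x\<^sub>0, x\<^sub>1, x\<^sub>2}" using fx e f1 f_inj V x by (metis insertCI)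
    have no_in: "(s, i, x\<^sub>0) \<notin> edges R" for s
      using string_rho_delta(1)[OF e] rho_edge[of s i x\<^sub>0] by auto
    have no_out: "(x\<^sub>2, i, t) \<notin> edges R" for t
      using string_rho_delta(6)[OF e] delta_edge[of x\<^sub>2 i t] by auto
    \<comment> \<open>Together with \<open>E'\<close> this makes the string closed under edges of
      color \<open>i\<close>, so that it is the whole component.\<close>
    have E: "s \<in> {x\<^sub>0, x\<^sub>1, x\<^sub>2} \<and> (s, i, t) \<in> edges R \<longleftrightarrow> (s, t) \<in> {(x\<^sub>0, x\<^sub>1), (x\<^sub>1, x\<^sub>2)}" for s t
      using e(1,2) no_out unique_out by blast
    have E': "t \<in> {x\<^sub>0, x\<^sub>1, x\<^sub>2} \<and> (s, i, t) \<in> edges R \<longleftrightarrow> (s, t) \<in> {(x\<^sub>0, x\<^sub>1), (x\<^sub>1, x\<^sub>2)}" for s t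
      using e(1,2) no_in unique_in by blast
    have vx: "verts (color_comp R i x) = {x\<^sub>0, x\<^sub>1, x\<^sub>2}"
    proof
      show "verts (color_comp R i x) \<subseteq> {x\<^sub>0, x\<^sub>1, x\<^sub>2}"
      proof (rule component_subset[OF x_in])
        fix s t assume "(s, t) \<in> step {i}"
        then have "(s, i, t) \<in> edges R" by (simp add: step_def)
        then show "s \<in> {x\<^sub>0, x\<^sub>1, x\<^sub>2} \<longleftrightarrow> t \<in> {x\<^sub>0, x\<^sub>1, x\<^sub>2}" using E[of s t] E'[of t s] by blast
      qed
      have "color_comp R i x\<^sub>0 = color_comp R i x" "color_comp R i x\<^sub>1 = color_comp R i x"
        "color_comp R i x\<^sub>2 = color_comp R i x"
        using x_in color_comp_edge[OF e(1)] color_comp_edge[OF e(2)] by auto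
      then show "{x\<^sub>0, x\<^sub>1, x\<^sub>2} \<subseteq> verts (color_comp R i x)"
        using self_in_component V by (metis empty_subsetI insert_subset)
    qed
    have "(s, k, t) \<in> edges (color_comp R i x) \<longleftrightarrow> (s, k, t) \<in> {(x\<^sub>0, i, x\<^sub>1), (x\<^sub>1, i, x\<^sub>2)}" for s k t
      using E[of s t] unfolding edges_component vx by (cases "k = i") (simp_all add: conj_commute)
    then have ex: "edges (color_comp R i x) = {(x\<^sub>0, i, x\<^sub>1), (x\<^sub>1, i, x\<^sub>2)}"
      by (simp only: set_eq_iff split_paired_All simp_thms)
    have "color_comp R i x = \<lparr>verts = {x\<^sub>0, x\<^sub>1, x\<^sub>2}, edges = {(x\<^sub>0, i, x\<^sub>1), (x\<^sub>1, i, x\<^sub>2)}\<rparr>"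
      by (rule colored_digraph.equality) (simp_all add: vx ex)
    moreover have "delta R j x\<^sub>0 = 0 \<and> rho R j x\<^sub>2 = 0 \<and> verts (color_comp R j x\<^sub>1) = {x\<^sub>1}"
      if j: "j \<in> I" "j \<noteq> i" for j
    proof (intro conjI)
      have ne: "\<alpha> i \<noteq> \<alpha> j" using \<alpha>_inj[OF _ i j(1)] j(2) by blast
      \<comment> \<open>Nonpositive Cartan integers make the pairing of \<open>- \<alpha> i\<close>
        with the other coroot nonnegative, so no edge of color \<open>j\<close> leaves the bottom;
        dually, none enters the top.\<close>
      have le: "\<alpha> i \<bullet> coroot (\<alpha> j) \<le> 0" using c_nonpos[OF i j(1)] j(2) by blast
      show "delta R j x\<^sub>0 = 0" using ne le by (intro delta_Inl_0[OF V(1) e(3)]) auto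
      show "rho R j x\<^sub>2 = 0" using ne le by (intro rho_Inl_0[OF V(3) e(4)]) auto
      have "verts (color_comp R j x\<^sub>1) \<subseteq> {x\<^sub>1}"
      proof (rule component_subset)
        fix s t assume "(s, t) \<in> step {j}"
        then have st: "(s, j, t) \<in> edges R" by (simp add: step_def)
        show "s \<in> {x\<^sub>1} \<longleftrightarrow> t \<in> {x\<^sub>1}"
          using rd_Inr_other[OF V(2) f1 j(2)] rho_edge[OF st] delta_edge[OF st] by auto
      qed simp
      then show "verts (color_comp R j x\<^sub>1) = {x\<^sub>1}" using self_in_component[OF V(2)] by blast
    qed
    ultimately show "\<exists>x\<^sub>0 x\<^sub>1 x\<^sub>2.
         color_comp R i x = \<lparr>verts = {x\<^sub>0, x\<^sub>1, x\<^sub>2}, edges = {(x\<^sub>0, i, x\<^sub>1), (x\<^sub>1, i, x\<^sub>2)}\<rparr> \<and>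
         (\<forall>j\<in>I. j \<noteq> i \<longrightarrow>
            delta R j x\<^sub>0 = 0 \<and> rho R j x\<^sub>2 = 0 \<and> verts (color_comp R j x\<^sub>1) = {x\<^sub>1})"
      by blast
  qed

  show "connected_digraph R"
  proof -
    obtain x0 where x0: "x0 \<in> verts R" "f x0 = Inl lam" using ex_Inl[OF weyl_orbit_self] by blast
    \<comment> \<open>Only labels in the orbit are tracked. A reflection that exchanges
      \<open>\<alpha> i\<close> and its negative travels through the bar vertex, and the bar
      vertices are attached afterwards by the edges above them.\<close>
    define S where "S = {\<mu>. \<exists>x\<in>verts R. f x = Inl \<mu> \<and> (x0, x) \<in> conn I}"
    have SI: "\<mu> \<in> S" if "x \<in> verts R" "f x = Inl \<mu>" "(x0, x) \<in> conn I" for x \<mu>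
      using that by (auto simp: S_def)
    have up: "(x0, t) \<in> conn I" if "(s, i, t) \<in> edges R" "(x0, s) \<in> conn I" for s i t
      using that conn_trans[OF _ step_conn[OF stepI]] edgeD[OF that(1)] by blast
    have down: "(x0, s) \<in> conn I" if "(s, i, t) \<in> edges R" "(x0, t) \<in> conn I" for s i t
      using that conn_trans[OF _ conn_sym[OF step_conn[OF stepI]]] edgeD[OF that(1)] by blast
    have "?W \<subseteq> S"
    proof (rule weyl_orbit_subset)
      show "lam \<in> S" using x0 conn_refl by (rule SI)
      fix i \<mu> assume i: "i \<in> I" and "\<mu> \<in> S"
      then obtain x where x: "x \<in> verts R" "f x = Inl \<mu>" "(x0, x) \<in> conn I" by (auto simp: S_def)
      consider "\<mu> = \<alpha> i" | "\<mu> = - \<alpha> i" | "\<mu> \<bullet> coroot (\<alpha> i) = 0" | "\<mu> \<bullet> coroot (\<alpha> i) = 1"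
        | "\<mu> \<bullet> coroot (\<alpha> i) = - 1"
        using val[OF f_Inl[OF x(1,2)] i] by auto
      then show "reflect (\<alpha> i) \<mu> \<in> S"
      proof cases
        case 1
        then obtain y0 y1 y2 where y: "(y0, i, y1) \<in> edges R" "(y1, i, y2) \<in> edges R"
          "f y0 = Inl (- \<alpha> i)" "f y2 = Inl (\<alpha> i)"
          using string[OF i] f_Inl[OF x(1,2)] by blast
        have "y2 = x" using f_inj[of y2 x] y(4) x 1 edgeD[OF y(2)] by simp
        then have "(x0, y0) \<in> conn I" using down[OF y(1) down[OF y(2)]] x(3) by simp
        then have "- \<alpha> i \<in> S" using SI[OF _ y(3)] edgeD[OF y(1)] by simp
        then show ?thesis using 1 simple_nonzero[OF i] by (simp add: reflect_self)
      next
        case 2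
        then have "\<alpha> i \<in> ?W" using W_minus[OF f_Inl[OF x(1,2)]] by simp
        then obtain y0 y1 y2 where y: "(y0, i, y1) \<in> edges R" "(y1, i, y2) \<in> edges R"
          "f y0 = Inl (- \<alpha> i)" "f y2 = Inl (\<alpha> i)"
          using string[OF i] by blast
        have "y0 = x" using f_inj[of y0 x] y(3) x 2 edgeD[OF y(1)] by simp
        then have "(x0, y2) \<in> conn I" using up[OF y(2) up[OF y(1)]] x(3) by simp
        then have "\<alpha> i \<in> S" using SI[OF _ y(4)] edgeD[OF y(2)] by simp
        then show ?thesis using 2 simple_nonzero[OF i] by (simp add: reflect_minus reflect_self)
      next
        case 3
        then show ?thesis using \<open>\<mu> \<in> S\<close> by (simp add: reflect_if_coroot_0)
      next
        case 4
        then obtain s where s: "(s, i, x) \<in> edges R" "f s = Inl (\<mu> - \<alpha> i)" using inn[OF x(1,2) i] by blast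
        then show ?thesis
          using SI[OF _ s(2) down[OF s(1) x(3)]] edgeD[OF s(1)] 4 by (simp add: reflect_if_coroot_1)
      next
        case 5
        then obtain t where t: "(x, i, t) \<in> edges R" "f t = Inl (\<mu> + \<alpha> i)" using out[OF x(1,2) i] by blast
        then show ?thesis
          using SI[OF _ t(2) up[OF t(1) x(3)]] edgeD[OF t(1)] 5 by (simp add: reflect_if_coroot_minus_1)
      qed
    qed
    then have Inl: "(x0, y) \<in> conn I" if "y \<in> verts R" "f y = Inl \<mu>" for y \<mu>
      using f_Inl[OF that] f_inj that unfolding S_def by (smt (verit) mem_Collect_eq subsetD)
    have "(x0, y) \<in> conn I" if y: "y \<in> verts R" for y
    proof (cases "f y")
      case (Inr i)
      obtain z where z: "z \<in> verts R" "f z = Inl (\<alpha> i)" using ex_Inl[OF f_Inr(2)[OF y Inr]] by blast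
      then have "(y, i, z) \<in> edges R" using y Inr f_Inr(1)[OF y Inr] by (simp add: edge)
      then show ?thesis using down Inl[OF z] by blast
    qed (use Inl y in blast)
    then show ?thesis unfolding connected_iff using conn_trans conn_sym by blast
  qed

  have peak: "\<exists>v. (t, v) \<in> (step {i, j})\<^sup>* \<and> (u, v) \<in> (step {i, j})\<^sup>*"
    if c: "\<alpha> i \<bullet> coroot (\<alpha> j) = 0 \<and> \<alpha> j \<bullet> coroot (\<alpha> i) = 0 \<or>
        \<alpha> i \<bullet> coroot (\<alpha> j) = - 1 \<and> \<alpha> j \<bullet> coroot (\<alpha> i) = - 1"
      and st: "(s, i, t) \<in> edges R" and su: "(s, j, u) \<in> edges R" for s i j t u
  proof -
    have I: "i \<in> I" "j \<in> I" and V: "s \<in> verts R" "t \<in> verts R" "u \<in> verts R"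
      using edgeD[OF st] edgeD[OF su] by auto
    have ij: "i \<noteq> j" using c c2[OF I(1)] by auto
    have ne: "\<alpha> i \<noteq> \<alpha> j" using \<alpha>_inj[OF _ I] ij by blast
    \<comment> \<open>A bar vertex has edges of one color only, and \<open>- \<alpha> i\<close>
      pairs with the other coroot to 0 or 1. A source with edges of both colors is therefore an
      ordinary label with both pairings -1.\<close>
    obtain \<mu> where \<mu>: "f s = Inl \<mu>" "f t = Inl (\<mu> + \<alpha> i)" "f u = Inl (\<mu> + \<alpha> j)"
      "\<mu> \<bullet> coroot (\<alpha> i) = - 1" "\<mu> \<bullet> coroot (\<alpha> j) = - 1"
      using out_cases[OF st] out_cases[OF su] ij ne c by auto
    have joined: "\<exists>v. (x, v) \<in> step {i, j} \<and> (y, v) \<in> step {i, j}"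
      if "(x, k, v) \<in> edges R" "(y, l, v') \<in> edges R" "f v = f v'" "k \<in> {i, j}" "l \<in> {i, j}" for x y v v' k l
    proof -
      have "v = v'" using f_inj that edgeD by blast
      then show ?thesis using that stepI by blast
    qed
    from c show ?thesis
    proof
      assume o: "\<alpha> i \<bullet> coroot (\<alpha> j) = 0 \<and> \<alpha> j \<bullet> coroot (\<alpha> i) = 0"
      obtain v where v: "(t, j, v) \<in> edges R" "f v = Inl (\<mu> + \<alpha> i + \<alpha> j)"
        using out[OF V(2) \<mu>(2) I(2)] \<mu> o by (auto simp: inner_add_left)
      obtain v' where v': "(u, i, v') \<in> edges R" "f v' = Inl (\<mu> + \<alpha> j + \<alpha> i)"
        using out[OF V(3) \<mu>(3) I(1)] \<mu> o by (auto simp: inner_add_left)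
      show ?thesis using joined[OF v(1) v'(1)] v(2) v'(2) by (auto simp: add_ac)
    next
      assume o: "\<alpha> i \<bullet> coroot (\<alpha> j) = - 1 \<and> \<alpha> j \<bullet> coroot (\<alpha> i) = - 1"
      \<comment> \<open>One edge lowers the other pairing to -2, which among short roots happens
        only at the negative of that simple root. Both sides then climb a full string of length two
        and meet at \<open>\<alpha> i + \<alpha> j\<close>, closing the hexagon.\<close>
      have "(\<mu> + \<alpha> i) \<bullet> coroot (\<alpha> j) = - 2" "(\<mu> + \<alpha> j) \<bullet> coroot (\<alpha> i) = - 2"
        using \<mu> o by (simp_all add: inner_add_left)
      then have t: "\<mu> + \<alpha> i = - \<alpha> j" and u: "\<mu> + \<alpha> j = - \<alpha> i"
        using val[OF f_Inl[OF V(2) \<mu>(2)] I(2)] val[OF f_Inl[OF V(3) \<mu>(3)] I(1)] c2[OF I(1)] c2[OF I(2)]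
        by auto
      have W: "\<alpha> i \<in> ?W" "\<alpha> j \<in> ?W"
        using W_minus[OF f_Inl[OF V(2) \<mu>(2)]] W_minus[OF f_Inl[OF V(3) \<mu>(3)]] by (simp_all only: t u minus_minus)
      obtain a0 a1 a2 where a: "(a0, j, a1) \<in> edges R" "(a1, j, a2) \<in> edges R"
        "f a0 = Inl (- \<alpha> j)" "f a2 = Inl (\<alpha> j)" using string[OF I(2) W(2)] by blast
      obtain b0 b1 b2 where b: "(b0, i, b1) \<in> edges R" "(b1, i, b2) \<in> edges R"
        "f b0 = Inl (- \<alpha> i)" "f b2 = Inl (\<alpha> i)" using string[OF I(1) W(1)] by blast
      have "a0 = t" "b0 = u"
        using f_inj[of a0 t] f_inj[of b0 u] a b \<mu> t u V edgeD[OF a(1)] edgeD[OF b(1)] by simp_all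
      moreover have "(a0, a2) \<in> (step {i, j})\<^sup>*" "(b0, b2) \<in> (step {i, j})\<^sup>*"
        using stepI[OF a(1), of "{i, j}"] stepI[OF a(2), of "{i, j}"]
          stepI[OF b(1), of "{i, j}"] stepI[OF b(2), of "{i, j}"] by auto
      moreover obtain v where v: "(a2, i, v) \<in> edges R" "f v = Inl (\<alpha> j + \<alpha> i)"
        using out[OF _ a(4) I(1)] edgeD[OF a(2)] o by blast
      moreover obtain v' where v': "(b2, j, v') \<in> edges R" "f v' = Inl (\<alpha> i + \<alpha> j)"
        using out[OF _ b(4) I(2)] edgeD[OF b(2)] o by blast
      moreover have "\<exists>v. (a2, v) \<in> step {i, j} \<and> (b2, v) \<in> step {i, j}"
        using v v' by (intro joined[OF v(1) v'(1)]) (auto simp: add.commute)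
      ultimately show ?thesis by (meson rtrancl_into_rtrancl)
    qed
  qed
  have unique: "\<exists>!m. maximal_elem (component R {i, j} x) m"
    if c: "\<alpha> i \<bullet> coroot (\<alpha> j) = 0 \<and> \<alpha> j \<bullet> coroot (\<alpha> i) = 0 \<or>
        \<alpha> i \<bullet> coroot (\<alpha> j) = - 1 \<and> \<alpha> j \<bullet> coroot (\<alpha> i) = - 1" and x: "x \<in> verts R" for i j x
  proof (rule unique_maximal_component[OF x])
    fix s t u assume "(s, t) \<in> step {i, j}" "(s, u) \<in> step {i, j}"
    then consider "t = u" | "(s, i, t) \<in> edges R" "(s, j, u) \<in> edges R"
      | "(s, j, t) \<in> edges R" "(s, i, u) \<in> edges R"
      using unique_out by (auto simp: step_def)
    then show "\<exists>v. (t, v) \<in> (step {i, j})\<^sup>* \<and> (u, v) \<in> (step {i, j})\<^sup>*"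
    proof cases
      case 2 then show ?thesis using peak c by blast
    next
      case 3 then show ?thesis using peak[of i j s u t] c by blast
    qed blast
  qed
  show "\<forall>i\<in>I. \<forall>j\<in>I. \<alpha> i \<bullet> coroot (\<alpha> j) = 0 \<and> \<alpha> j \<bullet> coroot (\<alpha> i) = 0 \<longrightarrow>
      (\<forall>x\<in>verts R. \<exists>!m. maximal_elem (component R {i, j} x) m)"
    using unique by blast
  show "\<forall>i\<in>I. \<forall>j\<in>I. \<alpha> i \<bullet> coroot (\<alpha> j) = - 1 \<and> \<alpha> j \<bullet> coroot (\<alpha> i) = - 1 \<longrightarrow>
      (\<forall>x\<in>verts R. \<exists>!m. maximal_elem (component R {i, j} x) m)"
    using unique by blast
qed

lemma structured_posetI:
  assumes "connected_digraph R" "fibrous I R" "structured I \<alpha> R"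
  shows "structured_poset \<Phi> I \<alpha> R r"
  by unfold_locales (use assms fibrous_unique_out fibrous_unique_in in blast)+

theorem minuscule_splitting_poset_unique_maximal:
  assumes "connected_digraph R" "fibrous I R" "structured I \<alpha> R" "edges R \<noteq> {}"
    and "\<forall>i\<in>I. \<forall>x\<in>verts R. len R i x \<le> 1"
    and "\<forall>i\<in>I. \<forall>j\<in>I. \<alpha> i \<bullet> coroot (\<alpha> j) = 0 \<and> \<alpha> j \<bullet> coroot (\<alpha> i) = 0 \<longrightarrow>
      (\<forall>x\<in>verts R. \<exists>!m. maximal_elem (component R {i, j} x) m)"
  shows "\<exists>m. maximal_elem R m \<and> (\<forall>m'. maximal_elem R m' \<longrightarrow> m' = m) \<and>
    wt I \<alpha> R m \<in> dominant_weights I \<alpha> \<and> minuscule \<Phi> I \<alpha> (wt I \<alpha> R m) \<and>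
    R \<cong>\<^sub>c minuscule_splitting_poset \<Phi> I \<alpha> (wt I \<alpha> R m)"
proof -
  interpret structured_poset \<Phi> I \<alpha> R r using assms(1-3) by (rule structured_posetI)
  show ?thesis using assms(4-6) by (intro minuscule_splitting_poset_if) blast+
qed

theorem quasi_minuscule_splitting_poset_unique_maximal:
  assumes "irreducible_root_system \<Phi>"
    and "connected_digraph R" "fibrous I R" "structured I \<alpha> R"
    and "\<exists>i\<in>I. \<exists>x\<in>verts R. len R i x \<ge> 2"
    and "\<forall>i\<in>I. \<forall>x\<in>verts R. len R i x \<ge> 2 \<longrightarrow>
      (\<exists>x\<^sub>0 x\<^sub>1 x\<^sub>2.
         color_comp R i x = \<lparr>verts = {x\<^sub>0, x\<^sub>1, x\<^sub>2}, edges = {(x\<^sub>0, i, x\<^sub>1), (x\<^sub>1, i, x\<^sub>2)}\<rparr> \<and>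
         (\<forall>j\<in>I. j \<noteq> i \<longrightarrow>
            delta R j x\<^sub>0 = 0 \<and> rho R j x\<^sub>2 = 0 \<and> verts (color_comp R j x\<^sub>1) = {x\<^sub>1}))"
    and "\<forall>i\<in>I. \<forall>j\<in>I. \<alpha> i \<bullet> coroot (\<alpha> j) = 0 \<and> \<alpha> j \<bullet> coroot (\<alpha> i) = 0 \<longrightarrow>
      (\<forall>x\<in>verts R. \<exists>!m. maximal_elem (component R {i, j} x) m)"
    and "\<forall>i\<in>I. \<forall>j\<in>I. \<alpha> i \<bullet> coroot (\<alpha> j) = - 1 \<and> \<alpha> j \<bullet> coroot (\<alpha> i) = - 1 \<longrightarrow>
      (\<forall>x\<in>verts R. \<exists>!m. maximal_elem (component R {i, j} x) m)"
  shows "\<exists>m. maximal_elem R m \<and> (\<forall>m'. maximal_elem R m' \<longrightarrow> m' = m) \<and>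
    wt I \<alpha> R m \<in> dominant_weights I \<alpha> \<and> quasi_minuscule \<Phi> I \<alpha> (wt I \<alpha> R m) \<and>
    R \<cong>\<^sub>c quasi_minuscule_splitting_poset \<Phi> I \<alpha> (wt I \<alpha> R m)"
proof -
  interpret structured_poset \<Phi> I \<alpha> R r using assms(2-4) by (rule structured_posetI)
  interpret quasi_minuscule_like_poset \<Phi> I \<alpha> R r
  proof
    show "irreducible_root_system \<Phi>" by (rule assms(1))
    show "\<exists>i\<in>I. \<exists>x\<in>verts R. len R i x \<ge> 2" by (rule assms(5))
  qed ((rule assms(6)[rule_format]; assumption), (rule assms(7)[rule_format]; (intro conjI)?; assumption),
      (rule assms(8)[rule_format]; (intro conjI)?; assumption))
  show ?thesis by (rule quasi_minuscule_splitting_poset_if)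
qed

end

theorem theorem4p16:
  fixes \<Phi> :: "'a::euclidean_space set" and I :: "'i set" and \<alpha> :: "'i \<Rightarrow> 'a"
    and R :: "('v, 'i) colored_digraph"
  assumes "irreducible_root_system \<Phi>"
    and "simple_roots \<Phi> I \<alpha>"
    and "edge_colored_poset I R"
    and "ranked R"
  shows
    "(is_minuscule_splitting_poset \<Phi> I \<alpha> R \<longleftrightarrow>
       connected_digraph R \<and> fibrous I R \<and> structured I \<alpha> R \<and> edges R \<noteq> {} \<and>
       (\<forall>i\<in>I. \<forall>x\<in>verts R. len R i x \<le> 1) \<and>
       (\<forall>i\<in>I. \<forall>j\<in>I. \<alpha> i \<bullet> coroot (\<alpha> j) = 0 \<and> \<alpha> j \<bullet> coroot (\<alpha> i) = 0 \<longrightarrow>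
          (\<forall>x\<in>verts R. \<exists>!m. maximal_elem (component R {i, j} x) m)))
     \<and>
     (is_minuscule_splitting_poset \<Phi> I \<alpha> R \<longrightarrow>
       (\<exists>m. maximal_elem R m \<and> (\<forall>m'. maximal_elem R m' \<longrightarrow> m' = m) \<and>
         wt I \<alpha> R m \<in> dominant_weights I \<alpha> \<and> minuscule \<Phi> I \<alpha> (wt I \<alpha> R m) \<and>
         R \<cong>\<^sub>c minuscule_splitting_poset \<Phi> I \<alpha> (wt I \<alpha> R m)))
     \<and>
     (is_quasi_minuscule_splitting_poset \<Phi> I \<alpha> R \<longleftrightarrow>
       connected_digraph R \<and> fibrous I R \<and> structured I \<alpha> R \<and>
       (\<exists>i\<in>I. \<exists>x\<in>verts R. len R i x \<ge> 2) \<and>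
       (\<forall>i\<in>I. \<forall>x\<in>verts R. len R i x \<ge> 2 \<longrightarrow>
          (\<exists>x\<^sub>0 x\<^sub>1 x\<^sub>2.
             color_comp R i x = \<lparr>verts = {x\<^sub>0, x\<^sub>1, x\<^sub>2}, edges = {(x\<^sub>0, i, x\<^sub>1), (x\<^sub>1, i, x\<^sub>2)}\<rparr> \<and>
             (\<forall>j\<in>I. j \<noteq> i \<longrightarrow>
                delta R j x\<^sub>0 = 0 \<and> rho R j x\<^sub>2 = 0 \<and> verts (color_comp R j x\<^sub>1) = {x\<^sub>1}))) \<and>
       (\<forall>i\<in>I. \<forall>j\<in>I. \<alpha> i \<bullet> coroot (\<alpha> j) = 0 \<and> \<alpha> j \<bullet> coroot (\<alpha> i) = 0 \<longrightarrow>
          (\<forall>x\<in>verts R. \<exists>!m. maximal_elem (component R {i, j} x) m)) \<and>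
       (\<forall>i\<in>I. \<forall>j\<in>I. \<alpha> i \<bullet> coroot (\<alpha> j) = - 1 \<and> \<alpha> j \<bullet> coroot (\<alpha> i) = - 1 \<longrightarrow>
          (\<forall>x\<in>verts R. \<exists>!m. maximal_elem (component R {i, j} x) m)))
     \<and>
     (is_quasi_minuscule_splitting_poset \<Phi> I \<alpha> R \<longrightarrow>
       (\<exists>m. maximal_elem R m \<and> (\<forall>m'. maximal_elem R m' \<longrightarrow> m' = m) \<and>
         wt I \<alpha> R m \<in> dominant_weights I \<alpha> \<and> quasi_minuscule \<Phi> I \<alpha> (wt I \<alpha> R m) \<and>
         R \<cong>\<^sub>c quasi_minuscule_splitting_poset \<Phi> I \<alpha> (wt I \<alpha> R m)))"
proof -
  obtain r l where "rank_function R r l" using assms(4) by (auto simp: ranked_def)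
  then have r: "r s + 1 = r t" if "(s, i, t) \<in> edges R" for s i t
    using that unfolding rank_function_def arcs_def by blast
  interpret weighted_poset \<Phi> I \<alpha> R r
  proof
    show "root_system \<Phi>" using assms(1) by (simp add: irreducible_root_system_def)
    show "simple_roots \<Phi> I \<alpha>" by (rule assms(2))
    show "finite (verts R)" "edges R \<subseteq> verts R \<times> I \<times> verts R"
      using assms(3) by (simp_all add: edge_colored_poset_def)
  qed (use r in force)
  \<comment> \<open>Each equivalence and its conclusion follow from a cycle of three implications:
    the conclusion itself exhibits the weight demanded by the definition of a splitting
    poset.\<close>
  have logic: "(P1 \<longleftrightarrow> Q1) \<and> (P1 \<longrightarrow> C1) \<and> (P2 \<longleftrightarrow> Q2) \<and> (P2 \<longrightarrow> C2)"
    if "P1 \<Longrightarrow> Q1" "Q1 \<Longrightarrow> C1" "C1 \<Longrightarrow> P1" "P2 \<Longrightarrow> Q2" "Q2 \<Longrightarrow> C2" "C2 \<Longrightarrow> P2"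
    for P1 Q1 C1 P2 Q2 C2 :: bool
    using that by blast
  show ?thesis
    apply (rule logic)
    subgoal
      unfolding is_minuscule_splitting_poset_def
      by (elim exE conjE, intro conjI; rule minuscule_splitting_poset_only_if; assumption)
    subgoal
      by (elim conjE, rule minuscule_splitting_poset_unique_maximal; assumption)
    subgoal unfolding is_minuscule_splitting_poset_def by blast
    subgoal
      unfolding is_quasi_minuscule_splitting_poset_def
      by (elim exE conjE, intro conjI;
          rule quasi_minuscule_splitting_poset_only_if[OF assms(1)]; assumption)
    subgoal
      by (elim conjE, rule quasi_minuscule_splitting_poset_unique_maximal[OF assms(1)]; assumption)
    subgoal unfolding is_quasi_minuscule_splitting_poset_def by blast
    done
qed

end
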